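(* Let $(M,g)$ be a compact, connected, smooth Riemannian manifold of dimension $n\ge 2$, and let $\mu$ be a finite Borel measure on $M$. Fix $u\in(0,n)$ and suppose that the Riesz energy $I_u(\mu)$ is finite. Then there exists a constant $C_1=C_1(M,g,u,\mu)$ such that $$\sum_{\lambda_j\le\lambda}\Bigl|\int_M e_j\,d\mu\Bigr|^2\le C_1\,\lambda^{n-u}\qquad\text{for all }\lambda\ge1.$$ In particular, if $\mu$ has correlation dimension $\dim_C(\mu)=s$ for some $s\in(0,n)$, then $I_u(\mu)<\infty$ for every $u\in(0,s)$, and hence for each $\varepsilon>0$ there exists a constant $C_2=C_2(M,g,s,\varepsilon,\mu)$ such that $$\sum_{\lambda_j\le\lambda}\Bigl|\int_M e_j\,d\mu\Bigr|^2\le C_2\,\lambda^{n-s+\varepsilon}\qquad\text{for all }\lambda\ge1.$$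
   Context: Let $\{e_j\}_{j\ge 0}$ be a complete orthonormal basis of $L^2(M)$ consisting of real Laplace eigenfunctions, $-\Delta_g e_j=\lambda_j^2 e_j$, with $0=\lambda_0<\lambda_1\le\lambda_2\le\cdots$. Let $d_g$ be the Riemannian distance. For $0<u<n$ the Riesz energy is $$I_u(\mu):=\iint d_g(x,y)^{-u}\,d\mu(x)\,d\mu(y).$$ The distance distribution of $\mu$ is $F(r):=(\mu\times\mu)(\{(x,y)\in M\times M: d_g(x,y)\le r\})$, $r\ge0$, and, when the limit exists, the correlation dimension of $\mu$ is $$\dim_C(\mu):=\lim_{r\to0^+}\frac{\log F(r)}{\log r}.$$ *)

theory Defs
  imports "HOL-Analysis.Analysis"
begin

section \<open>Smooth maps on open subsets of normed spaces\<close>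

primrec higher_differentiable_on ::
  "'a::real_normed_vector set \<Rightarrow> ('a \<Rightarrow> 'b::real_normed_vector) \<Rightarrow> nat \<Rightarrow> bool"
where
  "higher_differentiable_on S f 0 \<longleftrightarrow> continuous_on S f"
| "higher_differentiable_on S f (Suc k) \<longleftrightarrow>
     (\<forall>x\<in>S. f differentiable (at x)) \<and>
     (\<forall>v. higher_differentiable_on S (\<lambda>x. frechet_derivative f (at x) v) k)"

definition smooth_on :: "'a::real_normed_vector set \<Rightarrow> ('a \<Rightarrow> 'b::real_normed_vector) \<Rightarrow> bool"
  where "smooth_on S f \<longleftrightarrow> (\<forall>k. higher_differentiable_on S f k)"

definition partial_deriv :: "'n::finite \<Rightarrow> (real^'n \<Rightarrow> real) \<Rightarrow> real^'n \<Rightarrow> real"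
  where "partial_deriv i f x = frechet_derivative f (at x) (axis i 1)"


section \<open>Smooth manifolds\<close>

text \<open>The manifold is the whole type \<open>'m\<close>, with the topology given by its type class; the dimension
  is \<open>CARD('n)\<close>.  A chart is a pair of a domain \<open>U\<close> and a total function whose values outside \<open>U\<close>
  are irrelevant.\<close>

type_synonym ('m, 'n) chart = "'m set \<times> ('m \<Rightarrow> real^'n)"

abbreviation dom_chart :: "('m, 'n) chart \<Rightarrow> 'm set" where "dom_chart \<equiv> fst"

abbreviation coord :: "('m, 'n) chart \<Rightarrow> 'm \<Rightarrow> real^'n" where "coord \<equiv> snd"

abbreviation coord_image :: "('m, 'n) chart \<Rightarrow> (real^'n) set"
  where "coord_image c \<equiv> coord c ` dom_chart c"

abbreviation inv_coord :: "('m, 'n) chart \<Rightarrow> real^'n \<Rightarrow> 'm"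
  where "inv_coord c \<equiv> inv_into (dom_chart c) (coord c)"

definition is_chart :: "('m::topological_space, 'n::finite) chart \<Rightarrow> bool"
  where "is_chart c \<longleftrightarrow> open (dom_chart c) \<and> open (coord_image c) \<and>
    homeomorphism (dom_chart c) (coord_image c) (coord c) (inv_coord c)"

text \<open>A smooth structure is given by any (not necessarily maximal) smooth atlas.\<close>

definition smooth_atlas :: "('m::topological_space, 'n::finite) chart set \<Rightarrow> bool"
  where "smooth_atlas A \<longleftrightarrow>
    (\<forall>c\<in>A. is_chart c) \<and> (\<Union>c\<in>A. dom_chart c) = UNIV \<and>
    (\<forall>c\<in>A. \<forall>c'\<in>A. smooth_on (coord c ` (dom_chart c \<inter> dom_chart c')) (coord c' \<circ> inv_coord c))"

definition smooth_function :: "('m, 'n::finite) chart set \<Rightarrow> ('m \<Rightarrow> real) \<Rightarrow> bool"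
  where "smooth_function A f \<longleftrightarrow> (\<forall>c\<in>A. smooth_on (coord_image c) (f \<circ> inv_coord c))"

text \<open>A chart of the atlas around \<open>p\<close>, used to evaluate coordinate expressions that do not depend
  on the chart.\<close>

definition chart_at :: "('m, 'n) chart set \<Rightarrow> 'm \<Rightarrow> ('m, 'n) chart"
  where "chart_at A p = (SOME c. c \<in> A \<and> p \<in> dom_chart c)"


section \<open>Riemannian metrics\<close>

text \<open>A metric is given by its components: \<open>g c p\<close>, for \<open>p\<close> in the domain of \<open>c\<close>, is the Gram matrix
  of the coordinate vector fields of \<open>c\<close> at \<open>p\<close>.  The last condition is the transformation law of a
  covariant 2-tensor.\<close>

type_synonym ('m, 'n) metric_components = "('m, 'n) chart \<Rightarrow> 'm \<Rightarrow> real^'n^'n"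

definition transition_jacobian :: "('m, 'n) chart \<Rightarrow> ('m, 'n) chart \<Rightarrow> 'm \<Rightarrow> real^'n::finite^'n"
  where "transition_jacobian c c' p =
    matrix (frechet_derivative (coord c' \<circ> inv_coord c) (at (coord c p)))"

definition riemannian_metric ::
  "('m, 'n::finite) chart set \<Rightarrow> ('m, 'n) metric_components \<Rightarrow> bool"
  where "riemannian_metric A g \<longleftrightarrow>
    (\<forall>c\<in>A. smooth_on (coord_image c) (g c \<circ> inv_coord c)) \<and>
    (\<forall>c\<in>A. \<forall>p\<in>dom_chart c. transpose (g c p) = g c p \<and> (\<forall>v. v \<noteq> 0 \<longrightarrow> v \<bullet> (g c p *v v) > 0)) \<and>
    (\<forall>c\<in>A. \<forall>c'\<in>A. \<forall>p\<in>dom_chart c \<inter> dom_chart c'.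
       g c p = transpose (transition_jacobian c c' p) ** g c' p ** transition_jacobian c c' p)"

definition riemannian_manifold ::
  "('m::{t2_space, second_countable_topology}, 'n::finite) chart set \<Rightarrow>
   ('m, 'n) metric_components \<Rightarrow> bool"
  where "riemannian_manifold A g \<longleftrightarrow> smooth_atlas A \<and> riemannian_metric A g"


subsection \<open>Riemannian distance\<close>

text \<open>Derivatives at the end points of \<open>{a..b}\<close> are one-sided.\<close>

definition C1_curve_on ::
  "('m::topological_space, 'n::finite) chart set \<Rightarrow> real \<Rightarrow> real \<Rightarrow> (real \<Rightarrow> 'm) \<Rightarrow> bool"
  where "C1_curve_on A a b \<gamma> \<longleftrightarrow> continuous_on {a..b} \<gamma> \<and>
    (\<forall>c\<in>A. let T = {t\<in>{a..b}. \<gamma> t \<in> dom_chart c} in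
       (\<forall>t\<in>T. (coord c \<circ> \<gamma>) differentiable (at t within {a..b})) \<and>
       continuous_on T (\<lambda>t. vector_derivative (coord c \<circ> \<gamma>) (at t within {a..b})))"

definition piecewise_C1_curve ::
  "('m::topological_space, 'n::finite) chart set \<Rightarrow> (real \<Rightarrow> 'm) \<Rightarrow> bool"
  where "piecewise_C1_curve A \<gamma> \<longleftrightarrow>
    (\<exists>P. finite P \<and> {0, 1} \<subseteq> P \<and> P \<subseteq> {0..1} \<and>
       (\<forall>a\<in>P. \<forall>b\<in>P. a < b \<and> {a<..<b} \<inter> P = {} \<longrightarrow> C1_curve_on A a b \<gamma>))"

definition speed ::
  "('m, 'n::finite) chart set \<Rightarrow> ('m, 'n) metric_components \<Rightarrow> (real \<Rightarrow> 'm) \<Rightarrow> real \<Rightarrow> real"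
  where "speed A g \<gamma> t =
    (let c = chart_at A (\<gamma> t); v = vector_derivative (coord c \<circ> \<gamma>) (at t)
     in sqrt (v \<bullet> (g c (\<gamma> t) *v v)))"

text \<open>The speed is a junk value at the (finitely many) corners and end points of a piecewise
  \<open>C\<^sup>1\<close> curve; this does not affect the integral.\<close>

definition curve_length ::
  "('m, 'n::finite) chart set \<Rightarrow> ('m, 'n) metric_components \<Rightarrow> (real \<Rightarrow> 'm) \<Rightarrow> real"
  where "curve_length A g \<gamma> = integral {0..1} (speed A g \<gamma>)"

definition riemannian_dist ::
  "('m::topological_space, 'n::finite) chart set \<Rightarrow> ('m, 'n) metric_components \<Rightarrow> 'm \<Rightarrow> 'm \<Rightarrow> real"
  where "riemannian_dist A g x y =
    Inf {curve_length A g \<gamma> | \<gamma>. piecewise_C1_curve A \<gamma> \<and> \<gamma> 0 = x \<and> \<gamma> 1 = y}"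


subsection \<open>Riemannian volume\<close>

definition is_riemannian_volume ::
  "('m::topological_space, 'n::finite) chart set \<Rightarrow> ('m, 'n) metric_components \<Rightarrow> 'm measure \<Rightarrow> bool"
  where "is_riemannian_volume A g \<nu> \<longleftrightarrow> sets \<nu> = sets borel \<and>
    (\<forall>c\<in>A. \<forall>B\<in>sets borel. B \<subseteq> dom_chart c \<longrightarrow>
       emeasure \<nu> B = (\<integral>\<^sup>+x\<in>coord c ` B. ennreal (sqrt (det (g c (inv_coord c x)))) \<partial>lborel))"

text \<open>Uniquely determined, since countably many charts cover a second countable manifold; the local
  densities are compatible by the change of variables formula.\<close>

definition riemannian_volume ::
  "('m::topological_space, 'n::finite) chart set \<Rightarrow> ('m, 'n) metric_components \<Rightarrow> 'm measure"
  where "riemannian_volume A g = (THE \<nu>. is_riemannian_volume A g \<nu>)"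


subsection \<open>Laplace--Beltrami operator\<close>

definition laplacian_in_chart ::
  "('m, 'n::finite) metric_components \<Rightarrow> ('m, 'n) chart \<Rightarrow> ('m \<Rightarrow> real) \<Rightarrow> 'm \<Rightarrow> real"
  where "laplacian_in_chart g c f p =
    (let G = (\<lambda>x. g c (inv_coord c x)); h = f \<circ> inv_coord c; x0 = coord c p
     in (1 / sqrt (det (G x0))) *
        (\<Sum>i\<in>UNIV. partial_deriv i
           (\<lambda>x. sqrt (det (G x)) * (\<Sum>j\<in>UNIV. matrix_inv (G x) $ i $ j * partial_deriv j h x)) x0))"

definition laplace_beltrami ::
  "('m, 'n::finite) chart set \<Rightarrow> ('m, 'n) metric_components \<Rightarrow> ('m \<Rightarrow> real) \<Rightarrow> 'm \<Rightarrow> real"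
  where "laplace_beltrami A g f p = laplacian_in_chart g (chart_at A p) f p"


section \<open>Orthonormal bases of Laplace eigenfunctions\<close>

definition square_integrable :: "'m measure \<Rightarrow> ('m \<Rightarrow> real) \<Rightarrow> bool"
  where "square_integrable \<nu> f \<longleftrightarrow> f \<in> borel_measurable \<nu> \<and> integrable \<nu> (\<lambda>x. (f x)\<^sup>2)"

definition L2_inner :: "'m measure \<Rightarrow> ('m \<Rightarrow> real) \<Rightarrow> ('m \<Rightarrow> real) \<Rightarrow> real"
  where "L2_inner \<nu> f h = (\<integral>x. f x * h x \<partial>\<nu>)"

definition complete_orthonormal_basis :: "'m measure \<Rightarrow> (nat \<Rightarrow> 'm \<Rightarrow> real) \<Rightarrow> bool"
  where "complete_orthonormal_basis \<nu> e \<longleftrightarrow>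
    (\<forall>j. square_integrable \<nu> (e j)) \<and>
    (\<forall>i j. L2_inner \<nu> (e i) (e j) = (if i = j then 1 else 0)) \<and>
    (\<forall>f. square_integrable \<nu> f \<longrightarrow>
       (\<lambda>N. \<integral>x. (f x - (\<Sum>j<N. L2_inner \<nu> f (e j) * e j x))\<^sup>2 \<partial>\<nu>) \<longlonglongrightarrow> 0)"

definition laplace_eigenbasis ::
  "('m::topological_space, 'n::finite) chart set \<Rightarrow> ('m, 'n) metric_components \<Rightarrow>
   (nat \<Rightarrow> real) \<Rightarrow> (nat \<Rightarrow> 'm \<Rightarrow> real) \<Rightarrow> bool"
  where "laplace_eigenbasis A g lam e \<longleftrightarrow>
    complete_orthonormal_basis (riemannian_volume A g) e \<and>
    (\<forall>j. smooth_function A (e j)) \<and>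
    (\<forall>j p. - laplace_beltrami A g (e j) p = (lam j)\<^sup>2 * e j p) \<and>
    lam 0 = 0 \<and> 0 < lam 1 \<and> (\<forall>j\<ge>1. lam j \<le> lam (Suc j))"

text \<open>The index set below is finite on a compact manifold.  The sum is taken in \<open>ennreal\<close> because a
  real-valued \<open>sum\<close> over an infinite set would be 0 by convention.\<close>

definition spectral_sum ::
  "(nat \<Rightarrow> real) \<Rightarrow> (nat \<Rightarrow> 'm \<Rightarrow> real) \<Rightarrow> 'm measure \<Rightarrow> real \<Rightarrow> ennreal"
  where "spectral_sum lam e \<mu> \<Lambda> =
    (\<Sum>\<^sub>\<infinity>j\<in>{j. lam j \<le> \<Lambda>}. ennreal (\<bar>\<integral>x. e j x \<partial>\<mu>\<bar>\<^sup>2))"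


section \<open>Riesz energy and correlation dimension\<close>

text \<open>For \<open>u > 0\<close> the integrand is \<open>\<infinity>\<close> on the diagonal, as \<open>inverse 0 = \<infinity>\<close> in \<open>ennreal\<close>;
  the real number \<open>0 powr (- u)\<close> would be \<open>0\<close>.\<close>

definition riesz_energy ::
  "('m::topological_space, 'n::finite) chart set \<Rightarrow> ('m, 'n) metric_components \<Rightarrow> real \<Rightarrow>
   'm measure \<Rightarrow> ennreal"
  where "riesz_energy A g u \<mu> =
    (\<integral>\<^sup>+x. (\<integral>\<^sup>+y. inverse (ennreal (riemannian_dist A g x y powr u)) \<partial>\<mu>) \<partial>\<mu>)"

definition distance_distribution ::
  "('m::topological_space, 'n::finite) chart set \<Rightarrow> ('m, 'n) metric_components \<Rightarrow> 'm measure \<Rightarrow>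
   real \<Rightarrow> real"
  where "distance_distribution A g \<mu> r =
    measure (\<mu> \<Otimes>\<^sub>M \<mu>) {(x, y). riemannian_dist A g x y \<le> r}"

text \<open>On a compact manifold the distance distribution is positive on \<open>(0, \<infinity>)\<close> unless \<open>\<mu> = 0\<close>.  For
  \<open>\<mu> = 0\<close> the convention \<open>ln 0 = 0\<close> yields the limit \<open>0\<close>, which is not a value \<open>s > 0\<close>.\<close>

definition has_correlation_dimension ::
  "('m::topological_space, 'n::finite) chart set \<Rightarrow> ('m, 'n) metric_components \<Rightarrow> 'm measure \<Rightarrow>
   real \<Rightarrow> bool"
  where "has_correlation_dimension A g \<mu> s \<longleftrightarrow>
    ((\<lambda>r. ln (distance_distribution A g \<mu> r) / ln r) \<longlongrightarrow> s) (at_right 0)"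

end

theory Submission
  imports Defs
begin

text \<open>Let \<open>f = \<Sum> \<mu>\<^sub>j e\<^sub>j\<close> over finitely many \<open>\<lambda>\<^sub>j \<le> \<Lambda>\<close>, where \<open>\<mu>\<^sub>j = \<integral> e\<^sub>j d\<mu>\<close>; then
  \<open>S = \<Sum> \<mu>\<^sub>j\<^sup>2\<close> equals both \<open>\<integral> f d\<mu>\<close> and the squared \<open>L\<^sup>2\<close> norm of \<open>f\<close>.  Put
  \<open>F\<^sub>m = \<Sum> \<mu>\<^sub>j (\<lambda>\<^sub>j/\<Lambda>)\<^bsup>2m\<^esup> e\<^sub>j\<close>, so that \<open>\<Delta> F\<^sub>m = - \<Lambda>\<^sup>2 F\<^bsub>m+1\<^esub>\<close> and all \<open>F\<^sub>m\<close> have squared norm at most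
  \<open>S\<close>.  In a chart, comparing the value at a point with means over ellipsoids adapted to the metric
  at that point gives a local \<open>L\<^sup>1\<close> mean value estimate, and absorbing its error terms yields
  \<open>\<bar>f(x)\<bar> \<le> C R\<^bsup>-n\<^esup> \<Sum> 2\<^bsup>-m\<^esup> \<integral> \<bar>F\<^sub>m\<bar>\<close> with integrals over the ball of radius \<open>R = \<kappa>/\<Lambda>\<close> about \<open>x\<close>.
  Integrating against \<open>\<mu>\<close> brings in the masses \<open>N(y) = \<mu>(B(y, R))\<close>, for which
  \<open>\<integral> N\<^sup>2 \<le> C R\<^bsup>n+u\<^esup> I\<^sub>u(\<mu>)\<close>, as only pairs at distance \<open>O(R)\<close> contribute.  With AM-GM this
  gives \<open>S \<le> S/2 + C \<Lambda>\<^bsup>n-u\<^esup> I\<^sub>u(\<mu>)\<close>.  Neither the heat kernel nor Weyl's law is needed.\<close>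

subsection \<open>Continuously differentiable functions\<close>

text \<open>The chain of the F_m is forced: a sum of eigenfunctions satisfies no single equation, so
  its Laplacian is controlled only by the next member of the chain. At radius kappa/Lambda the
  square of the radius compensates the factor Lambda^2 of the Laplacian, which is why each link
  costs only a factor 1/2. The chain is cut after k links with remainder 2^-k times a supremum
  bound; that bound depends on the finite sum considered, so it is removed by letting k tend to
  infinity in the very last inequality. The index set is an arbitrary finite set of j with
  \<open>lam j\<close> at most Lambda; constants uniform in it pass to \<open>spectral_sum\<close>.

  Two features of the definitions shape the rest. The volume is a definite description and the
  Laplacian is evaluated in a chosen chart, so existence, uniqueness and chart independence precede
  any computation in a fixed chart. And the Riemannian distance is not known to be measurable: it
  enters through one-sided comparisons of nonnegative integrals, and in the second part through
  sublevel sets whose measurability the correlation dimension itself supplies.\<close>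

definition C1_on :: "(real^'n::finite) set \<Rightarrow> (real^'n \<Rightarrow> real) \<Rightarrow> bool"
  where "C1_on V f \<longleftrightarrow> (\<forall>x\<in>V. f differentiable (at x)) \<and> (\<forall>i. continuous_on V (partial_deriv i f))"

lemma partial_deriv_eqI:
  "(f has_derivative D) (at x) \<Longrightarrow> partial_deriv i f x = D (axis i 1)"
  unfolding partial_deriv_def by (metis frechet_derivative_at)

lemma C1_onI:
  assumes "\<And>x. x \<in> V \<Longrightarrow> (f has_derivative f' x) (at x)"
    and "\<And>i. continuous_on V (\<lambda>x. f' x (axis i 1))"
  shows "C1_on V f"
proof -
  have "continuous_on V (partial_deriv i f)" for i
    using assms(2)[of i] by (rule continuous_on_eq) (simp add: partial_deriv_eqI[OF assms(1)])
  then show ?thesis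
    using assms(1) by (auto simp: C1_on_def differentiable_def)
qed

lemma C1_on_differentiable: "C1_on V f \<Longrightarrow> x \<in> V \<Longrightarrow> f differentiable (at x)"
  by (simp add: C1_on_def)

lemma C1_on_continuous_partial: "C1_on V f \<Longrightarrow> continuous_on V (partial_deriv i f)"
  by (simp add: C1_on_def)

lemma C1_on_continuous: "C1_on V f \<Longrightarrow> continuous_on V f"
  by (simp add: C1_on_def continuous_at_imp_continuous_on differentiable_imp_continuous_within)

lemma C1_on_subset: "C1_on V f \<Longrightarrow> U \<subseteq> V \<Longrightarrow> C1_on U f"
  by (auto simp: C1_on_def intro: continuous_on_subset)

lemma vector_eq_sum_axis: "(v :: real^'n::finite) = (\<Sum>i\<in>UNIV. v $ i *\<^sub>R axis i 1)"
  by (simp add: vec_eq_iff axis_def if_distrib[of "(*) _"] cong: if_cong)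

lemma has_derivative_partial_deriv:
  fixes f :: "real^'n::finite \<Rightarrow> real"
  assumes "f differentiable (at x)"
  shows "(f has_derivative (\<lambda>v. \<Sum>i\<in>UNIV. v $ i * partial_deriv i f x)) (at x)"
proof -
  let ?D = "frechet_derivative f (at x)"
  have D: "(f has_derivative ?D) (at x)"
    using assms frechet_derivative_works by blast
  then have lin: "linear ?D" by (rule has_derivative_linear)
  have "?D v = (\<Sum>i\<in>UNIV. v $ i * partial_deriv i f x)" for v
  proof -
    have "?D v = ?D (\<Sum>i\<in>UNIV. v $ i *\<^sub>R axis i 1)"
      using vector_eq_sum_axis[of v] by simp
    also have "\<dots> = (\<Sum>i\<in>UNIV. v $ i * partial_deriv i f x)"
      by (simp add: linear_sum[OF lin] linear_scale[OF lin] partial_deriv_def)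
    finally show ?thesis .
  qed
  then have "?D = (\<lambda>v. \<Sum>i\<in>UNIV. v $ i * partial_deriv i f x)" by auto
  with D show ?thesis by simp
qed

lemma has_derivative_cong_open:
  assumes "(f has_derivative D) (at x)" "open V" "x \<in> V" "\<And>y. y \<in> V \<Longrightarrow> f y = k y"
  shows "(k has_derivative D) (at x)"
  using assms has_derivative_transform_within_open by blast

lemma differentiable_cong_open:
  assumes "f differentiable (at x)" "open V" "x \<in> V" "\<And>y. y \<in> V \<Longrightarrow> f y = k y"
  shows "k differentiable (at x)"
  using assms has_derivative_cong_open unfolding differentiable_def by blast

lemma partial_deriv_cong_open:
  assumes "open V" "x \<in> V" "\<And>y. y \<in> V \<Longrightarrow> f y = k y"
  shows "partial_deriv i f x = partial_deriv i k x"
proof -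
  have "(f has_derivative D) (at x) \<longleftrightarrow> (k has_derivative D) (at x)" for D
    using assms has_derivative_cong_open[of f D x V k] has_derivative_cong_open[of k D x V f] by auto
  then show ?thesis by (simp add: partial_deriv_def frechet_derivative_def)
qed

lemma C1_on_cong_open:
  assumes "C1_on V f" "open V" "\<And>y. y \<in> V \<Longrightarrow> f y = k y"
  shows "C1_on V k"
  unfolding C1_on_def
proof (intro conjI ballI allI)
  fix x assume "x \<in> V"
  then show "k differentiable (at x)"
    using assms differentiable_cong_open C1_on_differentiable by blast
next
  fix i
  show "continuous_on V (partial_deriv i k)"
    using C1_on_continuous_partial[OF assms(1)]
    by (rule continuous_on_eq) (use assms partial_deriv_cong_open in blast)
qed

lemma partial_deriv_const [simp]: "partial_deriv i (\<lambda>x. c) x = 0"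
  by (rule partial_deriv_eqI[OF has_derivative_const])

lemma C1_on_const [intro, simp]: "C1_on V (\<lambda>x. c)"
  by (rule C1_onI[where f' = "\<lambda>x v. 0"]) auto

lemma C1_on_component [intro]: "C1_on V (\<lambda>x. x $ j)"
  by (rule C1_onI[where f' = "\<lambda>x v. v $ j"])
     (auto intro: bounded_linear_imp_has_derivative bounded_linear_vec_nth)

lemma partial_deriv_add:
  assumes "f differentiable (at x)" "k differentiable (at x)"
  shows "partial_deriv i (\<lambda>x. f x + k x) x = partial_deriv i f x + partial_deriv i k x"
proof -
  from assms obtain D E where "(f has_derivative D) (at x)" "(k has_derivative E) (at x)"
    unfolding differentiable_def by blast
  then show ?thesis
    using partial_deriv_eqI[OF has_derivative_add[of f D "at x" k E]] partial_deriv_eqI[of f D x]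
      partial_deriv_eqI[of k E x] by simp
qed

lemma partial_deriv_mult:
  assumes "f differentiable (at x)" "k differentiable (at x)"
  shows "partial_deriv i (\<lambda>x. f x * k x) x = f x * partial_deriv i k x + partial_deriv i f x * k x"
proof -
  from assms obtain D E where "(f has_derivative D) (at x)" "(k has_derivative E) (at x)"
    unfolding differentiable_def by blast
  then show ?thesis
    using partial_deriv_eqI[OF has_derivative_mult[of f D x UNIV k E]] partial_deriv_eqI[of f D x]
      partial_deriv_eqI[of k E x] by simp
qed

lemma C1_on_add [intro]:
  assumes "C1_on V f" "C1_on V k"
  shows "C1_on V (\<lambda>x. f x + k x)"
  unfolding C1_on_def
proof (intro conjI ballI allI)
  show "(\<lambda>x. f x + k x) differentiable (at x)" if "x \<in> V" for x
    using that assms by (auto simp: C1_on_def)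
  show "continuous_on V (partial_deriv i (\<lambda>x. f x + k x))" for i
    by (rule continuous_on_eq[where f = "\<lambda>x. partial_deriv i f x + partial_deriv i k x"])
       (auto intro!: continuous_intros C1_on_continuous_partial assms
          simp: partial_deriv_add C1_on_differentiable[OF assms(1)] C1_on_differentiable[OF assms(2)])
qed

lemma C1_on_mult [intro]:
  assumes "C1_on V f" "C1_on V k"
  shows "C1_on V (\<lambda>x. f x * k x)"
  unfolding C1_on_def
proof (intro conjI ballI allI)
  show "(\<lambda>x. f x * k x) differentiable (at x)" if "x \<in> V" for x
    using that assms by (auto simp: C1_on_def)
  fix i
  have "continuous_on V (\<lambda>x. f x * partial_deriv i k x + partial_deriv i f x * k x)"
    by (intro continuous_on_add continuous_on_mult C1_on_continuous_partial[OF assms(1)]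
        C1_on_continuous_partial[OF assms(2)] C1_on_continuous[OF assms(1)] C1_on_continuous[OF assms(2)])
  then show "continuous_on V (partial_deriv i (\<lambda>x. f x * k x))"
    by (rule continuous_on_eq)
      (simp add: partial_deriv_mult C1_on_differentiable[OF assms(1)] C1_on_differentiable[OF assms(2)])
qed

lemma C1_on_uminus [intro]: "C1_on V f \<Longrightarrow> C1_on V (\<lambda>x. - f x)"
  using C1_on_mult[of V "\<lambda>_. -1" f] by simp

lemma C1_on_diff [intro]: "C1_on V f \<Longrightarrow> C1_on V k \<Longrightarrow> C1_on V (\<lambda>x. f x - k x)"
  using C1_on_add[of V f "\<lambda>x. - k x"] by auto

lemma C1_on_sum [intro]: "(\<And>a. a \<in> S \<Longrightarrow> C1_on V (f a)) \<Longrightarrow> C1_on V (\<lambda>x. \<Sum>a\<in>S. f a x)"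
  by (induction S rule: infinite_finite_induct) auto

lemma C1_on_prod [intro]: "(\<And>a. a \<in> S \<Longrightarrow> C1_on V (f a)) \<Longrightarrow> C1_on V (\<lambda>x. \<Prod>a\<in>S. f a x)"
  by (induction S rule: infinite_finite_induct) auto

lemma partial_deriv_uminus:
  "f differentiable (at x) \<Longrightarrow> partial_deriv i (\<lambda>x. - f x) x = - partial_deriv i f x"
  using partial_deriv_mult[of "\<lambda>_. -1" x f i] by simp

lemma partial_deriv_diff:
  "f differentiable (at x) \<Longrightarrow> k differentiable (at x) \<Longrightarrow>
    partial_deriv i (\<lambda>x. f x - k x) x = partial_deriv i f x - partial_deriv i k x"
  using partial_deriv_add[of f x "\<lambda>x. - k x" i] by (simp add: partial_deriv_uminus)

lemma partial_deriv_sum: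
  "finite S \<Longrightarrow> (\<And>a. a \<in> S \<Longrightarrow> f a differentiable (at x)) \<Longrightarrow>
    partial_deriv i (\<lambda>x. \<Sum>a\<in>S. f a x) x = (\<Sum>a\<in>S. partial_deriv i (f a) x)"
  by (induction S rule: finite_induct) (auto simp: partial_deriv_add)

lemma partial_deriv_compose_real:
  assumes "f differentiable (at x)" "(p has_real_derivative p') (at (f x))"
  shows "partial_deriv i (\<lambda>x. p (f x)) x = p' * partial_deriv i f x"
proof -
  have "((\<lambda>x. p (f x)) has_derivative (\<lambda>v. p' * (\<Sum>i\<in>UNIV. v $ i * partial_deriv i f x))) (at x)"
    using has_derivative_compose[OF has_derivative_partial_deriv[OF assms(1)]
        has_field_derivative_imp_has_derivative[OF assms(2)]] by simp
  from partial_deriv_eqI[OF this, of i] show ?thesis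
    by (simp add: axis_def if_distrib[of "\<lambda>t. t * _"] cong: if_cong)
qed

lemma C1_on_compose_real:
  assumes f: "C1_on V f" and p: "\<And>x. x \<in> V \<Longrightarrow> (p has_real_derivative p' (f x)) (at (f x))"
    and cont: "continuous_on (f ` V) p'"
  shows "C1_on V (\<lambda>x. p (f x))"
  unfolding C1_on_def
proof (intro conjI ballI allI)
  show "(\<lambda>x. p (f x)) differentiable (at x)" if "x \<in> V" for x
    using has_derivative_compose[OF has_derivative_partial_deriv[OF C1_on_differentiable[OF f that]]
        has_field_derivative_imp_has_derivative[OF p[OF that]]] by (auto simp: differentiable_def)
  show "continuous_on V (partial_deriv i (\<lambda>x. p (f x)))" for i
    by (rule continuous_on_eq[where f = "\<lambda>x. p' (f x) * partial_deriv i f x"])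
       (auto intro!: continuous_intros C1_on_continuous_partial f continuous_on_compose2[OF cont]
          C1_on_continuous[OF f] simp: partial_deriv_compose_real[OF C1_on_differentiable[OF f] p])
qed

lemma C1_on_inverse:
  assumes "C1_on V f" "\<And>x. x \<in> V \<Longrightarrow> f x \<noteq> 0"
  shows "C1_on V (\<lambda>x. inverse (f x))"
  by (rule C1_on_compose_real[where p' = "\<lambda>t. - (inverse t * inverse t)"])
     (auto intro!: assms continuous_intros derivative_eq_intros simp: assms(2) power2_eq_square)

lemma C1_on_divide:
  assumes "C1_on V f" "C1_on V k" "\<And>x. x \<in> V \<Longrightarrow> k x \<noteq> 0"
  shows "C1_on V (\<lambda>x. f x / k x)"
  unfolding divide_inverse by (intro C1_on_mult C1_on_inverse assms) auto

lemma C1_on_sqrt: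
  assumes "C1_on V f" "\<And>x. x \<in> V \<Longrightarrow> f x > 0"
  shows "C1_on V (\<lambda>x. sqrt (f x))"
  by (rule C1_on_compose_real[where p' = "\<lambda>t. inverse (sqrt t) / 2"])
     (use assms(2) in \<open>force intro!: assms continuous_intros derivative_eq_intros\<close>)+

lemma partial_deriv_affine:
  assumes "f differentiable (at (a + c *\<^sub>R z))"
  shows "partial_deriv i (\<lambda>z. f (a + c *\<^sub>R z)) z = c * partial_deriv i f (a + c *\<^sub>R z)"
    and "(\<lambda>z. f (a + c *\<^sub>R z)) differentiable (at z)"
proof -
  have "((\<lambda>z. a + c *\<^sub>R z) has_derivative (\<lambda>v. c *\<^sub>R v)) (at z)"
    by (auto intro!: derivative_eq_intros)
  from has_derivative_compose[OF this has_derivative_partial_deriv[OF assms]]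
  have D: "((\<lambda>z. f (a + c *\<^sub>R z)) has_derivative
      (\<lambda>v. \<Sum>i\<in>UNIV. (c *\<^sub>R v) $ i * partial_deriv i f (a + c *\<^sub>R z))) (at z)" .
  from partial_deriv_eqI[OF this, of i]
  show "partial_deriv i (\<lambda>z. f (a + c *\<^sub>R z)) z = c * partial_deriv i f (a + c *\<^sub>R z)"
    by (simp add: axis_def if_distrib[of "\<lambda>t. t * _"] if_distrib[of "\<lambda>t. _ * t"] cong: if_cong)
  from D show "(\<lambda>z. f (a + c *\<^sub>R z)) differentiable (at z)" by (auto simp: differentiable_def)
qed

lemma C1_on_affine:
  assumes "C1_on V f" "\<And>z. z \<in> U \<Longrightarrow> a + c *\<^sub>R z \<in> V"
  shows "C1_on U (\<lambda>z. f (a + c *\<^sub>R z))"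
  unfolding C1_on_def
proof (intro conjI ballI allI)
  show "(\<lambda>z. f (a + c *\<^sub>R z)) differentiable (at z)" if "z \<in> U" for z
    using partial_deriv_affine(2) C1_on_differentiable assms that by blast
  show "continuous_on U (partial_deriv i (\<lambda>z. f (a + c *\<^sub>R z)))" for i
    by (rule continuous_on_eq[where f = "\<lambda>z. c * partial_deriv i f (a + c *\<^sub>R z)"])
       (use assms in \<open>auto intro!: continuous_intros continuous_on_compose2[OF C1_on_continuous_partial[OF assms(1)]]
          simp: partial_deriv_affine(1)[OF C1_on_differentiable[OF assms(1)]]\<close>)
qed

text \<open>Differentiability is local, and the open sets \<open>V\<close> and \<open>- K\<close>
  cover the space; on \<open>- K\<close> the extension vanishes identically, so nothing has to be
  matched along the boundary of \<open>V\<close>.\<close>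

lemma C1_on_extend_zero:
  assumes "open V" "compact K" "K \<subseteq> V" "C1_on V P" "\<And>x. x \<in> V \<Longrightarrow> x \<notin> K \<Longrightarrow> P x = 0"
  defines "Q \<equiv> \<lambda>x. if x \<in> V then P x else 0"
  shows "C1_on UNIV Q"
    and "\<And>x. x \<in> V \<Longrightarrow> partial_deriv i Q x = partial_deriv i P x"
    and "\<And>x. x \<notin> K \<Longrightarrow> partial_deriv i Q x = 0"
proof -
  have K: "open (- K)" using assms(2) by (simp add: compact_imp_closed open_Compl)
  show 1: "partial_deriv i Q x = partial_deriv i P x" if "x \<in> V" for x i
    using that assms(1) by (intro partial_deriv_cong_open[of V]) (auto simp: Q_def)
  have z: "Q y = 0" if "y \<in> - K" for y using that assms(5) by (auto simp: Q_def)
  show 2: "partial_deriv i Q x = 0" if "x \<notin> K" for x i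
    using partial_deriv_cong_open[OF K, of x Q "\<lambda>_. 0" i] z that by auto
  have V: "C1_on V Q" by (rule C1_on_cong_open[OF assms(4,1)]) (auto simp: Q_def)
  have W: "C1_on (- K) Q" by (rule C1_on_cong_open[OF C1_on_const[of _ 0] K]) (auto simp: z)
  show "C1_on UNIV Q"
    unfolding C1_on_def
  proof (intro conjI ballI allI)
    show "Q differentiable (at x)" for x
      using V W assms(3) C1_on_differentiable by blast
    have "continuous_on (V \<union> - K) (partial_deriv i Q)" for i
      using V W assms(1) K by (intro continuous_on_open_Un C1_on_continuous_partial)
    moreover have "V \<union> - K = UNIV" using assms(3) by auto
    ultimately show "continuous_on UNIV (partial_deriv i Q)" for i by simp
  qed
qed

section \<open>Integrals of compactly supported functions and of their partial derivatives\<close>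

lemma integrable_cbox_support:
  fixes f :: "'a::euclidean_space \<Rightarrow> real"
  assumes "continuous_on (cbox a b) f" "\<And>x. x \<notin> cbox a b \<Longrightarrow> f x = 0"
  shows "integrable lborel f" "integral\<^sup>L lborel f = integral (cbox a b) f"
proof -
  have "integrable lborel (\<lambda>x. indicator (cbox a b) x *\<^sub>R f x)"
    by (intro borel_integrable_compact compact_cbox assms)
  moreover have "(\<lambda>x. indicator (cbox a b) x *\<^sub>R f x) = f"
    using assms(2) by (auto simp: indicator_def fun_eq_iff)
  ultimately show i: "integrable lborel f" by simp
  have "integral\<^sup>L lborel f = integral UNIV f" using integral_lborel[OF i] by simp
  also have "\<dots> = integral (cbox a b) f"
  proof -
    have "(\<lambda>x. if x \<in> cbox a b then f x else 0) = f" using assms(2) by auto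
    then show ?thesis using integral_restrict_UNIV[of "cbox a b" f] by simp
  qed
  finally show "integral\<^sup>L lborel f = integral (cbox a b) f" .
qed

lemma lborel_integral_shift:
  fixes f :: "'a::euclidean_space \<Rightarrow> real"
  shows "f \<in> borel_measurable borel \<Longrightarrow> (\<integral>x. f (t + x) \<partial>lborel) = (\<integral>x. f x \<partial>lborel)"
  using lborel_distr_plus[of t] integral_distr[of "(+) t" lborel borel f] by simp

text \<open>The integral of a translate of \<open>P\<close> along the \<open>i\<close>-th axis does
  not depend on the shift \<open>t\<close>. Differentiating under the integral at
  \<open>t = 0\<close> gives the integral of the partial derivative.\<close>

lemma integral_partial_deriv_UNIV:
  fixes P :: "real^'n::finite \<Rightarrow> real"
  assumes P: "C1_on UNIV P" and supp: "\<And>x. norm x > r \<Longrightarrow> P x = 0"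
  shows "(\<integral>x. partial_deriv i P x \<partial>lborel) = 0"
proof -
  \<comment> \<open>The margin 1 keeps the supports of all translates with
    \<open>\<bar>t\<bar> < 1\<close> inside one fixed box.\<close>
  have "bounded (cball (0::real^'n) (\<bar>r\<bar> + 1))" by simp
  then obtain b :: "real^'n" where b: "cball (0::real^'n) (\<bar>r\<bar> + 1) \<subseteq> cbox (- b) b"
    using bounded_subset_cbox_symmetric by blast
  let ?e = "axis i 1 :: real^'n"
  let ?J = "\<lambda>t. integral (cbox (-b) b) (\<lambda>z. P (t *\<^sub>R ?e + z))"
  let ?U = "ball 0 1 :: real set"
  have contP: "continuous_on UNIV P" by (rule C1_on_continuous[OF P])
  have contD: "continuous_on UNIV (partial_deriv i P)" by (rule C1_on_continuous_partial[OF P])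
  have zero: "P (t *\<^sub>R ?e + z) = 0" if "t \<in> ?U" "z \<notin> cbox (-b) b" for t z
  proof (rule supp)
    have "norm z > \<bar>r\<bar> + 1" using that(2) b by (auto simp: subset_iff not_le[symmetric])
    moreover have "norm (t *\<^sub>R ?e) \<le> 1" using that(1) by simp
    moreover have "norm z \<le> norm (t *\<^sub>R ?e + z) + norm (t *\<^sub>R ?e)"
      by (metis add.commute add_diff_cancel_left' norm_triangle_ineq4)
    ultimately show "r < norm (t *\<^sub>R ?e + z)" by linarith
  qed
  have J: "?J t = integral\<^sup>L lborel P" if "t \<in> ?U" for t
  proof -
    have "(\<integral>x. P (t *\<^sub>R ?e + x) \<partial>lborel) = ?J t"
      by (rule integrable_cbox_support) 
        (auto intro!: continuous_intros continuous_on_compose2[OF contP] zero[OF that])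
    moreover have "(\<integral>x. P (t *\<^sub>R ?e + x) \<partial>lborel) = integral\<^sup>L lborel P"
      by (rule lborel_integral_shift) (simp add: borel_measurable_continuous_onI contP)
    ultimately show ?thesis by simp
  qed
  have "(?J has_field_derivative integral (cbox (-b) b) (\<lambda>z. partial_deriv i P (0 *\<^sub>R ?e + z))) (at 0 within ?U)"
  proof (rule leibniz_rule_field_derivative)
    show "((\<lambda>t. P (t *\<^sub>R ?e + z)) has_field_derivative partial_deriv i P (t *\<^sub>R ?e + z)) (at t within ?U)" for t z
    proof -
      have "((\<lambda>t. t *\<^sub>R ?e + z) has_derivative (\<lambda>s. s *\<^sub>R ?e)) (at t within ?U)"
        by (auto intro!: derivative_eq_intros)
      from has_derivative_compose[OF this has_derivative_partial_deriv[OF C1_on_differentiable[OF P UNIV_I]]]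
      have "((\<lambda>t. P (t *\<^sub>R ?e + z)) has_derivative
          (\<lambda>s. \<Sum>j\<in>UNIV. (s *\<^sub>R ?e) $ j * partial_deriv j P (t *\<^sub>R ?e + z))) (at t within ?U)" .
      also have "(\<lambda>s. \<Sum>j\<in>UNIV. (s *\<^sub>R ?e) $ j * partial_deriv j P (t *\<^sub>R ?e + z))
          = (*) (partial_deriv i P (t *\<^sub>R ?e + z))"
        by (auto simp: axis_def if_distrib[of "\<lambda>t. t * _"] if_distrib[of "\<lambda>t. _ * t"] fun_eq_iff
            mult.commute cong: if_cong)
      finally show ?thesis by (simp only: has_field_derivative_def)
    qed
    show "(\<lambda>z. P (t *\<^sub>R ?e + z)) integrable_on cbox (- b) b" for t
      by (intro integrable_continuous continuous_intros continuous_on_compose2[OF contP]) auto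
    show "continuous_on (?U \<times> cbox (- b) b) (\<lambda>(t, z). partial_deriv i P (t *\<^sub>R ?e + z))"
      unfolding case_prod_unfold
      by (intro continuous_intros continuous_on_compose2[OF contD]) auto
  qed auto
  then have "(?J has_field_derivative integral (cbox (-b) b) (partial_deriv i P)) (at 0)"
    by (simp add: at_within_open[of 0 ?U])
  moreover have "(?J has_field_derivative 0) (at 0)"
    by (rule has_field_derivative_transform_within_open[of "\<lambda>_. integral\<^sup>L lborel P" _ _ ?U])
       (auto simp: J)
  ultimately have "integral (cbox (-b) b) (partial_deriv i P) = 0"
    by (rule DERIV_unique)
  moreover have "integral\<^sup>L lborel (partial_deriv i P) = integral (cbox (-b) b) (partial_deriv i P)"
  proof (rule integrable_cbox_support)
    show "continuous_on (cbox (- b) b) (partial_deriv i P)" by (rule continuous_on_subset[OF contD]) auto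
    fix x assume "x \<notin> cbox (-b) b"
    then have "norm x > \<bar>r\<bar> + 1" using b by (auto simp: subset_iff not_le[symmetric])
    then have "x \<in> {x. norm x > r}" by auto
    moreover have "open {x::real^'n. norm x > r}" by (simp add: open_Collect_less continuous_on_norm_id)
    ultimately show "partial_deriv i P x = 0"
      using partial_deriv_cong_open[of "{x. norm x > r}" x P "\<lambda>_. 0" i] supp by auto
  qed
  ultimately show ?thesis by simp
qed

lemma integral_partial_deriv_eq_0:
  fixes P :: "real^'n::finite \<Rightarrow> real"
  assumes "open V" "compact K" "K \<subseteq> V" "C1_on V P" "\<And>x. x \<in> V \<Longrightarrow> x \<notin> K \<Longrightarrow> P x = 0"
  shows "(\<integral>x. indicator K x * partial_deriv i P x \<partial>lborel) = 0"
proof -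
  define Q where "Q = (\<lambda>x. if x \<in> V then P x else 0)"
  note Q = C1_on_extend_zero[OF assms, folded Q_def]
  obtain r where r: "\<And>x. x \<in> K \<Longrightarrow> norm x \<le> r"
    using compact_imp_bounded[OF assms(2)] unfolding bounded_iff by blast
  have "Q x = 0" if "norm x > r" for x
    using r[of x] that assms(5)[of x] by (auto simp: Q_def)
  then have "(\<integral>x. partial_deriv i Q x \<partial>lborel) = 0"
    using integral_partial_deriv_UNIV[OF Q(1), of r i] by simp
  moreover have "partial_deriv i Q x = indicator K x * partial_deriv i P x" for x
    using Q(2,3)[of x i] assms(3) by (auto simp: indicator_def)
  ultimately show ?thesis by simp
qed

subsection \<open>The mean value estimate\<close>

lemma DERIV_pos_part_power:
  assumes "n \<ge> 2"
  shows "((\<lambda>t::real. max 0 t ^ n) has_real_derivative real n * max 0 t ^ (n - 1)) (at t)"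
proof (rule linorder_cases[of t 0])
  assume t: "t < 0"
  have "((\<lambda>t::real. 0) has_real_derivative 0) (at t)" by simp
  then have "((\<lambda>t::real. max 0 t ^ n) has_real_derivative 0) (at t)"
    by (rule has_field_derivative_transform_within_open[of _ _ _ "{..<0}"]) (use t assms in auto)
  then show ?thesis using t assms by (simp add: power_0_left)
next
  assume t: "t > 0"
  have "((\<lambda>t::real. t ^ n) has_real_derivative real n * t ^ (n - 1)) (at t)"
    using DERIV_pow[of n t] by simp
  then have "((\<lambda>t::real. max 0 t ^ n) has_real_derivative real n * t ^ (n - 1)) (at t)"
    by (rule has_field_derivative_transform_within_open[of _ _ _ "{0<..}"]) (use t in auto)
  then show ?thesis using t by simp
next
  assume t: "t = 0"
  obtain k where n: "n = Suc (Suc k)" using assms by (metis add_2_eq_Suc le_Suc_ex)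
  have "((\<lambda>h::real. max 0 h ^ (k + 1)) \<longlongrightarrow> max 0 0 ^ (k + 1)) (at 0)"
    by (intro tendsto_intros)
  moreover have "eventually (\<lambda>h::real. max 0 h ^ (k + 1) = (max 0 (0 + h) ^ n - max 0 0 ^ n) / h) (at 0)"
    unfolding eventually_at n by (intro exI[of _ 1]) (auto simp: max_def)
  ultimately have "((\<lambda>h::real. (max 0 (0 + h) ^ n - max 0 0 ^ n) / h) \<longlongrightarrow> 0) (at 0)"
    using Lim_transform_eventually[of "\<lambda>h::real. max 0 h ^ (k + 1)" "max 0 0 ^ (k + 1)" "at 0"] by simp
  then show ?thesis using t n by (simp add: DERIV_def)
qed

definition quad :: "real^'n^'n \<Rightarrow> real^'n::finite \<Rightarrow> real"
  where "quad B z = z \<bullet> (B *v z)"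

text \<open>The square is the lowest integer power of the positive part that is continuously
  differentiable; the second integration by parts differentiates the kernel.\<close>

definition bump :: "real^'n^'n \<Rightarrow> real^'n::finite \<Rightarrow> real"
  where "bump B z = max 0 (1 - quad B z) ^ 2"

text \<open>An antiderivative of the kernel: its gradient is \<open>- bump B z\<close> times
  \<open>B *v z\<close>, the divisor 6 being 3 from the power times 2 from the quadratic
  form.\<close>

definition bump_potential :: "real^'n^'n \<Rightarrow> real^'n::finite \<Rightarrow> real"
  where "bump_potential B z = max 0 (1 - quad B z) ^ 3 / 6"

lemma has_derivative_quad:
  assumes "transpose B = B"
  shows "(quad B has_derivative (\<lambda>v. 2 * (v \<bullet> (B *v z)))) (at z)"
proof -
  have *: "z \<bullet> (B *v v) = v \<bullet> (B *v z)" for v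
    using assms by (metis dot_lmul_matrix inner_commute transpose_matrix_vector)
  have "((\<lambda>z. z \<bullet> (B *v z)) has_derivative (\<lambda>v. z \<bullet> (B *v v) + v \<bullet> (B *v z))) (at z)"
    by (intro has_derivative_inner has_derivative_ident bounded_linear_imp_has_derivative
        matrix_vector_mul_bounded_linear)
  then show ?thesis unfolding quad_def[abs_def] by (simp add: *)
qed

lemma partial_deriv_quad: "transpose B = B \<Longrightarrow> partial_deriv i (quad B) z = 2 * (B *v z) $ i"
  using partial_deriv_eqI[OF has_derivative_quad] by (simp add: inner_axis')

lemma C1_on_matrix_vector [intro]: "C1_on V (\<lambda>z. (B *v z) $ j)"
  unfolding matrix_vector_mult_def vec_lambda_beta
  by (intro C1_on_sum C1_on_mult C1_on_const C1_on_component)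

lemma partial_deriv_matrix_vector: "partial_deriv i (\<lambda>z. (B *v z) $ j) z = B $ j $ i"
proof -
  have "((\<lambda>z. (B *v z) $ j) has_derivative (\<lambda>v. (B *v v) $ j)) (at z)"
    by (intro bounded_linear_imp_has_derivative bounded_linear_compose[OF bounded_linear_vec_nth]
        matrix_vector_mul_bounded_linear)
  from partial_deriv_eqI[OF this, of i] show ?thesis
    by (simp add: matrix_vector_mult_basis column_def)
qed

lemma C1_on_quad: "transpose B = B \<Longrightarrow> C1_on V (quad B)"
  by (rule C1_onI[OF has_derivative_quad])
     (auto simp: inner_axis' intro!: continuous_intros C1_on_continuous)

lemma C1_on_pos_part_power:
  assumes "transpose B = B" "n \<ge> 2"
  shows "C1_on V (\<lambda>z. max 0 (1 - quad B z) ^ n)"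
    and "partial_deriv i (\<lambda>z. max 0 (1 - quad B z) ^ n) z
      = - (2 * real n) * max 0 (1 - quad B z) ^ (n - 1) * (B *v z) $ i"
proof -
  have C: "C1_on V (\<lambda>z. 1 - quad B z)" for V
    by (intro C1_on_diff C1_on_const C1_on_quad assms)
  show "C1_on V (\<lambda>z. max 0 (1 - quad B z) ^ n)"
    by (rule C1_on_compose_real[OF C, where p' = "\<lambda>t. real n * max 0 t ^ (n - 1)"])
       (auto simp only: intro!: DERIV_pos_part_power assms continuous_intros)
  have q: "quad B differentiable (at z)" for z
    using has_derivative_quad[OF assms(1)] by (auto simp: differentiable_def)
  have "partial_deriv i (\<lambda>z. 1 - quad B z) z = - 2 * (B *v z) $ i"
    by (subst partial_deriv_diff) (auto simp: q partial_deriv_quad assms)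
  then show "partial_deriv i (\<lambda>z. max 0 (1 - quad B z) ^ n) z
      = - (2 * real n) * max 0 (1 - quad B z) ^ (n - 1) * (B *v z) $ i"
    using partial_deriv_compose_real[OF C1_on_differentiable[OF C[of UNIV] UNIV_I] DERIV_pos_part_power[OF assms(2)],
        of i z] by simp
qed

lemma C1_on_bump [intro]: "transpose B = B \<Longrightarrow> C1_on V (bump B)"
  using C1_on_pos_part_power(1)[of B 2 V] unfolding bump_def[abs_def] by simp

lemma partial_deriv_bump:
  "transpose B = B \<Longrightarrow> partial_deriv i (bump B) z = - 4 * max 0 (1 - quad B z) * (B *v z) $ i"
  using C1_on_pos_part_power(2)[of B 2 i z] unfolding bump_def[abs_def] by simp

lemma C1_on_bump_potential [intro]: "transpose B = B \<Longrightarrow> C1_on V (bump_potential B)"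
  using C1_on_mult[OF C1_on_pos_part_power(1)[of B 3 V] C1_on_const[of V "1/6"]]
  unfolding bump_potential_def[abs_def] by simp

lemma partial_deriv_bump_potential:
  assumes "transpose B = B"
  shows "partial_deriv i (bump_potential B) z = - bump B z * (B *v z) $ i"
proof -
  have "partial_deriv i (\<lambda>z. max 0 (1 - quad B z) ^ 3 * (1/6)) z = - bump B z * (B *v z) $ i"
    using C1_on_pos_part_power(2)[OF assms, of 3 i z]
      C1_on_differentiable[OF C1_on_pos_part_power(1)[OF assms, of 3 UNIV], of z]
    by (subst partial_deriv_mult) (auto simp: bump_def)
  then show ?thesis unfolding bump_potential_def[abs_def] by simp
qed

text \<open>The vanishing of \<open>integral_partial_deriv_eq_0\<close> restated for gauge integrals
  over a box, the form in which the means are differentiated.\<close>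

lemma integral_cbox_partial_deriv_eq_0:
  fixes P :: "real^'n::finite \<Rightarrow> real"
  assumes "open V" "compact K" "K \<subseteq> cbox a b" "cbox a b \<subseteq> V" "C1_on V P"
    "\<And>x. x \<in> V \<Longrightarrow> x \<notin> K \<Longrightarrow> P x = 0"
  shows "integral (cbox a b) (partial_deriv i P) = 0"
proof -
  have KV: "K \<subseteq> V" using assms by blast
  define Q where "Q = (\<lambda>x. if x \<in> V then P x else 0)"
  note Q = C1_on_extend_zero[OF assms(1,2) KV assms(5,6), folded Q_def]
  have eq: "partial_deriv i Q x = indicator K x * partial_deriv i P x" for x
    using Q(2,3)[of x i] KV by (auto simp: indicator_def)
  have "integral\<^sup>L lborel (partial_deriv i Q) = integral (cbox a b) (partial_deriv i Q)"
    using C1_on_continuous_partial[OF Q(1)] Q(3) assms(3)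
    by (intro integrable_cbox_support) (auto intro: continuous_on_subset)
  moreover have "integral\<^sup>L lborel (partial_deriv i Q) = 0"
    using integral_partial_deriv_eq_0[OF assms(1,2) KV assms(5,6), of i] unfolding eq by simp
  moreover have "integral (cbox a b) (partial_deriv i Q) = integral (cbox a b) (partial_deriv i P)"
    using Q(2)[of _ i] assms(4) by (intro integral_cong) auto
  ultimately show ?thesis by simp
qed

text \<open>Here \<open>D\<close> is the divergence of \<open>a \<nabla>h\<close>.  The derivative in \<open>\<rho>\<close> of the mean of \<open>h\<close> over
  the ellipsoid of size \<open>\<rho>\<close> around \<open>x\<close> is rewritten by integrating by parts twice; since the
  coefficients are frozen at \<open>x\<close>, the error \<open>E\<close> is of order \<open>\<rho>\<close>.\<close>

lemma mean_deriv_identity: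
  fixes h :: "real^'n::finite \<Rightarrow> real" and a :: "'n \<Rightarrow> 'n \<Rightarrow> real^'n \<Rightarrow> real"
  assumes V: "open V" and B: "transpose B = B"
    and K: "compact K" "K \<subseteq> cbox (-b) b" "\<And>z. z \<notin> K \<Longrightarrow> quad B z \<ge> 1"
    and \<rho>: "\<rho> > 0" "\<And>z. z \<in> cbox (-b) b \<Longrightarrow> x + \<rho> *\<^sub>R z \<in> V"
    and h: "C1_on V h" and a: "\<And>i j. C1_on V (a i j)" and sym: "\<And>i j y. y \<in> V \<Longrightarrow> a i j y = a j i y"
    and X: "\<And>j. C1_on V (\<lambda>y. \<Sum>i\<in>UNIV. a j i y * partial_deriv i h y)"
    and a0: "\<And>i z. (\<Sum>j\<in>UNIV. a i j x * (B *v z) $ j) = w0 * z $ i" and xV: "x \<in> V"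
  defines "D \<equiv> \<lambda>y. \<Sum>j\<in>UNIV. partial_deriv j (\<lambda>y. \<Sum>i\<in>UNIV. a j i y * partial_deriv i h y) y"
  defines "E \<equiv> \<lambda>z. \<Sum>i\<in>UNIV. \<Sum>j\<in>UNIV. \<rho> * partial_deriv i (a i j) (x + \<rho> *\<^sub>R z) * ((B *v z) $ j * bump B z)
      + (a i j (x + \<rho> *\<^sub>R z) - a i j x) * partial_deriv i (\<lambda>z. (B *v z) $ j * bump B z) z"
  shows "w0 * integral (cbox (-b) b) (\<lambda>z. (\<Sum>i\<in>UNIV. z $ i * partial_deriv i h (x + \<rho> *\<^sub>R z)) * bump B z)
    = integral (cbox (-b) b) (\<lambda>z. \<rho> * D (x + \<rho> *\<^sub>R z) * bump_potential B z + h (x + \<rho> *\<^sub>R z) * E z / \<rho>)"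
    and "continuous_on (cbox (-b) b) E"
proof -
  let ?Q = "cbox (-b) b"
  define U where "U = (\<lambda>z. x + \<rho> *\<^sub>R z) -` V"
  have U: "open U" unfolding U_def by (intro open_vimage V continuous_intros)
  have QU: "?Q \<subseteq> U" using \<rho>(2) by (auto simp: U_def)
  have in_V: "x + \<rho> *\<^sub>R z \<in> V" if "z \<in> U" for z using that by (simp add: U_def)
  let ?y = "\<lambda>z. x + \<rho> *\<^sub>R z"
  define X where "X = (\<lambda>j y. \<Sum>i\<in>UNIV. a j i y * partial_deriv i h y)"
  have CX: "C1_on V (X j)" for j using X[of j] by (simp add: X_def)
  have D: "D y = (\<Sum>j\<in>UNIV. partial_deriv j (X j) y)" for y by (simp add: D_def X_def)
  \<comment> \<open>The divergence of \<open>P\<close> trades the field \<open>X\<close> against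
    \<open>bump\<close> for the divergence of \<open>X\<close> against
    \<open>bump_potential\<close>; the divergence of \<open>R\<close> moves the remaining derivative
    off \<open>h\<close>. Both fields vanish outside \<open>K\<close>, so both divergences integrate
    to 0.\<close>
  define P where "P = (\<lambda>j z. X j (?y z) * bump_potential B z)"
  \<comment> \<open>The defect of freezing the coefficients at \<open>x\<close>. It is
    differentiated in place of \<open>h\<close>, and \<open>E\<close> is its divergence.\<close>
  define Y where "Y = (\<lambda>i z. \<Sum>j\<in>UNIV. (a i j (?y z) - a i j x) * ((B *v z) $ j * bump B z))"
  define R where "R = (\<lambda>i z. h (?y z) * Y i z)"
  have aff: "C1_on U (\<lambda>z. f (?y z))" if "C1_on V f" for f
    using C1_on_affine[OF that] in_V by blast
  have CP: "C1_on U (P j)" for j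
    unfolding P_def by (intro C1_on_mult aff CX C1_on_bump_potential B)
  have CB: "C1_on U (\<lambda>z. (B *v z) $ j * bump B z)" for j U
    by (intro C1_on_mult C1_on_matrix_vector C1_on_bump B)
  have CY: "C1_on U (Y i)" for i
    unfolding Y_def by (intro C1_on_sum C1_on_mult C1_on_diff aff a C1_on_const CB) 
  have CR: "C1_on U (R i)" for i
    unfolding R_def by (intro C1_on_mult aff h CY)
  have zero: "bump B z = 0" "bump_potential B z = 0" if "z \<notin> K" for z
    using K(3)[OF that] by (auto simp: bump_def bump_potential_def max_def)
  have intP: "integral ?Q (partial_deriv j (P j)) = 0" for j
    by (rule integral_cbox_partial_deriv_eq_0[OF U K(1,2) QU CP]) (simp add: P_def zero)
  have intR: "integral ?Q (partial_deriv i (R i)) = 0" for i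
    by (rule integral_cbox_partial_deriv_eq_0[OF U K(1,2) QU CR]) (simp add: R_def Y_def zero)
  have pP: "partial_deriv j (P j) z = \<rho> * partial_deriv j (X j) (?y z) * bump_potential B z
      - X j (?y z) * (bump B z * (B *v z) $ j)" if "z \<in> U" for j z
    unfolding P_def
    using partial_deriv_affine[OF C1_on_differentiable[OF CX in_V[OF that]]] 
      C1_on_differentiable[OF C1_on_bump_potential[OF B, of UNIV]]
    by (subst partial_deriv_mult) (auto simp: partial_deriv_bump_potential[OF B])
  have daff: "(\<lambda>z. a i j (?y z) - a i j x) differentiable (at z)" if "z \<in> U" for i j z
    using C1_on_differentiable[OF C1_on_diff[OF aff[OF a] C1_on_const] that] .
  have pY: "partial_deriv i (Y i) z = (\<Sum>j\<in>UNIV. \<rho> * partial_deriv i (a i j) (?y z) * ((B *v z) $ j * bump B z)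
      + (a i j (?y z) - a i j x) * partial_deriv i (\<lambda>z. (B *v z) $ j * bump B z) z)" if "z \<in> U" for i z
  proof -
    have 1: "(\<lambda>z. (B *v z) $ j * bump B z) differentiable (at z)" for j
      by (rule C1_on_differentiable[OF CB[of UNIV]]) simp
    have 2: "(\<lambda>z. a i j (?y z)) differentiable (at z)" for j
      by (rule C1_on_differentiable[OF aff[OF a] that])
    have 3: "partial_deriv i (\<lambda>z. a i j (?y z) - a i j x) z = \<rho> * partial_deriv i (a i j) (?y z)" for j
      by (subst partial_deriv_diff)
        (auto simp: 2 partial_deriv_affine[OF C1_on_differentiable[OF a in_V[OF that]]])
    show ?thesis
      unfolding Y_def
      by (subst partial_deriv_sum) (auto simp: 1 3 partial_deriv_mult[OF daff[OF that] 1] 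
          intro!: differentiable_mult[OF daff[OF that] 1] sum.cong)
  qed
  have E: "E z = (\<Sum>i\<in>UNIV. partial_deriv i (Y i) z)" if "z \<in> U" for z
    unfolding E_def by (simp add: pY[OF that])
  have pR: "partial_deriv i (R i) z = \<rho> * partial_deriv i h (?y z) * Y i z + h (?y z) * partial_deriv i (Y i) z"
    if "z \<in> U" for i z
    unfolding R_def
    using partial_deriv_affine[OF C1_on_differentiable[OF h in_V[OF that]]] C1_on_differentiable[OF CY that]
    by (subst partial_deriv_mult) auto
  have hY: "(\<Sum>i\<in>UNIV. partial_deriv i h (?y z) * Y i z)
      = (\<Sum>j\<in>UNIV. X j (?y z) * (bump B z * (B *v z) $ j))
        - w0 * (\<Sum>i\<in>UNIV. z $ i * partial_deriv i h (?y z)) * bump B z" if "z \<in> U" for z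
  proof -
    have "(\<Sum>i\<in>UNIV. partial_deriv i h (?y z) * Y i z)
      = (\<Sum>i\<in>UNIV. \<Sum>j\<in>UNIV. a i j (?y z) * partial_deriv i h (?y z) * (bump B z * (B *v z) $ j))
        - (\<Sum>i\<in>UNIV. partial_deriv i h (?y z) * bump B z * (\<Sum>j\<in>UNIV. a i j x * (B *v z) $ j))"
      unfolding Y_def by (simp add: sum_distrib_left sum_subtractf[symmetric] algebra_simps)
    also have "(\<Sum>i\<in>UNIV. \<Sum>j\<in>UNIV. a i j (?y z) * partial_deriv i h (?y z) * (bump B z * (B *v z) $ j))
       = (\<Sum>j\<in>UNIV. X j (?y z) * (bump B z * (B *v z) $ j))"
      unfolding X_def sum_distrib_right using sym[OF in_V[OF that]] by (subst sum.swap) simp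
    finally show ?thesis
      unfolding a0 by (simp add: sum_distrib_left sum_distrib_right mult_ac)
  qed
  have id: "w0 * ((\<Sum>i\<in>UNIV. z $ i * partial_deriv i h (?y z)) * bump B z)
      = (\<rho> * D (?y z) * bump_potential B z + h (?y z) * E z / \<rho>)
        - ((\<Sum>j\<in>UNIV. partial_deriv j (P j) z) + (\<Sum>i\<in>UNIV. partial_deriv i (R i) z) / \<rho>)" 
    if "z \<in> U" for z
  proof -
    have "(\<Sum>j\<in>UNIV. partial_deriv j (P j) z) = \<rho> * D (?y z) * bump_potential B z
        - (\<Sum>j\<in>UNIV. X j (?y z) * (bump B z * (B *v z) $ j))"
      unfolding D by (simp add: pP[OF that] sum_subtractf sum_distrib_left sum_distrib_right mult_ac)
    moreover have "(\<Sum>i\<in>UNIV. partial_deriv i (R i) z) / \<rho>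
        = (\<Sum>i\<in>UNIV. partial_deriv i h (?y z) * Y i z) + h (?y z) * E z / \<rho>"
      using \<rho>(1) unfolding E[OF that]
      by (simp add: pR[OF that] sum.distrib sum_distrib_left field_simps)
    ultimately show ?thesis using hY[OF that] by (simp add: algebra_simps)
  qed
  have contE: "continuous_on ?Q (\<lambda>z. \<Sum>i\<in>UNIV. partial_deriv i (Y i) z)"
    using QU by (intro continuous_on_sum continuous_on_subset[OF C1_on_continuous_partial[OF CY]])
  then show cE: "continuous_on ?Q E"
    by (rule continuous_on_eq) (use QU E in auto)
  have y_cont: "continuous_on ?Q (\<lambda>z. f (?y z))" if "continuous_on V f" for f :: "real^'n \<Rightarrow> real"
    using \<rho>(2) by (intro continuous_on_compose2[OF that] continuous_intros) auto
  have i1: "(\<lambda>z. \<rho> * D (?y z) * bump_potential B z + h (?y z) * E z / \<rho>) integrable_on ?Q"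
    using \<rho>(1) unfolding D divide_inverse
    by (intro integrable_continuous continuous_intros cE y_cont C1_on_continuous[OF h]
        C1_on_continuous_partial[OF CX] C1_on_continuous[OF C1_on_bump_potential[OF B]])
  have iP: "partial_deriv j (P j) integrable_on ?Q" for j
    using QU by (intro integrable_continuous continuous_on_subset[OF C1_on_continuous_partial[OF CP]])
  have iR: "partial_deriv j (R j) integrable_on ?Q" for j
    using QU by (intro integrable_continuous continuous_on_subset[OF C1_on_continuous_partial[OF CR]])
  have sP: "(\<lambda>z. \<Sum>j\<in>UNIV. partial_deriv j (P j) z) integrable_on ?Q"
    "integral ?Q (\<lambda>z. \<Sum>j\<in>UNIV. partial_deriv j (P j) z) = 0"
    using iP intP by (auto intro!: integrable_sum simp: integral_sum)
  have sR: "(\<lambda>z. (\<Sum>i\<in>UNIV. partial_deriv i (R i) z) * (1 / \<rho>)) integrable_on ?Q"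
    "integral ?Q (\<lambda>z. (\<Sum>i\<in>UNIV. partial_deriv i (R i) z) * (1 / \<rho>)) = 0"
    using integral_mult_left[of ?Q "\<lambda>z. \<Sum>i\<in>UNIV. partial_deriv i (R i) z" "1 / \<rho>"] iR intR
    by (auto intro!: integrable_on_mult_left[of _ _ "1 / \<rho>", simplified] integrable_sum simp: integral_sum)
  have "integral ?Q (\<lambda>z. w0 * ((\<Sum>i\<in>UNIV. z $ i * partial_deriv i h (?y z)) * bump B z))
     = integral ?Q (\<lambda>z. (\<rho> * D (?y z) * bump_potential B z + h (?y z) * E z / \<rho>)
        - ((\<Sum>j\<in>UNIV. partial_deriv j (P j) z) + (\<Sum>i\<in>UNIV. partial_deriv i (R i) z) * (1 / \<rho>)))"
    using QU by (intro integral_cong) (auto simp: id)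
  also have "\<dots> = integral ?Q (\<lambda>z. \<rho> * D (?y z) * bump_potential B z + h (?y z) * E z / \<rho>)
      - integral ?Q (\<lambda>z. (\<Sum>j\<in>UNIV. partial_deriv j (P j) z) + (\<Sum>i\<in>UNIV. partial_deriv i (R i) z) * (1 / \<rho>))"
    by (rule integral_diff[OF i1 integrable_add[OF sP(1) sR(1)]])
  also have "integral ?Q (\<lambda>z. (\<Sum>j\<in>UNIV. partial_deriv j (P j) z) + (\<Sum>i\<in>UNIV. partial_deriv i (R i) z) * (1 / \<rho>)) = 0"
    by (simp only: integral_add[OF sP(1) sR(1)] sP(2) sR(2))
  finally show "w0 * integral ?Q (\<lambda>z. (\<Sum>i\<in>UNIV. z $ i * partial_deriv i h (?y z)) * bump B z)
    = integral ?Q (\<lambda>z. \<rho> * D (?y z) * bump_potential B z + h (?y z) * E z / \<rho>)"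
    by simp
qed

section \<open>From the derivative of the mean to a pointwise bound\<close>

lemma has_real_derivative_line:
  fixes f :: "real^'n::finite \<Rightarrow> real"
  assumes "f differentiable (at (x + t *\<^sub>R z))"
  shows "((\<lambda>t. f (x + t *\<^sub>R z)) has_real_derivative (\<Sum>i\<in>UNIV. z $ i * partial_deriv i f (x + t *\<^sub>R z))) (at t within U)"
proof -
  have "((\<lambda>t. x + t *\<^sub>R z) has_derivative (\<lambda>s. s *\<^sub>R z)) (at t within U)"
    by (auto intro!: derivative_eq_intros)
  from has_derivative_compose[OF this has_derivative_partial_deriv[OF assms]]
  have "((\<lambda>t. f (x + t *\<^sub>R z)) has_derivative
      (\<lambda>s. \<Sum>i\<in>UNIV. (s *\<^sub>R z) $ i * partial_deriv i f (x + t *\<^sub>R z))) (at t within U)" .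
  also have "(\<lambda>s. \<Sum>i\<in>UNIV. (s *\<^sub>R z) $ i * partial_deriv i f (x + t *\<^sub>R z))
      = (*) (\<Sum>i\<in>UNIV. z $ i * partial_deriv i f (x + t *\<^sub>R z))"
    by (auto simp: fun_eq_iff sum_distrib_left mult_ac)
  finally show ?thesis by (simp only: has_field_derivative_def)
qed

lemma abs_sum_le_card:
  fixes f :: "'n::finite \<Rightarrow> real"
  assumes "\<And>i. \<bar>f i\<bar> \<le> c"
  shows "\<bar>\<Sum>i\<in>UNIV. f i\<bar> \<le> real CARD('n) * c"
proof -
  have "(\<Sum>i\<in>UNIV. \<bar>f i\<bar>) \<le> real CARD('n) * c"
    using sum_bounded_above[of UNIV "\<lambda>i. \<bar>f i\<bar>" c] assms by simp
  then show ?thesis using sum_abs[of f UNIV] by linarith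
qed

lemma line_increment_bound:
  fixes f :: "real^'n::finite \<Rightarrow> real"
  assumes "C1_on V f" "\<And>t. 0 \<le> t \<Longrightarrow> t \<le> \<rho> \<Longrightarrow> x + t *\<^sub>R z \<in> V" "\<rho> \<ge> 0"
    and N: "\<And>t i. 0 \<le> t \<Longrightarrow> t \<le> \<rho> \<Longrightarrow> \<bar>partial_deriv i f (x + t *\<^sub>R z)\<bar> \<le> N"
  shows "\<bar>f (x + \<rho> *\<^sub>R z) - f x\<bar> \<le> \<rho> * (real CARD('n) * (norm z * N))"
proof -
  have "norm (f (x + \<rho> *\<^sub>R z) - f (x + 0 *\<^sub>R z)) \<le> real CARD('n) * (norm z * N) * norm (\<rho> - 0)"
  proof (rule field_differentiable_bound)
    show "convex {0..\<rho>}" by simp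
    show "((\<lambda>t. f (x + t *\<^sub>R z)) has_field_derivative (\<Sum>i\<in>UNIV. z $ i * partial_deriv i f (x + t *\<^sub>R z)))
        (at t within {0..\<rho>})" if "t \<in> {0..\<rho>}" for t
      using that assms(1,2) by (intro has_real_derivative_line) (auto intro: C1_on_differentiable)
    show "norm (\<Sum>i\<in>UNIV. z $ i * partial_deriv i f (x + t *\<^sub>R z)) \<le> real CARD('n) * (norm z * N)"
      if "t \<in> {0..\<rho>}" for t
      unfolding real_norm_def
      using that component_le_norm_cart[of z] N[of t]
      by (intro abs_sum_le_card) (auto simp: abs_mult intro!: mult_mono)
  qed (use assms in auto)
  then show ?thesis using assms(3) by (simp add: mult_ac)
qed

lemma integral_abs_cbox_scaled_le:
  fixes h :: "real^'n::finite \<Rightarrow> real"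
  assumes "r > 0" and cont: "continuous_on (cball x (\<sigma> * r)) h" and Q: "cbox (-b) b \<subseteq> cball 0 \<sigma>"
  shows "integral (cbox (-b) b) (\<lambda>z. \<bar>h (x + r *\<^sub>R z)\<bar>)
      \<le> integral\<^sup>L lborel (\<lambda>y. indicator (cball x (\<sigma> * r)) y * \<bar>h y\<bar>) / r ^ CARD('n)"
proof -
  let ?f = "\<lambda>y. indicator (cball x (\<sigma> * r)) y * \<bar>h y\<bar>"
  have int: "integrable lborel ?f"
    using borel_integrable_compact[OF compact_cball continuous_on_rabs[OF cont]] by simp
  have in_ball: "x + r *\<^sub>R z \<in> cball x (\<sigma> * r)" if "z \<in> cball 0 \<sigma>" for z
    using that assms(1) by (auto simp: dist_norm mult.commute)
  have meas[measurable]: "(\<lambda>y. ?f (x + r *\<^sub>R y)) \<in> borel_measurable borel"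
    using borel_measurable_integrable[OF int] by (auto intro: measurable_compose[rotated])
  have "integral\<^sup>L lborel ?f = integral\<^sup>L (density (distr lborel borel (\<lambda>y. x + r *\<^sub>R y)) (\<lambda>_. ennreal (\<bar>r\<bar> ^ CARD('n)))) ?f"
    using lborel_affine[of r x] assms(1) by simp
  also have "\<dots> = (\<integral>y. r ^ CARD('n) * ?f (x + r *\<^sub>R y) \<partial>lborel)"
    using assms(1) borel_measurable_integrable[OF int]
    by (subst integral_density) (auto simp: integral_distr)
  finally have eq: "integral\<^sup>L lborel ?f / r ^ CARD('n) = (\<integral>y. ?f (x + r *\<^sub>R y) \<partial>lborel)"
    using assms(1) by simp
  have int2: "integrable lborel (\<lambda>y. ?f (x + r *\<^sub>R y))"
  proof -
    have "integrable (density (distr lborel borel (\<lambda>y. x + r *\<^sub>R y)) (\<lambda>_. ennreal (\<bar>r\<bar> ^ CARD('n)))) ?f"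
      using int lborel_affine[of r x] assms(1) by simp
    then have "integrable (distr lborel borel (\<lambda>y. x + r *\<^sub>R y)) (\<lambda>y. \<bar>r\<bar> ^ CARD('n) *\<^sub>R ?f y)"
      using borel_measurable_integrable[OF int] by (subst (asm) integrable_density) auto
    then have "integrable lborel (\<lambda>y. r ^ CARD('n) * ?f (x + r *\<^sub>R y))"
      using assms(1) borel_measurable_integrable[OF int] by (subst (asm) integrable_distr_eq) auto
    then show ?thesis using assms(1) by simp
  qed
  have contQ: "continuous_on (cbox (-b) b) (\<lambda>z. \<bar>h (x + r *\<^sub>R z)\<bar>)"
    using Q in_ball by (intro continuous_intros continuous_on_compose2[OF cont]) auto
  have int3: "integrable lborel (\<lambda>z. indicator (cbox (-b) b) z * \<bar>h (x + r *\<^sub>R z)\<bar>)"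
    using borel_integrable_compact[OF compact_cbox contQ] by simp
  have "integral (cbox (-b) b) (\<lambda>z. \<bar>h (x + r *\<^sub>R z)\<bar>)
      = integral (cbox (-b) b) (\<lambda>z. indicator (cbox (-b) b) z * \<bar>h (x + r *\<^sub>R z)\<bar>)"
    by (intro integral_cong) auto
  also have "\<dots> = (\<integral>z. indicator (cbox (-b) b) z * \<bar>h (x + r *\<^sub>R z)\<bar> \<partial>lborel)"
    by (rule integrable_cbox_support(2)[symmetric]) 
      (auto intro!: continuous_on_eq[OF contQ])
  also have "\<dots> \<le> (\<integral>y. ?f (x + r *\<^sub>R y) \<partial>lborel)"
    by (rule integral_mono[OF int3 int2]) (use Q in_ball in \<open>auto simp: indicator_def\<close>)
  finally show ?thesis unfolding eq .
qed

lemma has_real_derivative_mean: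
  fixes h :: "real^'n::finite \<Rightarrow> real"
  assumes h: "C1_on V h" and B: "transpose B = B"
    and V: "\<And>\<rho> z. 0 \<le> \<rho> \<Longrightarrow> \<rho> \<le> r \<Longrightarrow> z \<in> cbox (-b) b \<Longrightarrow> x + \<rho> *\<^sub>R z \<in> V"
    and \<rho>: "\<rho> \<in> {0..r}"
  shows "((\<lambda>\<rho>. integral (cbox (-b) b) (\<lambda>z. h (x + \<rho> *\<^sub>R z) * bump B z)) has_real_derivative
    integral (cbox (-b) b) (\<lambda>z. (\<Sum>i\<in>UNIV. z $ i * partial_deriv i h (x + \<rho> *\<^sub>R z)) * bump B z))
    (at \<rho> within {0..r})"
proof (rule leibniz_rule_field_derivative)
  fix \<rho> z assume *: "\<rho> \<in> {0..r}" "z \<in> cbox (-b) b"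
  then have "h differentiable (at (x + \<rho> *\<^sub>R z))"
    using V C1_on_differentiable[OF h] by auto
  from has_real_derivative_line[OF this]
  show "((\<lambda>\<rho>. h (x + \<rho> *\<^sub>R z) * bump B z) has_real_derivative
      (\<Sum>i\<in>UNIV. z $ i * partial_deriv i h (x + \<rho> *\<^sub>R z)) * bump B z) (at \<rho> within {0..r})"
    by (rule DERIV_cmult_right)
next
  fix \<rho> assume *: "\<rho> \<in> {0..r}"
  show "(\<lambda>z. h (x + \<rho> *\<^sub>R z) * bump B z) integrable_on cbox (-b) b"
    using V * by (intro integrable_continuous continuous_on_mult continuous_on_compose2[OF C1_on_continuous[OF h]]
        C1_on_continuous[OF C1_on_bump[OF B]] continuous_intros) auto
next
  have 1: "continuous_on ({0..r} \<times> cbox (-b) b) (\<lambda>p. bump B (snd p))"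
    using C1_on_continuous[OF C1_on_bump[OF B, of UNIV]]
    by (rule continuous_on_compose2) (auto intro: continuous_intros)
  have 2: "continuous_on ({0..r} \<times> cbox (-b) b) (\<lambda>p. partial_deriv i h (x + fst p *\<^sub>R snd p))" for i
    using C1_on_continuous_partial[OF h]
    by (rule continuous_on_compose2) (use V in \<open>auto intro!: continuous_intros\<close>)
  show "continuous_on ({0..r} \<times> cbox (-b) b)
     (\<lambda>(\<rho>, z). (\<Sum>i\<in>UNIV. z $ i * partial_deriv i h (x + \<rho> *\<^sub>R z)) * bump B z)"
    unfolding case_prod_unfold
    by (intro continuous_on_mult continuous_on_sum 1 2 continuous_intros)
qed (use \<rho> in auto)

text \<open>The weighted mean of \<open>h\<close> at scale \<open>\<rho>\<close> is
  \<open>h x\<close> times the kernel mass at \<open>\<rho> = 0\<close> and is bounded by an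
  unweighted L^1 mean at \<open>\<rho> = r\<close>; the mean value theorem bounds the difference by
  the derivative from \<open>mean_deriv_identity\<close>. Here \<open>S\<close> and \<open>T\<close>
  bound \<open>h\<close> and the divergence, \<open>\<beta>\<close> bounds the entries of
  \<open>B *v z\<close> on the box, and \<open>L\<close> bounds the error \<open>E / \<rho>\<close>.
  The number \<open>s\<close> is chosen so that the ellipsoid \<open>quad B z \<le> 1\<close> lies
  in the box of half side \<open>s\<close>, and \<open>\<sigma>\<close> bounds the norm on that
  box.\<close>

lemma local_mean_estimate:
  fixes h :: "real^'n::finite \<Rightarrow> real" and a :: "'n \<Rightarrow> 'n \<Rightarrow> real^'n \<Rightarrow> real"
  assumes V: "open V" and B: "transpose B = B" and m: "m > 0" "\<And>z. quad B z \<ge> m * (norm z)\<^sup>2"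
    and s: "s = 1 / sqrt m" "b = (\<chi> i. s)" "\<sigma> = real CARD('n) * s"
    and r: "r > 0" "cball x (\<sigma> * r) \<subseteq> V" and w0: "w0 > 0" and N: "N \<ge> 0"
    and h: "C1_on V h" and a: "\<And>i j. C1_on V (a i j)" and sym: "\<And>i j y. y \<in> V \<Longrightarrow> a i j y = a j i y"
    and X: "\<And>j. C1_on V (\<lambda>y. \<Sum>i\<in>UNIV. a j i y * partial_deriv i h y)"
    and a0: "\<And>i z. (\<Sum>j\<in>UNIV. a i j x * (B *v z) $ j) = w0 * z $ i"
    and BN: "\<And>i j. \<bar>B $ i $ j\<bar> \<le> N"
    and aN: "\<And>i j k y. y \<in> cball x (\<sigma> * r) \<Longrightarrow> \<bar>partial_deriv k (a i j) y\<bar> \<le> N"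
    and S: "\<And>y. y \<in> cball x (\<sigma> * r) \<Longrightarrow> \<bar>h y\<bar> \<le> S"
    and T: "\<And>y. y \<in> cball x (\<sigma> * r) \<Longrightarrow>
       \<bar>\<Sum>j\<in>UNIV. partial_deriv j (\<lambda>y. \<Sum>i\<in>UNIV. a j i y * partial_deriv i h y) y\<bar> \<le> T"
  defines "\<beta> \<equiv> real CARD('n) * (N * \<sigma>)"
  defines "L \<equiv> real CARD('n) * (real CARD('n) * (N * \<beta> + (real CARD('n) * (\<sigma> * N)) * (N + 4 * \<beta>\<^sup>2)))"
  shows "\<bar>h x\<bar> * integral (cbox (-b) b) (bump B)
    \<le> integral\<^sup>L lborel (\<lambda>y. indicator (cball x (\<sigma> * r)) y * \<bar>h y\<bar>) / r ^ CARD('n)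
      + r * (((r * T + S * L) * (2 * s) ^ CARD('n)) / w0)"
proof -
  let ?Q = "cbox (-b) b"
  define K where "K = {z. quad B z \<le> 1}"
  have s0: "s > 0" using m s by simp
  then have \<sigma>0: "\<sigma> > 0" using s by simp
  have \<beta>0: "\<beta> \<ge> 0" unfolding \<beta>_def using N \<sigma>0 by simp
  have norm_K: "norm z \<le> s" if "z \<in> K" for z
  proof -
    have "m * (norm z)\<^sup>2 \<le> 1" using that m(2)[of z] by (simp add: K_def)
    then have "(sqrt m * norm z)\<^sup>2 \<le> 1\<^sup>2" using m(1) by (simp add: power_mult_distrib)
    then have "sqrt m * norm z \<le> 1" by (rule power2_le_imp_le) simp
    then show ?thesis using m(1) by (simp add: s(1) pos_le_divide_eq mult.commute)
  qed
  have "closed K"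
    unfolding K_def using C1_on_continuous[OF C1_on_quad[OF B, of UNIV]]
    by (intro closed_Collect_le continuous_intros)
  moreover have "bounded K" using norm_K by (auto simp: bounded_iff)
  ultimately have K: "compact K" by (simp add: compact_eq_bounded_closed)
  have KQ: "K \<subseteq> ?Q"
  proof
    fix z assume "z \<in> K"
    then have "\<bar>z $ i\<bar> \<le> s" for i using norm_K component_le_norm_cart order_trans by blast
    then show "z \<in> ?Q" by (auto simp: mem_box_cart s(2) abs_le_iff minus_le_iff)
  qed
  have normQ: "norm z \<le> \<sigma>" if "z \<in> ?Q" for z
  proof -
    have "\<bar>z $ i\<bar> \<le> s" for i using that by (auto simp: mem_box_cart s(2) abs_le_iff minus_le_iff)
    then have "(\<Sum>i\<in>UNIV. \<bar>z $ i\<bar>) \<le> \<sigma>"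
      using abs_sum_le_card[of "\<lambda>i. \<bar>z $ i\<bar>" s] by (simp add: s(3))
    then show ?thesis using norm_le_l1_cart[of z] by linarith
  qed
  have in_ball: "x + \<rho> *\<^sub>R z \<in> cball x (\<sigma> * r)" if "0 \<le> \<rho>" "\<rho> \<le> r" "z \<in> ?Q" for \<rho> z
    using that normQ[of z] mult_mono[of \<rho> r "norm z" \<sigma>] r(1) by (simp add: dist_norm mult.commute)
  have in_V: "x + \<rho> *\<^sub>R z \<in> V" if "0 \<le> \<rho>" "\<rho> \<le> r" "z \<in> ?Q" for \<rho> z
    using in_ball that r(2) by blast
  have xV: "x \<in> V" using r \<sigma>0 by auto
  have KS: "quad B z \<ge> 1" if "z \<notin> K" for z using that by (simp add: K_def)
  have content: "measure lborel ?Q = (2 * s) ^ CARD('n)"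
    using s0 by (subst content_cbox_cart) (auto simp: s(2) interval_eq_empty_cart not_less)
  have bump01: "0 \<le> bump B z" "bump B z \<le> 1" for z
  proof -
    have "0 \<le> quad B z" using m(1) m(2)[of z] by (meson order_trans mult_nonneg_nonneg less_imp_le zero_le_power2)
    then show "bump B z \<le> 1" "0 \<le> bump B z" by (auto simp: bump_def intro!: power_le_one)
  qed
  have pot01: "\<bar>bump_potential B z\<bar> \<le> 1" for z
  proof -
    have "0 \<le> quad B z" using m(1) m(2)[of z] by (meson order_trans mult_nonneg_nonneg less_imp_le zero_le_power2)
    then have "max 0 (1 - quad B z) ^ 3 \<le> 1" by (auto intro!: power_le_one)
    then show ?thesis by (simp add: bump_potential_def)
  qed
  have Bz: "\<bar>(B *v z) $ j\<bar> \<le> \<beta>" if "z \<in> ?Q" for z j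
    unfolding matrix_vector_mult_def vec_lambda_beta \<beta>_def
    using BN component_le_norm_cart[of z] normQ[OF that] N
    by (intro abs_sum_le_card) (auto simp: abs_mult intro!: mult_mono intro: order_trans)
  have Bbump: "\<bar>(B *v z) $ j * bump B z\<bar> \<le> \<beta>" if "z \<in> ?Q" for z j
    using mult_mono[OF Bz[OF that, of j] bump01(2)[of z]] bump01(1)[of z] \<beta>0 by (simp add: abs_mult)
  have pBbump: "\<bar>partial_deriv i (\<lambda>z. (B *v z) $ j * bump B z) z\<bar> \<le> N + 4 * \<beta>\<^sup>2" if "z \<in> ?Q" for z i j
  proof -
    have q: "0 \<le> quad B z" using m(1) m(2)[of z] by (meson order_trans mult_nonneg_nonneg less_imp_le zero_le_power2)
    have "partial_deriv i (\<lambda>z. (B *v z) $ j * bump B z) z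
       = (B *v z) $ j * (- 4 * max 0 (1 - quad B z) * (B *v z) $ i) + B $ j $ i * bump B z"
      using C1_on_differentiable[OF C1_on_matrix_vector[of UNIV B j]]
        C1_on_differentiable[OF C1_on_bump[OF B, of UNIV]]
      by (subst partial_deriv_mult) (auto simp: partial_deriv_bump[OF B] partial_deriv_matrix_vector)
    also have "\<bar>\<dots>\<bar> \<le> \<bar>(B *v z) $ j\<bar> * (4 * \<bar>max 0 (1 - quad B z)\<bar> * \<bar>(B *v z) $ i\<bar>) + \<bar>B $ j $ i\<bar> * bump B z"
      using bump01(1)[of z] by (intro order_trans[OF abs_triangle_ineq] add_mono) (simp_all add: abs_mult)
    also have "\<dots> \<le> \<beta> * (4 * 1 * \<beta>) + N * 1"
      using q bump01[of z] Bz[OF that] BN N \<beta>0 by (intro add_mono mult_mono) auto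
    finally show ?thesis by (simp add: power2_eq_square)
  qed
  let ?E = "\<lambda>\<rho> z. \<Sum>i\<in>UNIV. \<Sum>j\<in>UNIV. \<rho> * partial_deriv i (a i j) (x + \<rho> *\<^sub>R z) * ((B *v z) $ j * bump B z)
      + (a i j (x + \<rho> *\<^sub>R z) - a i j x) * partial_deriv i (\<lambda>z. (B *v z) $ j * bump B z) z"
  have E: "\<bar>?E \<rho> z\<bar> \<le> \<rho> * L" if "0 < \<rho>" "\<rho> \<le> r" "z \<in> ?Q" for \<rho> z
  proof -
    have "\<bar>?E \<rho> z\<bar> \<le> real CARD('n) * (real CARD('n) * (\<rho> * N * \<beta> + (\<rho> * (real CARD('n) * (\<sigma> * N))) * (N + 4 * \<beta>\<^sup>2)))"
    proof (intro abs_sum_le_card)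
      fix i j
      have 1: "\<bar>\<rho> * partial_deriv i (a i j) (x + \<rho> *\<^sub>R z) * ((B *v z) $ j * bump B z)\<bar> \<le> \<rho> * N * \<beta>"
        unfolding abs_mult[of "\<rho> * _"] abs_mult[of \<rho>]
        using that aN[OF in_ball[of \<rho> z]] Bbump[OF that(3)] N by (intro mult_mono) auto
      have "\<bar>a i j (x + \<rho> *\<^sub>R z) - a i j x\<bar> \<le> \<rho> * (real CARD('n) * (norm z * N))"
        using that by (intro line_increment_bound[OF a] in_V aN in_ball) auto
      also have "\<dots> \<le> \<rho> * (real CARD('n) * (\<sigma> * N))"
        using that normQ[OF that(3)] N by (intro mult_left_mono mult_right_mono) auto
      finally have 2: "\<bar>(a i j (x + \<rho> *\<^sub>R z) - a i j x) * partial_deriv i (\<lambda>z. (B *v z) $ j * bump B z) z\<bar>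
          \<le> (\<rho> * (real CARD('n) * (\<sigma> * N))) * (N + 4 * \<beta>\<^sup>2)"
        unfolding abs_mult using pBbump[OF that(3)] that N \<sigma>0 by (intro mult_mono) auto
      show "\<bar>\<rho> * partial_deriv i (a i j) (x + \<rho> *\<^sub>R z) * ((B *v z) $ j * bump B z)
        + (a i j (x + \<rho> *\<^sub>R z) - a i j x) * partial_deriv i (\<lambda>z. (B *v z) $ j * bump B z) z\<bar>
        \<le> \<rho> * N * \<beta> + (\<rho> * (real CARD('n) * (\<sigma> * N))) * (N + 4 * \<beta>\<^sup>2)"
        using 1 2 by linarith
    qed
    also have "\<dots> = \<rho> * L" unfolding L_def by (simp add: algebra_simps)
    finally show ?thesis .
  qed
  have S0: "S \<ge> 0" using S[of x] r(1) \<sigma>0 by (auto intro: order_trans[OF abs_ge_zero])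
  have T0: "T \<ge> 0" using T[of x] r(1) \<sigma>0 by (auto intro: order_trans[OF abs_ge_zero])
  have L0: "L \<ge> 0" unfolding L_def using N \<beta>0 \<sigma>0 by simp
  let ?m = "\<lambda>\<rho>. integral ?Q (\<lambda>z. h (x + \<rho> *\<^sub>R z) * bump B z)"
  let ?m' = "\<lambda>\<rho>. integral ?Q (\<lambda>z. (\<Sum>i\<in>UNIV. z $ i * partial_deriv i h (x + \<rho> *\<^sub>R z)) * bump B z)"
  let ?C = "((r * T + S * L) * (2 * s) ^ CARD('n)) / w0"
  have m': "(?m has_real_derivative ?m' \<rho>) (at \<rho> within {0..r})" if "\<rho> \<in> {0..r}" for \<rho>
    by (rule has_real_derivative_mean[OF h B in_V that])
  \<comment> \<open>Only the open interval is treated, since the identity divides by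
    \<open>\<rho>\<close>; together with continuity up to the end points this suffices for the mean
    value theorem.\<close>
  have bound: "\<bar>?m' \<rho>\<bar> \<le> ?C" if "0 < \<rho>" "\<rho> < r" for \<rho>
  proof -
    let ?D = "\<lambda>y. \<Sum>j\<in>UNIV. partial_deriv j (\<lambda>y. \<Sum>i\<in>UNIV. a j i y * partial_deriv i h y) y"
    let ?F = "\<lambda>z. \<rho> * ?D (x + \<rho> *\<^sub>R z) * bump_potential B z + h (x + \<rho> *\<^sub>R z) * ?E \<rho> z / \<rho>"
    have inV: "x + \<rho> *\<^sub>R z \<in> V" if "z \<in> ?Q" for z using in_V[of \<rho> z] that \<open>0 < \<rho>\<close> \<open>\<rho> < r\<close> by simp
    note id = mean_deriv_identity[OF V B K KQ KS that(1) inV h a sym X a0 xV]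
    have "w0 * \<bar>?m' \<rho>\<bar> = \<bar>w0 * ?m' \<rho>\<bar>" using w0 by (simp add: abs_mult)
    also have "\<dots> = \<bar>integral ?Q ?F\<bar>" by (rule arg_cong[OF id(1)])
    also have "\<dots> \<le> (r * T + S * L) * measure lborel ?Q"
    proof (subst real_norm_def[symmetric], rule has_integral_bound[where f = ?F])
      show "0 \<le> r * T + S * L" using r(1) T0 S0 L0 by simp
      have y_cont: "continuous_on ?Q (\<lambda>z. f (x + \<rho> *\<^sub>R z))" if "continuous_on V f" for f :: "real^'n \<Rightarrow> real"
        using inV by (intro continuous_on_compose2[OF that] continuous_intros) auto
      show "(?F has_integral integral ?Q ?F) ?Q"
        using that unfolding divide_inverse
        by (intro integrable_integral integrable_continuous continuous_intros id(2) y_cont C1_on_continuous[OF h] C1_on_continuous_partial[OF X]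
            C1_on_continuous[OF C1_on_bump_potential[OF B]])
      fix z assume z: "z \<in> ?Q"
      have ball: "x + \<rho> *\<^sub>R z \<in> cball x (\<sigma> * r)" using in_ball[of \<rho> z] that z by simp
      have "\<bar>\<rho> * ?D (x + \<rho> *\<^sub>R z) * bump_potential B z\<bar> \<le> r * T * 1"
        unfolding abs_mult using that T[OF ball] pot01[of z] T0 by (intro mult_mono) auto
      moreover have "\<bar>h (x + \<rho> *\<^sub>R z) * ?E \<rho> z / \<rho>\<bar> \<le> S * L"
      proof -
        have "\<bar>?E \<rho> z\<bar> / \<rho> \<le> L" using E[of \<rho> z] that z by (simp add: field_simps)
        then have "\<bar>h (x + \<rho> *\<^sub>R z)\<bar> * (\<bar>?E \<rho> z\<bar> / \<rho>) \<le> S * L"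
          using S[OF ball] S0 that by (intro mult_mono) auto
        then show ?thesis using that by (simp add: abs_mult)
      qed
      ultimately show "norm (?F z) \<le> r * T + S * L" unfolding real_norm_def by linarith
    qed
    finally show ?thesis using w0 content by (simp add: field_simps)
  qed
  have "continuous_on {0..r} ?m"
    using m' by (meson DERIV_continuous continuous_on_eq_continuous_within)
  moreover have "(?m has_derivative (*) (?m' \<rho>)) (at \<rho>)" if "0 < \<rho>" "\<rho> < r" for \<rho>
    using m'[of \<rho>] that by (simp add: at_within_Icc_at has_field_derivative_def)
  ultimately obtain \<xi> where \<xi>: "0 < \<xi>" "\<xi> < r" "?m r - ?m 0 = ?m' \<xi> * (r - 0)"
    using mvt[OF r(1), of ?m "\<lambda>\<rho>. (*) (?m' \<rho>)"] by auto
  have "\<bar>?m r - ?m 0\<bar> \<le> r * ?C"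
    unfolding \<xi>(3) abs_mult using mult_right_mono[OF bound[OF \<xi>(1,2)], of r] r(1)
    by (simp only: diff_0_right abs_of_pos mult.commute)
  moreover have "\<bar>?m 0\<bar> = \<bar>h x\<bar> * integral ?Q (bump B)"
  proof -
    have "integral ?Q (bump B) \<ge> 0" by (intro integral_nonneg integrable_continuous C1_on_continuous C1_on_bump B bump01)
    then show ?thesis by (simp add: abs_mult)
  qed
  moreover have "\<bar>?m r\<bar> \<le> integral ?Q (\<lambda>z. \<bar>h (x + r *\<^sub>R z)\<bar>)"
  proof -
    have ch: "continuous_on ?Q (\<lambda>z. h (x + r *\<^sub>R z))"
      using in_V[of r] r(1) by (intro continuous_on_compose2[OF C1_on_continuous[OF h]] continuous_intros) auto
    have cb: "continuous_on ?Q (bump B)" by (rule C1_on_continuous[OF C1_on_bump[OF B]])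
    have "norm (?m r) \<le> integral ?Q (\<lambda>z. \<bar>h (x + r *\<^sub>R z)\<bar>)"
      using bump01 ch cb
      by (intro integral_norm_bound_integral integrable_continuous continuous_intros)
         (auto simp: abs_mult intro!: mult_left_le)
    then show ?thesis by simp
  qed
  moreover have "integral ?Q (\<lambda>z. \<bar>h (x + r *\<^sub>R z)\<bar>)
      \<le> integral\<^sup>L lborel (\<lambda>y. indicator (cball x (\<sigma> * r)) y * \<bar>h y\<bar>) / r ^ CARD('n)"
    using r continuous_on_subset[OF C1_on_continuous[OF h]] normQ
    by (intro integral_abs_cbox_scaled_le) auto
  ultimately show ?thesis by linarith
qed

text \<open>On the smaller box of half side \<open>\<epsilon>\<close> the form is at most 1/2, so
  the kernel is at least 1/4 there. Dividing by this mass turns the mean estimate into a bound for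
  \<open>h x\<close>.\<close>

lemma integral_bump_ge:
  fixes B :: "real^'n::finite^'n"
  assumes B: "transpose B = B" and BN: "\<And>i j. \<bar>B $ i $ j\<bar> \<le> N" and N: "N > 0"
    and \<epsilon>: "0 < \<epsilon>" "\<epsilon> \<le> s" "(real CARD('n))\<^sup>2 * N * \<epsilon>\<^sup>2 \<le> 1 / 2"
  shows "(2 * \<epsilon>) ^ CARD('n) / 4 \<le> integral (cbox (-(\<chi> i. s)) (\<chi> i. s)) (bump B)"
proof -
  let ?q = "cbox (-(\<chi> i. \<epsilon>)) (\<chi> i. \<epsilon>) :: (real^'n) set"
  have nonneg: "bump B z \<ge> 0" for z by (simp add: bump_def)
  have int: "bump B integrable_on cbox a b" for a b
    by (intro integrable_continuous C1_on_continuous C1_on_bump B)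
  have "quad B z \<le> 1 / 2" if "z \<in> ?q" for z
  proof -
    have z: "\<bar>z $ i\<bar> \<le> \<epsilon>" for i using that by (auto simp: mem_box_cart abs_le_iff minus_le_iff)
    have "\<bar>(B *v z) $ j\<bar> \<le> real CARD('n) * (N * \<epsilon>)" for j
      unfolding matrix_vector_mult_def vec_lambda_beta
      using BN z N by (intro abs_sum_le_card) (auto simp: abs_mult intro!: mult_mono)
    then have "\<bar>quad B z\<bar> \<le> real CARD('n) * (\<epsilon> * (real CARD('n) * (N * \<epsilon>)))"
      unfolding quad_def inner_vec_def inner_real_def
      using z \<epsilon>(1) by (intro abs_sum_le_card) (auto simp: abs_mult intro!: mult_mono)
    then show ?thesis using \<epsilon>(3) by (simp add: power2_eq_square mult_ac)
  qed
  then have q: "bump B z \<ge> 1 / 4" if "z \<in> ?q" for z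
    using that power_mono[of "1/2" "max 0 (1 - quad B z)" 2] by (force simp: bump_def power_divide)
  have "(2 * \<epsilon>) ^ CARD('n) / 4 = integral ?q (\<lambda>_. 1 / 4)"
    using \<epsilon>(1) by (simp add: content_cbox_cart interval_eq_empty_cart not_less)
  also have "\<dots> \<le> integral ?q (bump B)"
    by (rule integral_le[OF _ int q]) auto
  also have "\<dots> \<le> integral (cbox (-(\<chi> i. s)) (\<chi> i. s)) (bump B)"
    proof (intro integral_subset_le int ballI nonneg)
    have "- s \<le> t \<and> t \<le> s" if "- \<epsilon> \<le> t \<and> t \<le> \<epsilon>" for t using that \<epsilon>(2) by linarith
    then show "?q \<subseteq> cbox (-(\<chi> i. s)) (\<chi> i. s)" by (auto simp: mem_box_cart)
  qed
  finally show ?thesis .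
qed

text \<open>The minimum over the compact product of \<open>K\<close> with the unit sphere, extended
  to all vectors by homogeneity of degree 2.\<close>

lemma quad_lower_bound:
  fixes G :: "real^'n::finite \<Rightarrow> real^'n^'n"
  assumes "compact K" "continuous_on K G" "\<And>y v. y \<in> K \<Longrightarrow> v \<noteq> 0 \<Longrightarrow> v \<bullet> (G y *v v) > 0"
  obtains m where "m > 0" "\<And>y v. y \<in> K \<Longrightarrow> quad (G y) v \<ge> m * (norm v)\<^sup>2"
proof (cases "K = {}")
  case True
  then show ?thesis using that[of 1] by simp
next
  case False
  let ?S = "K \<times> sphere (0::real^'n) 1"
  have "axis undefined 1 \<in> sphere (0::real^'n) 1" by simp
  with False have ne: "?S \<noteq> {}" by blast
  have "continuous_on ?S (\<lambda>p. G (fst p))"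
    using assms(2) by (rule continuous_on_compose2) (auto intro: continuous_intros)
  then have "continuous_on ?S (\<lambda>p. quad (G (fst p)) (snd p))"
    unfolding quad_def inner_vec_def inner_real_def matrix_vector_mult_def vec_lambda_beta
    by (intro continuous_intros)
  moreover have "compact ?S" using assms(1) by (intro compact_Times) auto
  ultimately obtain p where p: "p \<in> ?S" "\<And>p'. p' \<in> ?S \<Longrightarrow> quad (G (fst p)) (snd p) \<le> quad (G (fst p')) (snd p')"
    using continuous_attains_inf[OF _ ne] by blast
  define m where "m = quad (G (fst p)) (snd p)"
  have "norm (snd p) = 1" "fst p \<in> K" using p(1) by auto
  then have "snd p \<noteq> 0" "fst p \<in> K" by auto
  then have "m > 0" unfolding m_def quad_def by (intro assms(3))
  moreover have "quad (G y) v \<ge> m * (norm v)\<^sup>2" if "y \<in> K" for y v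
  proof (cases "v = 0")
    case True then show ?thesis by (simp add: quad_def)
  next
    case False
    have "m \<le> quad (G y) (inverse (norm v) *\<^sub>R v)"
      using p(2)[of "(y, inverse (norm v) *\<^sub>R v)"] that False by (simp add: m_def)
    also have "\<dots> = inverse (norm v) * (inverse (norm v) * quad (G y) v)"
      by (simp add: quad_def matrix_vector_mult_scaleR)
    finally show ?thesis using False by (simp add: field_simps power2_eq_square)
  qed
  ultimately show ?thesis using that by blast
qed

text \<open>The continuous sum of all absolute values is bounded on \<open>K\<close> and dominates
  every member of the family. A single function is treated as a family indexed by
  \<open>unit\<close>.\<close>

lemma compact_uniform_bound:
  fixes f :: "'i \<Rightarrow> 'a::topological_space \<Rightarrow> real"
  assumes "finite I" "compact K" "\<And>i. i \<in> I \<Longrightarrow> continuous_on K (f i)"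
  obtains N where "N \<ge> 1" "\<And>i y. i \<in> I \<Longrightarrow> y \<in> K \<Longrightarrow> \<bar>f i y\<bar> \<le> N"
proof -
  have "compact ((\<lambda>y. \<Sum>i\<in>I. \<bar>f i y\<bar>) ` K)"
    by (intro compact_continuous_image continuous_intros assms)
  then have "bounded ((\<lambda>y. \<Sum>i\<in>I. \<bar>f i y\<bar>) ` K)" by (rule compact_imp_bounded)
  then obtain N where N: "\<And>y. y \<in> K \<Longrightarrow> \<bar>\<Sum>i\<in>I. \<bar>f i y\<bar>\<bar> \<le> N"
    unfolding bounded_real by blast
  have "\<bar>f i y\<bar> \<le> max 1 N" if "i \<in> I" "y \<in> K" for i y
  proof -
    have "\<bar>f i y\<bar> \<le> (\<Sum>i\<in>I. \<bar>f i y\<bar>)"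
      using member_le_sum[of i I "\<lambda>i. \<bar>f i y\<bar>"] that assms(1) by simp
    then show ?thesis using N[OF that(2)] by linarith
  qed
  then show ?thesis using that[of "max 1 N"] by simp
qed

text \<open>All balls in question lie in the compact ball of radius \<open>2 * r0\<close>, on which
  the Gram matrix, the derivatives of the coefficients, \<open>w\<close> and \<open>1 / w\<close>
  are bounded; hence one \<open>C\<close> serves every centre and radius. The bound on the
  divergence carries the factor \<open>w y\<close> because the divergence will be the volume density
  times the Laplacian.\<close>

lemma uniform_mean_estimate:
  fixes G :: "real^'n::finite \<Rightarrow> real^'n^'n" and a :: "'n \<Rightarrow> 'n \<Rightarrow> real^'n \<Rightarrow> real"
  assumes V: "open V" "cball x0 (2 * r0) \<subseteq> V" and r0: "r0 > 0"
    and G: "continuous_on V G" "\<And>y. y \<in> V \<Longrightarrow> transpose (G y) = G y"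
      "\<And>y v. y \<in> V \<Longrightarrow> v \<noteq> 0 \<Longrightarrow> v \<bullet> (G y *v v) > 0"
    and a: "\<And>i j. C1_on V (a i j)" and sym: "\<And>i j y. y \<in> V \<Longrightarrow> a i j y = a j i y"
    and w: "continuous_on V w" "\<And>y. y \<in> V \<Longrightarrow> w y > 0"
    and aG: "\<And>i y z. y \<in> V \<Longrightarrow> (\<Sum>j\<in>UNIV. a i j y * (G y *v z) $ j) = w y * z $ i"
  obtains C where "C > 0"
    "\<And>x r h S T. x \<in> cball x0 r0 \<Longrightarrow> 0 < r \<Longrightarrow> r \<le> r0 \<Longrightarrow> C1_on V h \<Longrightarrow>
      (\<And>j. C1_on V (\<lambda>y. \<Sum>i\<in>UNIV. a j i y * partial_deriv i h y)) \<Longrightarrow>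
      (\<And>y. y \<in> cball x r \<Longrightarrow> \<bar>h y\<bar> \<le> S) \<Longrightarrow>
      (\<And>y. y \<in> cball x r \<Longrightarrow>
         \<bar>\<Sum>j\<in>UNIV. partial_deriv j (\<lambda>y. \<Sum>i\<in>UNIV. a j i y * partial_deriv i h y) y\<bar> \<le> w y * T) \<Longrightarrow>
      \<bar>h x\<bar> \<le> C * (integral\<^sup>L lborel (\<lambda>y. indicator (cball x r) y * \<bar>h y\<bar>) / r ^ CARD('n)
                 + r * (S + r * T))"
proof -
  let ?K = "cball x0 (2 * r0)"
  let ?n = "real CARD('n)"
  have contG: "continuous_on ?K G" using continuous_on_subset[OF G(1) V(2)] .
  obtain m where m: "m > 0" "\<And>y v. y \<in> ?K \<Longrightarrow> quad (G y) v \<ge> m * (norm v)\<^sup>2"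
    using quad_lower_bound[OF compact_cball contG] G(3) V(2) by blast
  have contG': "continuous_on ?K (\<lambda>y. G y $ i $ j)" for i j
    by (intro continuous_intros contG)
  obtain N1 where N1: "N1 \<ge> 1" "\<And>p y. p \<in> UNIV \<Longrightarrow> y \<in> ?K \<Longrightarrow> \<bar>G y $ fst p $ snd p\<bar> \<le> N1"
    using compact_uniform_bound[of "UNIV :: ('n \<times> 'n) set" ?K "\<lambda>p y. G y $ fst p $ snd p"] contG'
    by auto
  obtain N2 where N2: "N2 \<ge> 1" "\<And>p y. p \<in> UNIV \<Longrightarrow> y \<in> ?K \<Longrightarrow>
      \<bar>partial_deriv (fst p) (a (fst (snd p)) (snd (snd p))) y\<bar> \<le> N2"
    using compact_uniform_bound[of "UNIV :: ('n \<times> 'n \<times> 'n) set" ?K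
       "\<lambda>p y. partial_deriv (fst p) (a (fst (snd p)) (snd (snd p))) y"]
      continuous_on_subset[OF C1_on_continuous_partial[OF a] V(2)] by auto
  obtain N3 where N3: "N3 \<ge> 1" "\<And>y. y \<in> ?K \<Longrightarrow> \<bar>w y\<bar> \<le> N3"
    using compact_uniform_bound[of "UNIV :: unit set" ?K "\<lambda>_. w"] continuous_on_subset[OF w(1) V(2)] by auto
  have "continuous_on ?K (\<lambda>y. 1 / w y)"
    using w(2) V(2) by (intro continuous_intros continuous_on_subset[OF w(1) V(2)]) force
  then obtain N4 where N4: "N4 \<ge> 1" "\<And>y. y \<in> ?K \<Longrightarrow> \<bar>1 / w y\<bar> \<le> N4"
    using compact_uniform_bound[of "UNIV :: unit set" ?K "\<lambda>_ y. 1 / w y"] by auto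
  define N where "N = N1 + N2"
  define s where "s = 1 / sqrt m"
  define \<sigma> where "\<sigma> = ?n * s"
  define \<beta> where "\<beta> = ?n * (N * \<sigma>)"
  define L where "L = ?n * (?n * (N * \<beta> + (?n * (\<sigma> * N)) * (N + 4 * \<beta>\<^sup>2)))"
  \<comment> \<open>Gives \<open>?n * \<epsilon> * N \<le> 1 / 2\<close> and, since \<open>N\<close>
    exceeds 1, also \<open>?n * \<epsilon> \<le> 1\<close>; the product of the two is the smallness
    required by \<open>integral_bump_ge\<close>.\<close>
  define \<epsilon> where "\<epsilon> = min s (1 / (2 * ?n * N))"
  define \<Phi> where "\<Phi> = (2 * \<epsilon>) ^ CARD('n) / 4"
  have n1: "?n \<ge> 1" by (simp add: Suc_leI)
  have N: "N \<ge> 2" unfolding N_def using N1(1) N2(1) by simp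
  have s0: "s > 0" unfolding s_def using m(1) by simp
  have \<sigma>0: "\<sigma> > 0" unfolding \<sigma>_def using s0 n1 by simp
  have \<beta>0: "\<beta> \<ge> 0" unfolding \<beta>_def using \<sigma>0 N by simp
  have L0: "L \<ge> 0" unfolding L_def using N \<beta>0 \<sigma>0 by simp
  have \<epsilon>0: "\<epsilon> > 0" unfolding \<epsilon>_def using s0 n1 N by simp
  have \<Phi>0: "\<Phi> > 0" unfolding \<Phi>_def using \<epsilon>0 by simp
  have \<epsilon>s: "\<epsilon> \<le> s" "?n\<^sup>2 * N * \<epsilon>\<^sup>2 \<le> 1 / 2"
  proof -
    have "\<epsilon> \<le> 1 / (2 * ?n * N)" unfolding \<epsilon>_def by simp
    then have "?n * \<epsilon> * N \<le> 1 / 2" using n1 N by (simp add: field_simps)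
    moreover have "?n * \<epsilon> \<le> 1"
    proof -
      have "?n * \<epsilon> * 1 \<le> ?n * \<epsilon> * N" using N n1 \<epsilon>0 by (intro mult_left_mono) auto
      then show ?thesis using \<open>?n * \<epsilon> * N \<le> 1 / 2\<close> by linarith
    qed
    ultimately have "(?n * \<epsilon> * N) * (?n * \<epsilon>) \<le> 1 / 2 * 1"
      using n1 \<epsilon>0 N by (intro mult_mono) auto
    then show "?n\<^sup>2 * N * \<epsilon>\<^sup>2 \<le> 1 / 2" by (simp add: power2_eq_square mult_ac)
  qed (simp add: \<epsilon>_def)
  \<comment> \<open>\<open>C1\<close> and \<open>C2\<close> result from inserting
    \<open>\<rho> = r / \<sigma>\<close> into the local estimate and dividing by the lower bound
    \<open>\<Phi>\<close> of the kernel mass.\<close>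
  define C1 where "C1 = (\<sigma> ^ CARD('n)) / \<Phi>"
  define C2 where "C2 = ((2 * s) ^ CARD('n)) * N4 / (\<sigma> * \<Phi>) * (N3 / \<sigma> + L)"
  have C1: "C1 > 0" unfolding C1_def using \<sigma>0 \<Phi>0 by simp
  have C2: "C2 \<ge> 0" unfolding C2_def using s0 N4(1) N3(1) \<sigma>0 \<Phi>0 L0 by simp
  show ?thesis
  proof (rule that)
    show "C1 + C2 > 0" using C1 C2 by simp
    fix x r h S T
    assume x: "x \<in> cball x0 r0" and r: "0 < r" "r \<le> r0" and h: "C1_on V h"
      and X: "\<And>j. C1_on V (\<lambda>y. \<Sum>i\<in>UNIV. a j i y * partial_deriv i h y)"
      and S: "\<And>y. y \<in> cball x r \<Longrightarrow> \<bar>h y\<bar> \<le> S"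
      and T: "\<And>y. y \<in> cball x r \<Longrightarrow>
         \<bar>\<Sum>j\<in>UNIV. partial_deriv j (\<lambda>y. \<Sum>i\<in>UNIV. a j i y * partial_deriv i h y) y\<bar> \<le> w y * T"
    have ball: "cball x r \<subseteq> ?K"
    proof
      fix y assume "y \<in> cball x r"
      then show "y \<in> ?K" using x r dist_triangle[of x0 y x] by auto
    qed
    have xK: "x \<in> ?K" using x r0 by auto
    have xV: "x \<in> V" using xK V(2) by blast
    have S0: "S \<ge> 0" using S[of x] r by (auto intro: order_trans[OF abs_ge_zero])
    have "0 \<le> w x * T" using T[of x] r by (auto intro: order_trans[OF abs_ge_zero])
    then have T0: "T \<ge> 0" using w(2)[OF xV] by (simp add: zero_le_mult_iff)
    \<comment> \<open>The local estimate at scale \<open>\<rho>\<close> involves the ball of radius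
      \<open>\<sigma> * \<rho>\<close>, which is then exactly \<open>cball x r\<close>.\<close>
    define \<rho> where "\<rho> = r / \<sigma>"
    have \<rho>: "\<rho> > 0" "\<sigma> * \<rho> = r" using r \<sigma>0 by (auto simp: \<rho>_def)
    let ?I = "integral\<^sup>L lborel (\<lambda>y. indicator (cball x r) y * \<bar>h y\<bar>)"
    let ?J = "integral (cbox (-(\<chi> i. s)) (\<chi> i. s)) (bump (G x))"
    have BN: "\<bar>G x $ i $ j\<bar> \<le> N" for i j
      using N1(2)[of "(i, j)" x] xK N2(1) by (simp add: N_def)
    have "\<bar>h x\<bar> * ?J
       \<le> integral\<^sup>L lborel (\<lambda>y. indicator (cball x (\<sigma> * \<rho>)) y * \<bar>h y\<bar>) / \<rho> ^ CARD('n)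
      + \<rho> * (((\<rho> * (N3 * T) + S * L) * (2 * s) ^ CARD('n)) / w x)"
      unfolding L_def \<beta>_def
    proof (rule local_mean_estimate[OF V(1) G(2)[OF xV] m(1) m(2)[OF xK] s_def refl \<sigma>_def \<rho>(1) _ w(2)[OF xV] _ h a sym X aG[OF xV]])
      show "cball x (\<sigma> * \<rho>) \<subseteq> V" using \<rho> ball V(2) by blast
      show "0 \<le> N" using N by simp
      show "\<bar>G x $ i $ j\<bar> \<le> N" for i j by (rule BN)
      show "\<bar>partial_deriv k (a i j) y\<bar> \<le> N" if "y \<in> cball x (\<sigma> * \<rho>)" for i j k y
      proof -
        have "y \<in> ?K" using that \<rho>(2) ball by blast
        from N2(2)[OF UNIV_I this, of "(k, i, j)"] show ?thesis using N1(1) by (simp add: N_def)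
      qed
      show "\<bar>h y\<bar> \<le> S" if "y \<in> cball x (\<sigma> * \<rho>)" for y using S that \<rho> by simp
      show "\<bar>\<Sum>j\<in>UNIV. partial_deriv j (\<lambda>y. \<Sum>i\<in>UNIV. a j i y * partial_deriv i h y) y\<bar> \<le> N3 * T"
        if "y \<in> cball x (\<sigma> * \<rho>)" for y
      proof -
        have "w y * T \<le> N3 * T" using N3(2)[of y] that \<rho> ball T0 by (intro mult_right_mono) auto
        then show ?thesis using T[of y] that \<rho> by simp
      qed
    qed
    also have "\<dots> = \<sigma> ^ CARD('n) * (?I / r ^ CARD('n))
        + r * ((r * (N3 / \<sigma> * T) + S * L) * (((2 * s) ^ CARD('n)) / \<sigma> * (1 / w x)))"
      unfolding \<rho>(2) using \<sigma>0 by (simp add: \<rho>_def power_divide)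
    also have "\<dots> \<le> \<sigma> ^ CARD('n) * (?I / r ^ CARD('n))
        + r * ((r * ((N3 / \<sigma> + L) * T) + S * (N3 / \<sigma> + L)) * (((2 * s) ^ CARD('n)) / \<sigma> * N4))"
      using r T0 S0 L0 s0 \<sigma>0 N3(1) N4(2)[OF xK] w(2)[OF xV]
      by (intro add_left_mono mult_left_mono mult_mono add_mono add_nonneg_nonneg mult_nonneg_nonneg) auto
    finally have *: "\<bar>h x\<bar> * ?J \<le> \<dots>" .
    have "\<bar>h x\<bar> * \<Phi> \<le> \<bar>h x\<bar> * ?J"
      unfolding \<Phi>_def using N \<epsilon>0 \<epsilon>s BN
      by (intro mult_left_mono integral_bump_ge[where N = N] G(2) xV) auto
    with * have "\<bar>h x\<bar> \<le> (\<sigma> ^ CARD('n) * (?I / r ^ CARD('n))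
        + r * ((r * ((N3 / \<sigma> + L) * T) + S * (N3 / \<sigma> + L)) * (((2 * s) ^ CARD('n)) / \<sigma> * N4))) / \<Phi>"
      using \<Phi>0 by (simp add: pos_le_divide_eq)
    also have "\<dots> = C1 * (?I / r ^ CARD('n)) + C2 * (r * (S + r * T))"
      unfolding C1_def C2_def using \<Phi>0 \<sigma>0 by (simp add: field_simps)
    also have "\<dots> \<le> (C1 + C2) * (?I / r ^ CARD('n)) + (C1 + C2) * (r * (S + r * T))"
    proof -
      have "0 \<le> ?I" by (rule integral_nonneg_AE) auto
      then have "0 \<le> ?I / r ^ CARD('n)" using r by simp
      moreover have "0 \<le> r * (S + r * T)" using r S0 T0 by simp
      ultimately show ?thesis using C1 C2 by (intro add_mono mult_right_mono) auto
    qed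
    finally show "\<bar>h x\<bar> \<le> (C1 + C2) * (?I / r ^ CARD('n) + r * (S + r * T))"
      by (simp add: distrib_left)
  qed
qed

text \<open>The weight \<open>(R - dist x0 x)^n\<close> absorbs the supremum terms: at a maximum point, the
  estimate is applied on a ball of half the distance to the boundary.\<close>

lemma weighted_absorption:
  fixes F :: "nat \<Rightarrow> real^'n::finite \<Rightarrow> real"
  assumes cont: "\<And>m. continuous_on (cball x0 R) (F m)" and R: "R > 0" and C: "C > 0"
    and Bd: "\<And>m y. y \<in> cball x0 R \<Longrightarrow> \<bar>F m y\<bar> \<le> Bd"
    and small: "C * 2 ^ CARD('n) * R \<le> 1 / 4" "C * 2 ^ CARD('n) * (R * R * L) \<le> 1 / 4" and L: "L \<ge> 0"
    and est: "\<And>m x r S T. x \<in> cball x0 R \<Longrightarrow> 0 < r \<Longrightarrow> r \<le> R \<Longrightarrow> cball x r \<subseteq> cball x0 R \<Longrightarrow>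
       (\<And>y. y \<in> cball x r \<Longrightarrow> \<bar>F m y\<bar> \<le> S) \<Longrightarrow> (\<And>y. y \<in> cball x r \<Longrightarrow> \<bar>F (Suc m) y\<bar> \<le> T) \<Longrightarrow>
       \<bar>F m x\<bar> \<le> C * (integral\<^sup>L lborel (\<lambda>y. indicator (cball x r) y * \<bar>F m y\<bar>) / r ^ CARD('n)
                 + r * (S + r * (L * T)))"
  shows "\<bar>F 0 x0\<bar> \<le> 2 * C * 2 ^ CARD('n) *
      (\<Sum>m<k. (1/2) ^ m * integral\<^sup>L lborel (\<lambda>y. indicator (cball x0 R) y * \<bar>F m y\<bar>)) / R ^ CARD('n)
      + (1/2) ^ k * Bd"
proof -
  let ?n = "CARD('n)"
  let ?g = "\<lambda>m x. (R - dist x0 x) ^ ?n * \<bar>F m x\<bar>"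
  define I where "I = (\<lambda>m. integral\<^sup>L lborel (\<lambda>y. indicator (cball x0 R) y * \<bar>F m y\<bar>))"
  have int: "integrable lborel (\<lambda>y. indicator (cball x0 R) y * \<bar>F m y\<bar>)" for m
    using borel_integrable_compact[OF compact_cball continuous_on_rabs[OF cont]] by simp
  have I0: "I m \<ge> 0" for m unfolding I_def by (rule integral_nonneg_AE) auto
  have "\<exists>x\<in>cball x0 R. \<forall>y\<in>cball x0 R. ?g m y \<le> ?g m x" for m
    using R by (intro continuous_attains_sup continuous_intros cont) auto
  then obtain p where p: "\<And>m. p m \<in> cball x0 R" "\<And>m y. y \<in> cball x0 R \<Longrightarrow> ?g m y \<le> ?g m (p m)"
    by metis
  define M where "M = (\<lambda>m. ?g m (p m))"
  have M0: "M m \<ge> 0" for m unfolding M_def using p(1)[of m] by simp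
  have step: "M m \<le> 2 * C * 2 ^ ?n * I m + M (Suc m) / 2" for m
  proof (cases "M m = 0")
    \<comment> \<open>A maximum point on the boundary sphere has weight 0 and belongs to this case;
      in the other case \<open>\<delta>\<close> is positive.\<close>
    case True
    then show ?thesis using C I0[of m] M0[of "Suc m"] by simp
  next
    case False
    define \<delta> where "\<delta> = R - dist x0 (p m)"
    have "\<delta> \<ge> 0" using p(1)[of m] by (simp add: \<delta>_def)
    moreover have "\<delta> \<noteq> 0" using False by (auto simp: M_def \<delta>_def)
    ultimately have \<delta>: "\<delta> > 0" by simp
    have \<delta>R: "\<delta> \<le> R" by (simp add: \<delta>_def)
    let ?r = "\<delta> / 2"
    have near: "y \<in> cball x0 R" "(\<delta> / 2) ^ ?n * \<bar>F i y\<bar> \<le> M i" if "y \<in> cball (p m) ?r" for y i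
    proof -
      have d: "dist x0 y \<le> dist x0 (p m) + ?r" using that dist_triangle[of x0 y "p m"] by simp
      then show y: "y \<in> cball x0 R" using \<delta> by (simp add: \<delta>_def field_simps)
      have "\<delta> / 2 \<le> R - dist x0 y" using d by (simp add: \<delta>_def field_simps)
      then have "(\<delta> / 2) ^ ?n * \<bar>F i y\<bar> \<le> ?g i y" using \<delta> by (intro mult_right_mono power_mono) auto
      also have "\<dots> \<le> M i" unfolding M_def by (rule p(2)[OF y])
      finally show "(\<delta> / 2) ^ ?n * \<bar>F i y\<bar> \<le> M i" .
    qed
    have pos: "(\<delta> / 2) ^ ?n > 0" using \<delta> by simp
    have "\<bar>F m (p m)\<bar> \<le> C * (integral\<^sup>L lborel (\<lambda>y. indicator (cball (p m) ?r) y * \<bar>F m y\<bar>) / ?r ^ ?n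
        + ?r * (M m / (\<delta> / 2) ^ ?n + ?r * (L * (M (Suc m) / (\<delta> / 2) ^ ?n))))"
    proof (rule est[OF p(1)])
      show "\<bar>F m y\<bar> \<le> M m / (\<delta> / 2) ^ ?n" if "y \<in> cball (p m) ?r" for y
        using near(2)[OF that, of m] pos by (simp only: pos_le_divide_eq mult.commute)
      show "\<bar>F (Suc m) y\<bar> \<le> M (Suc m) / (\<delta> / 2) ^ ?n" if "y \<in> cball (p m) ?r" for y
        using near(2)[OF that, of "Suc m"] pos by (simp only: pos_le_divide_eq mult.commute)
    qed (use \<delta> \<delta>R near(1) in auto)
    also have "\<dots> \<le> C * (I m / ?r ^ ?n + ?r * (M m / (\<delta> / 2) ^ ?n + ?r * (L * (M (Suc m) / (\<delta> / 2) ^ ?n))))"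
    proof -
      have "integral\<^sup>L lborel (\<lambda>y. indicator (cball (p m) ?r) y * \<bar>F m y\<bar>) \<le> I m"
        unfolding I_def
      proof (rule integral_mono[OF _ int])
        have "continuous_on (cball (p m) ?r) (F m)"
          using near(1) by (intro continuous_on_subset[OF cont]) blast
        then show "integrable lborel (\<lambda>y. indicator (cball (p m) ?r) y * \<bar>F m y\<bar>)"
          using borel_integrable_compact[OF compact_cball continuous_on_rabs] by simp
      qed (use near(1) in \<open>auto simp: indicator_def\<close>)
      then show ?thesis using C pos by (intro mult_left_mono add_right_mono divide_right_mono) auto
    qed
    finally have "\<delta> ^ ?n * \<bar>F m (p m)\<bar> \<le> \<delta> ^ ?n * \<dots>"
      using \<delta> by (intro mult_left_mono) auto
    \<comment> \<open>Multiplying by \<open>\<delta> ^ ?n\<close> leaves \<open>2 ^ ?n\<close> from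
      each denominator \<open>(\<delta> / 2) ^ ?n\<close>, independently of \<open>\<delta>\<close>;
      the remaining factors are those bounded by \<open>small\<close>.\<close>
    also have "\<dots> = C * 2 ^ ?n * I m + (C * 2 ^ ?n * ?r) * M m + (C * 2 ^ ?n * (?r * ?r * L)) * M (Suc m)"
      using \<delta> by (simp add: power_divide field_simps)
    also have "\<dots> \<le> C * 2 ^ ?n * I m + (1 / 4) * M m + (1 / 4) * M (Suc m)"
    proof (intro add_mono mult_right_mono M0 order_refl)
      have "C * 2 ^ ?n * ?r \<le> C * 2 ^ ?n * R" using C \<delta> \<delta>R by (intro mult_left_mono) auto
      then show "C * 2 ^ ?n * ?r \<le> 1 / 4" using small(1) by linarith
      have "C * 2 ^ ?n * (?r * ?r * L) \<le> C * 2 ^ ?n * (R * R * L)"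
        using C \<delta> \<delta>R L by (intro mult_left_mono mult_right_mono mult_mono) auto
      then show "C * 2 ^ ?n * (?r * ?r * L) \<le> 1 / 4" using small(2) by linarith
    qed (use I0 in auto)
    \<comment> \<open>Moving the term \<open>(1 / 4) * M m\<close> to the left leaves the
      coefficients 4/3 and 1/3, relaxed to the 2 and 1/2 of the claim.\<close>
    finally have "M m \<le> C * 2 ^ ?n * I m + (1 / 4) * M m + (1 / 4) * M (Suc m)"
      by (simp only: M_def \<delta>_def)
    moreover have "C * 2 ^ ?n * I m \<ge> 0" using C I0 by simp
    ultimately show ?thesis using M0[of "Suc m"] by simp
  qed
  have iter: "M 0 \<le> 2 * C * 2 ^ ?n * (\<Sum>m<k. (1/2) ^ m * I m) + (1/2) ^ k * M k"
  proof (induction k)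
    case (Suc k)
    have "(1/2) ^ k * M k \<le> (1/2) ^ k * (2 * C * 2 ^ ?n * I k + M (Suc k) / 2)"
      by (intro mult_left_mono step) simp
    with Suc.IH show ?case by (simp add: algebra_simps)
  qed simp
  \<comment> \<open>The last maximum is bounded only by the crude \<open>Bd\<close>; its factor
    \<open>(1/2) ^ k\<close> is kept so that \<open>k\<close> can be sent to infinity later.\<close>
  have "M k \<le> R ^ ?n * Bd"
    unfolding M_def using p(1)[of k] Bd[OF p(1)] R by (intro mult_mono power_mono) auto
  then have "(1/2) ^ k * M k \<le> (1/2) ^ k * (R ^ ?n * Bd)" by (intro mult_left_mono) auto
  moreover have "R ^ ?n * \<bar>F 0 x0\<bar> \<le> M 0" unfolding M_def using p(2)[of x0 0] R by simp
  ultimately have "R ^ ?n * \<bar>F 0 x0\<bar> \<le> 2 * C * 2 ^ ?n * (\<Sum>m<k. (1/2) ^ m * I m) + (1/2) ^ k * (R ^ ?n * Bd)"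
    using iter by linarith
  then have "\<bar>F 0 x0\<bar> \<le> (2 * C * 2 ^ ?n * (\<Sum>m<k. (1/2) ^ m * I m) + (1/2) ^ k * (R ^ ?n * Bd)) / R ^ ?n"
    using R by (simp only: pos_le_divide_eq zero_less_power mult.commute)
  also have "\<dots> = 2 * C * 2 ^ ?n * (\<Sum>m<k. (1/2) ^ m * I m) / R ^ ?n + (1/2) ^ k * Bd"
    using R by (simp add: add_divide_distrib)
  finally show ?thesis unfolding I_def .
qed

subsection \<open>Change of variables\<close>

text \<open>For an image of finite measure this is \<open>has_measure_differentiable_image\<close>
  translated to \<open>lborel\<close>. If the image has infinite measure, a finite integral would
  give it finite measure by the converse direction of the same theorem.\<close>

lemma nn_integral_abs_det_eq_emeasure_image_wellorder:
  fixes f :: "real^'n::{finite,wellorder} \<Rightarrow> real^'n::_"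
  assumes S: "S \<in> sets borel" and f: "\<And>x. x \<in> S \<Longrightarrow> (f has_derivative f' x) (at x)"
    and inj: "inj_on f S" and fS: "f ` S \<in> sets borel"
    and meas: "(\<lambda>x. \<bar>det (matrix (f' x))\<bar> * indicator S x) \<in> borel_measurable borel"
  shows "emeasure lborel (f ` S) = (\<integral>\<^sup>+x\<in>S. ennreal \<bar>det (matrix (f' x))\<bar> \<partial>lborel)"
proof -
  let ?d = "\<lambda>x. \<bar>det (matrix (f' x))\<bar>"
  have Sl: "S \<in> sets lebesgue" using S by (simp add: lborelD)
  have f': "(f has_derivative f' x) (at x within S)" if "x \<in> S" for x
    using f[OF that] by (rule has_derivative_at_withinI)
  have int_eq: "(\<integral>\<^sup>+x\<in>S. ennreal (?d x) \<partial>lborel) = (\<integral>\<^sup>+x. ennreal (?d x * indicator S x) \<partial>lborel)"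
    by (intro nn_integral_cong) (auto simp: indicator_def)
  have em: "emeasure lebesgue (f ` S) = emeasure lborel (f ` S)" using fS by simp
  note main = has_measure_differentiable_image[OF Sl f' inj]
  show ?thesis
  proof (cases "emeasure lborel (f ` S) = \<infinity>")
    case False
    then have "f ` S \<in> lmeasurable"
      using fS em by (auto simp: fmeasurable_def less_top lborelD)
    with main have "(?d has_integral measure lebesgue (f ` S)) S" by blast
    from nn_integral_has_integral_lebesgue'[OF _ this]
    have "(\<integral>\<^sup>+x\<in>S. ennreal (?d x) \<partial>lborel) = ennreal (measure lebesgue (f ` S))" by simp
    also have "\<dots> = emeasure lborel (f ` S)"
      using False em by (simp add: measure_def less_top)
    finally show ?thesis by simp
  next
    case True
    have "(\<integral>\<^sup>+x\<in>S. ennreal (?d x) \<partial>lborel) = \<infinity>"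
    proof (rule ccontr)
      assume "(\<integral>\<^sup>+x\<in>S. ennreal (?d x) \<partial>lborel) \<noteq> \<infinity>"
      then obtain r where r: "(\<integral>\<^sup>+x. ennreal (?d x * indicator S x) \<partial>lborel) = ennreal r" "0 \<le> r"
        using int_eq by (cases "(\<integral>\<^sup>+x. ennreal (?d x * indicator S x) \<partial>lborel)" rule: ennreal_cases) auto
      have "((\<lambda>x. ?d x * indicator S x) has_integral r) UNIV"
        by (rule nn_integral_has_integral[OF meas _ r]) auto
      moreover have "(\<lambda>x. ?d x * indicator S x) = (\<lambda>x. if x \<in> S then ?d x else 0)"
        by (auto simp: indicator_def)
      ultimately have "(?d has_integral r) S" by (simp add: has_integral_restrict_UNIV)
      with main have "f ` S \<in> lmeasurable" by blast
      then show False using True em by (auto simp: fmeasurable_def)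
    qed
    with True show ?thesis by simp
  qed
qed

text \<open>The change of variables theorems of the library are stated for well-ordered index types; the
  index type is therefore replaced by a copy that is well-ordered through an enumeration.\<close>

typedef 'n ordered_copy = "UNIV :: 'n set" by simp

instance ordered_copy :: (finite) finite
proof
  have "finite (Abs_ordered_copy ` (UNIV :: 'a set))" by simp
  moreover have "Abs_ordered_copy ` (UNIV :: 'a set) = UNIV"
    by (metis Rep_ordered_copy_inverse surj_def)
  ultimately show "finite (UNIV :: 'a ordered_copy set)" by simp
qed

instantiation ordered_copy :: (finite) wellorder
begin

definition copy_index :: "'a ordered_copy \<Rightarrow> nat"
  where "copy_index = (SOME f. inj f)"

definition less_eq_ordered_copy :: "'a ordered_copy \<Rightarrow> 'a ordered_copy \<Rightarrow> bool"
  where "a \<le> b \<longleftrightarrow> copy_index a \<le> copy_index b"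

definition less_ordered_copy :: "'a ordered_copy \<Rightarrow> 'a ordered_copy \<Rightarrow> bool"
  where "a < b \<longleftrightarrow> copy_index a < copy_index b"

instance
proof
  have "inj (copy_index :: 'a ordered_copy \<Rightarrow> nat)"
    unfolding copy_index_def using finite_imp_inj_to_nat_seg[OF finite_class.finite_UNIV]
    by (metis someI_ex)
  then have inj: "copy_index a = copy_index b \<Longrightarrow> a = b" for a b :: "'a ordered_copy" by (rule injD)
  fix a b c :: "'a ordered_copy"
  show "(a < b) = (a \<le> b \<and> \<not> b \<le> a)" by (auto simp: less_eq_ordered_copy_def less_ordered_copy_def)
  show "a \<le> a" by (simp add: less_eq_ordered_copy_def)
  show "a \<le> b \<Longrightarrow> b \<le> c \<Longrightarrow> a \<le> c" by (simp add: less_eq_ordered_copy_def)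
  show "a \<le> b \<Longrightarrow> b \<le> a \<Longrightarrow> a = b" using inj by (simp add: less_eq_ordered_copy_def)
  show "a \<le> b \<or> b \<le> a" by (auto simp: less_eq_ordered_copy_def)
  fix P
  assume "\<And>x :: 'a ordered_copy. (\<And>y. y < x \<Longrightarrow> P y) \<Longrightarrow> P x"
  then show "P a"
    unfolding less_ordered_copy_def by (rule measure_induct_rule)
qed

end

section \<open>Signs, determinants and Lebesgue measure under relabelling of coordinates\<close>

lemma swapidseq_conjugate:
  assumes "swapidseq n p" "bij r"
  shows "swapidseq n (r \<circ> p \<circ> inv r)"
  using assms(1)
proof induction
  case id
  have eq: "r \<circ> id \<circ> inv r = id"
    by (rule ext) (simp only: o_apply id_apply surj_f_inv_f[OF bij_is_surj[OF assms(2)]])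
  show ?case unfolding eq by (rule swapidseq.id)
next
  case (comp_Suc n p a b)
  have inv: "inv r (r x) = x" "r (inv r y) = y" for x y
    using assms(2) by (auto simp: bij_is_inj bij_is_surj surj_f_inv_f)
  have inj: "r x = r y \<longleftrightarrow> x = y" for x y using assms(2) by (metis inv(1))
  have "r \<circ> (Transposition.transpose a b \<circ> p) \<circ> inv r = Transposition.transpose (r a) (r b) \<circ> (r \<circ> p \<circ> inv r)"
    by (auto simp: fun_eq_iff Transposition.transpose_def inj)
  moreover have "swapidseq (Suc n) (Transposition.transpose (r a) (r b) \<circ> (r \<circ> p \<circ> inv r))"
    by (rule swapidseq.comp_Suc[OF comp_Suc.IH]) (use comp_Suc.hyps(2) inj in simp)
  ultimately show ?case by (simp only:)
qed

lemma sign_conjugate: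
  fixes r :: "'a \<Rightarrow> 'b"
  assumes "bij r" "permutation p"
  shows "sign (r \<circ> p \<circ> inv r) = sign p"
proof -
  obtain n where n: "swapidseq n p" using assms(2) by (auto simp: permutation_def)
  show ?thesis
    using evenperm_unique[OF n refl] evenperm_unique[OF swapidseq_conjugate[OF n assms(1)] refl]
    by (simp add: sign_def)
qed

text \<open>Conjugation by \<open>r\<close> is a sign-preserving bijection between the permutations
  of the two index types, and it matches the products in the Leibniz formula term by term.\<close>

lemma det_reindex:
  fixes A :: "'a::comm_ring_1^'n::finite^'n" and r :: "'m::finite \<Rightarrow> 'n"
  assumes r: "bij r"
  shows "det (\<chi> i j. A $ r i $ r j) = det A"
proof -
  have inv: "inv r (r x) = x" "r (inv r y) = y" for x y
    using r by (auto simp: bij_is_inj bij_is_surj surj_f_inv_f)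
  have conj_perm: "s \<circ> p \<circ> inv s permutes UNIV" if "p permutes UNIV" "bij s" for p :: "'c \<Rightarrow> 'c" and s :: "'c \<Rightarrow> 'd"
    using that unfolding permutes_univ bij_iff[symmetric]
    by (intro bij_comp bij_imp_bij_inv)
  have summand: "of_int (sign p) * (\<Prod>i\<in>UNIV. A $ r i $ r (p i))
     = of_int (sign (r \<circ> p \<circ> inv r)) * (\<Prod>i\<in>UNIV. A $ i $ (r \<circ> p \<circ> inv r) i)"
    if "p permutes UNIV" for p
  proof -
    have "(\<Prod>i\<in>UNIV. A $ i $ (r \<circ> p \<circ> inv r) i) = (\<Prod>i\<in>UNIV. A $ r i $ (r \<circ> p \<circ> inv r) (r i))"
      using prod.reindex_bij_betw[OF r, of "\<lambda>i. A $ i $ (r \<circ> p \<circ> inv r) i"] by simp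
    then show ?thesis
      using sign_conjugate[OF r, of p] permutes_imp_permutation[OF _ that] by (simp add: inv)
  qed
  show ?thesis
    unfolding det_def
  proof (rule sum.reindex_bij_witness[where i = "\<lambda>q. inv r \<circ> q \<circ> r" and j = "\<lambda>p. r \<circ> p \<circ> inv r"])
    fix p :: "'m \<Rightarrow> 'm" assume "p \<in> {p. p permutes UNIV}"
    then show "inv r \<circ> (r \<circ> p \<circ> inv r) \<circ> r = p" "r \<circ> p \<circ> inv r \<in> {p. p permutes UNIV}"
      using conj_perm[OF _ r] by (auto simp: fun_eq_iff inv)
    show "of_int (sign (r \<circ> p \<circ> inv r)) * (\<Prod>i\<in>UNIV. A $ i $ (r \<circ> p \<circ> inv r) i)
        = of_int (sign p) * (\<Prod>i\<in>UNIV. (\<chi> i j. A $ r i $ r j) $ i $ p i)"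
      using summand \<open>p \<in> _\<close> by simp
  next
    fix q :: "'n \<Rightarrow> 'n" assume "q \<in> {p. p permutes UNIV}"
    then show "r \<circ> (inv r \<circ> q \<circ> r) \<circ> inv r = q" "inv r \<circ> q \<circ> r \<in> {p. p permutes UNIV}"
      using conj_perm[OF _ bij_imp_bij_inv[OF r]] inv_inv_eq[OF r] by (auto simp: fun_eq_iff inv)
  qed
qed

definition reindex :: "('m \<Rightarrow> 'n) \<Rightarrow> 'a^'n \<Rightarrow> 'a^'m"
  where "reindex r x = (\<chi> i. x $ r i)"

lemma linear_reindex: "linear (reindex r :: real^'n::finite \<Rightarrow> real^'m::finite)"
  by (rule linearI) (auto simp: reindex_def vec_eq_iff)

lemma continuous_on_reindex [continuous_intros]:
  "continuous_on S f \<Longrightarrow> continuous_on S (\<lambda>x. reindex r (f x) :: real^'m::finite)"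
  for f :: "'a::topological_space \<Rightarrow> real^'n::finite"
  using continuous_on_compose2[OF linear_continuous_on[OF linear_conv_bounded_linear[THEN iffD1, OF linear_reindex]]]
  by blast

lemma reindex_inv:
  assumes "bij r"
  shows "reindex (inv r) (reindex r x) = x" "reindex r (reindex (inv r) y) = y"
  using assms by (auto simp: reindex_def vec_eq_iff bij_is_inj bij_is_surj surj_f_inv_f)

lemma prod_Basis_cart:
  fixes x :: "real^'n::finite"
  shows "(\<Prod>b\<in>Basis. x \<bullet> b) = (\<Prod>i\<in>UNIV. x $ i)"
proof -
  have B: "Basis = range (\<lambda>i. axis i (1::real) :: real^'n)" by (auto simp: Basis_vec_def)
  have "inj (\<lambda>i. axis i (1::real) :: real^'n)" by (auto intro!: injI simp: axis_eq_axis)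
  then show ?thesis unfolding B by (subst prod.reindex) (auto simp: inner_axis)
qed

text \<open>Relabelling takes boxes to boxes with the same side lengths, and boxes determine
  Lebesgue measure.\<close>

lemma lborel_distr_reindex:
  fixes r :: "'m::finite \<Rightarrow> 'n::finite"
  assumes r: "bij r"
  shows "distr lborel borel (reindex r) = (lborel :: (real^'m) measure)"
proof (rule lborel_eqI[symmetric])
  have meas: "(reindex r :: real^'n \<Rightarrow> real^'m) \<in> borel_measurable borel"
    by (intro borel_measurable_continuous_onI continuous_intros)
  fix l u :: "real^'m" assume le: "\<And>b. b \<in> Basis \<Longrightarrow> l \<bullet> b \<le> u \<bullet> b"
  have le': "l $ i \<le> u $ i" for i using le[of "axis i 1"] by (simp add: inner_axis axis_in_Basis_iff)
  have inv: "r (inv r x) = x" "inv r (r y) = y" for x y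
    using r by (auto simp: bij_is_surj surj_f_inv_f bij_is_inj)
  have "reindex r -` box l u = box (reindex (inv r) l) (reindex (inv r) u)"
    unfolding reindex_def set_eq_iff mem_box_cart vimage_eq vec_lambda_beta using inv by metis
  then have "emeasure (distr lborel borel (reindex r)) (box l u)
      = emeasure lborel (box (reindex (inv r) l) (reindex (inv r) u))"
    using meas by (simp add: emeasure_distr)
  also have "\<dots> = ennreal (\<Prod>b\<in>Basis. (reindex (inv r) u - reindex (inv r) l) \<bullet> b)"
    using le' by (intro emeasure_lborel_box) (auto simp: Basis_vec_def inner_axis reindex_def)
  also have "\<dots> = ennreal (\<Prod>b\<in>Basis. (u - l) \<bullet> b)"
    unfolding prod_Basis_cart
    using prod.reindex_bij_betw[OF bij_imp_bij_inv[OF r], of "\<lambda>i. (u - l) $ i"]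
    by (simp add: reindex_def)
  finally show "emeasure (distr lborel borel (reindex r)) (box l u) = (\<Prod>b\<in>Basis. (u - l) \<bullet> b)" .
qed simp

text \<open>The map is conjugated by the relabelling of coordinates, which changes neither the
  measure of Borel sets nor the Jacobian determinant.\<close>

lemma nn_integral_abs_det_eq_emeasure_image:
  fixes f :: "real^'n::finite \<Rightarrow> real^'n"
  assumes S: "S \<in> sets borel" and f: "\<And>x. x \<in> S \<Longrightarrow> (f has_derivative f' x) (at x)"
    and inj: "inj_on f S" and fS: "f ` S \<in> sets borel"
    and meas: "(\<lambda>x. \<bar>det (matrix (f' x))\<bar> * indicator S x) \<in> borel_measurable borel"
  shows "emeasure lborel (f ` S) = (\<integral>\<^sup>+x\<in>S. ennreal \<bar>det (matrix (f' x))\<bar> \<partial>lborel)"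
proof -
  let ?r = "Rep_ordered_copy :: 'n ordered_copy \<Rightarrow> 'n"
  let ?T = "reindex ?r :: real^'n \<Rightarrow> real^'n ordered_copy"
  let ?U = "reindex (inv ?r) :: real^'n ordered_copy \<Rightarrow> real^'n"
  have r: "bij ?r"
    by (metis Abs_ordered_copy_inverse Rep_ordered_copy_inverse UNIV_I bijI')
  note r' = bij_imp_bij_inv[OF r]
  have TU: "?U (?T x) = x" "?T (?U y) = y" for x y using reindex_inv[OF r] by auto
  have [measurable]: "?T \<in> borel_measurable borel" "?U \<in> borel_measurable borel"
    by (intro borel_measurable_continuous_onI continuous_intros)+
  have image: "?T ` X = ?U -` X" for X
    unfolding set_eq_iff image_iff vimage_eq using TU by metis
  have img_borel: "?T ` X \<in> sets borel" if "X \<in> sets borel" for X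
    unfolding image using measurable_sets[of ?U borel borel X] that by simp
  have em: "emeasure lborel (?T ` X) = emeasure lborel X" if X: "X \<in> sets borel" for X
  proof -
    have "emeasure lborel X = emeasure (distr lborel borel ?U) X"
      using lborel_distr_reindex[OF r'] by simp
    also have "\<dots> = emeasure lborel (?T ` X)" using X by (simp add: emeasure_distr image)
    finally show ?thesis by simp
  qed
  let ?f = "\<lambda>y. ?T (f (?U y))" and ?f' = "\<lambda>y v. ?T (f' (?U y) (?U v))"
  have fT: "?f ` (?T ` S) = ?T ` (f ` S)" by (simp add: image_image TU)
  have bl: "bounded_linear ?T" "bounded_linear ?U"
    using linear_reindex linear_conv_bounded_linear by blast+
  have det: "det (matrix (?f' y)) = det (matrix (f' (?U y)))" for y
  proof -
    have "?U (axis j 1) = axis (?r j) 1" for j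
      using r by (auto simp: reindex_def vec_eq_iff axis_def bij_is_surj surj_f_inv_f bij_is_inj)
    then have "matrix (?f' y) = (\<chi> i j. matrix (f' (?U y)) $ ?r i $ ?r j)"
      by (simp add: matrix_def reindex_def)
    then show ?thesis using det_reindex[OF r] by simp
  qed
  have ind: "indicator (?T ` S) y = (indicator S (?U y) :: 'c::zero_neq_one)" for y
    by (simp add: image indicator_def)
  have "emeasure lborel (f ` S) = emeasure lborel (?f ` (?T ` S))" using em[OF fS] fT by simp
  also have "\<dots> = (\<integral>\<^sup>+y\<in>?T ` S. ennreal \<bar>det (matrix (?f' y))\<bar> \<partial>lborel)"
  proof (rule nn_integral_abs_det_eq_emeasure_image_wellorder[OF img_borel[OF S]])
    fix y assume "y \<in> ?T ` S"
    then have "?U y \<in> S" by (simp add: image)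
    have "((\<lambda>y. ?U y) has_derivative ?U) (at y)" by (rule bounded_linear_imp_has_derivative[OF bl(2)])
    from has_derivative_compose[OF this f[OF \<open>?U y \<in> S\<close>]]
    show "(?f has_derivative ?f' y) (at y)"
      by (rule bounded_linear.has_derivative[OF bl(1)])
  next
    show "inj_on ?f (?T ` S)"
      by (rule inj_onI) (metis TU inj inj_onD imageE)
    show "?f ` ?T ` S \<in> sets borel" using fT img_borel[OF fS] by simp
    show "(\<lambda>y. \<bar>det (matrix (?f' y))\<bar> * indicator (?T ` S) y) \<in> borel_measurable borel"
      unfolding det ind using measurable_compose[OF \<open>?U \<in> _\<close> meas] by simp
  qed
  also have "\<dots> = (\<integral>\<^sup>+y. ennreal (\<bar>det (matrix (f' (?U y)))\<bar> * indicator S (?U y)) \<partial>lborel)"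
    unfolding det ind by (intro nn_integral_cong) (auto simp: indicator_def)
  also have "\<dots> = (\<integral>\<^sup>+x. ennreal (\<bar>det (matrix (f' x))\<bar> * indicator S x) \<partial>distr lborel borel ?U)"
    using meas by (subst nn_integral_distr) auto
  also have "\<dots> = (\<integral>\<^sup>+x\<in>S. ennreal \<bar>det (matrix (f' x))\<bar> \<partial>lborel)"
    unfolding lborel_distr_reindex[OF r'] by (intro nn_integral_cong) (auto simp: indicator_def)
  finally show ?thesis .
qed

text \<open>The Jacobian density on \<open>B\<close>, pushed forward by \<open>f\<close>, is
  Lebesgue measure restricted to the image of \<open>B\<close>: on each Borel set this is the
  preceding lemma. Integrating \<open>g\<close> against both measures gives the formula.\<close>

lemma nn_integral_change_of_variables:
  fixes f :: "real^'n::finite \<Rightarrow> real^'n"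
  assumes V: "open V" and W: "open W" and hom: "homeomorphism V W f k"
    and f: "\<And>x. x \<in> V \<Longrightarrow> (f has_derivative f' x) (at x)"
    and cont: "continuous_on V (\<lambda>x. det (matrix (f' x)))"
    and B: "B \<in> sets borel" "B \<subseteq> V" and g: "g \<in> borel_measurable borel"
  shows "(\<integral>\<^sup>+y\<in>f ` B. g y \<partial>lborel) = (\<integral>\<^sup>+x\<in>B. ennreal \<bar>det (matrix (f' x))\<bar> * g (f x) \<partial>lborel)"
proof -
  let ?d = "\<lambda>x. \<bar>det (matrix (f' x))\<bar>"
  have contf: "continuous_on V f" and contk: "continuous_on W k"
    and kf: "\<And>x. x \<in> V \<Longrightarrow> k (f x) = x" and fk: "\<And>y. y \<in> W \<Longrightarrow> f (k y) = y"
    and fV: "f ` V = W" and kW: "k ` W = V"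
    using hom by (auto simp: homeomorphism_def)
  have [measurable]: "V \<in> sets borel" "W \<in> sets borel" "B \<in> sets borel" using V W B by auto
  have image_eq: "f ` X = W \<inter> k -` X" if "X \<subseteq> V" for X
    using that fV kf fk kW unfolding set_eq_iff image_iff Int_iff vimage_eq by (metis imageI subsetD)
  have k_meas: "(\<lambda>y. if y \<in> W then k y else 0) \<in> borel_measurable borel"
    using contk W by (intro borel_measurable_continuous_on_if) auto
  have img: "f ` X \<in> sets borel" if "X \<in> sets borel" "X \<subseteq> V" for X
  proof -
    have "f ` X = W \<inter> (\<lambda>y. if y \<in> W then k y else 0) -` X" using image_eq[OF that(2)] by auto
    also have "\<dots> \<in> sets borel" using measurable_sets[OF k_meas that(1)] by auto
    finally show ?thesis .
  qed
  have d_meas: "(\<lambda>x. if x \<in> X then ?d x else 0) \<in> borel_measurable borel" if "X \<in> sets borel" "X \<subseteq> V" for X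
    using that by (intro borel_measurable_continuous_on_if continuous_on_rabs continuous_on_subset[OF cont]) auto
  have f_meas[measurable]: "(\<lambda>x. if x \<in> B then f x else 0) \<in> borel_measurable borel"
    using B continuous_on_subset[OF contf] by (intro borel_measurable_continuous_on_if) auto
  have dB[measurable]: "(\<lambda>x. if x \<in> B then ?d x else 0) \<in> borel_measurable borel" by (rule d_meas[OF B])
  let ?D = "density lborel (\<lambda>x. ennreal (if x \<in> B then ?d x else 0))"
  \<comment> \<open>The value 0 off \<open>B\<close> makes the map Borel on the whole space; the
    density vanishes there.\<close>
  let ?F = "\<lambda>x. if x \<in> B then f x else 0"
  have eq: "distr ?D borel ?F = density lborel (indicator (f ` B))"
  proof (rule measure_eqI)
    fix Y assume "Y \<in> sets (distr ?D borel ?F)"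
    then have Y[measurable]: "Y \<in> sets borel" by simp
    let ?X = "B \<inter> ?F -` Y"
    have X: "?X \<in> sets borel" "?X \<subseteq> V" using measurable_sets[OF f_meas Y] B by auto
    have "emeasure (distr ?D borel ?F) Y = emeasure ?D (?F -` Y)"
      by (simp add: emeasure_distr)
    also have "\<dots> = (\<integral>\<^sup>+x. ennreal (if x \<in> B then ?d x else 0) * indicator (?F -` Y) x \<partial>lborel)"
      using measurable_sets[OF f_meas Y] by (simp add: emeasure_density)
    also have "\<dots> = (\<integral>\<^sup>+x\<in>?X. ennreal (?d x) \<partial>lborel)"
      by (intro nn_integral_cong) (auto simp: indicator_def)
    also have "\<dots> = emeasure lborel (f ` ?X)"
    proof (rule nn_integral_abs_det_eq_emeasure_image[symmetric, OF X(1)])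
      show "inj_on f ?X" using X(2) kf by (intro inj_on_inverseI[of _ k]) blast
      show "f ` ?X \<in> sets borel" by (rule img[OF X])
      have "(\<lambda>x. if x \<in> ?X then ?d x else 0) = (\<lambda>x. ?d x * indicator ?X x)" by (auto simp: indicator_def)
      then show "(\<lambda>x. ?d x * indicator ?X x) \<in> borel_measurable borel"
        using d_meas[OF X] by simp
    qed (use X f in auto)
    also have "f ` ?X = f ` B \<inter> Y" by auto
    also have "emeasure lborel \<dots> = emeasure (density lborel (indicator (f ` B))) Y"
      using img[OF B] by (subst emeasure_density) (auto simp: indicator_inter_arith[symmetric])
    finally show "emeasure (distr ?D borel ?F) Y = emeasure (density lborel (indicator (f ` B))) Y" .
  qed simp
  have "(\<integral>\<^sup>+y\<in>f ` B. g y \<partial>lborel) = (\<integral>\<^sup>+y. g y \<partial>density lborel (indicator (f ` B)))"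
    using g img[OF B] by (subst nn_integral_density) (auto simp: mult.commute)
  also have "\<dots> = (\<integral>\<^sup>+x. g (?F x) \<partial>?D)"
    unfolding eq[symmetric] using g by (subst nn_integral_distr) auto
  also have "\<dots> = (\<integral>\<^sup>+x. ennreal (if x \<in> B then ?d x else 0) * g (?F x) \<partial>lborel)"
    using g by (subst nn_integral_density) auto
  also have "\<dots> = (\<integral>\<^sup>+x\<in>B. ennreal (?d x) * g (f x) \<partial>lborel)"
    by (intro nn_integral_cong) (auto simp: indicator_def)
  finally show ?thesis .
qed

section \<open>Determinants, inverse matrices and smooth functions in coordinates\<close>

lemma C1_on_det:
  fixes M :: "real^'n::finite \<Rightarrow> real^'k::finite^'k"
  shows "(\<And>i j. C1_on V (\<lambda>x. M x $ i $ j)) \<Longrightarrow> C1_on V (\<lambda>x. det (M x))"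
  unfolding det_def by (intro C1_on_sum C1_on_mult C1_on_prod C1_on_const)

lemma matrix_inv_mult:
  fixes M :: "real^'k::finite^'k"
  assumes "det M \<noteq> 0"
  shows "M ** matrix_inv M = mat 1" "matrix_inv M ** M = mat 1"
proof -
  have "\<exists>M'. M ** M' = mat 1 \<and> M' ** M = mat 1"
    using assms invertible_det_nz[of M] by (simp add: invertible_def)
  then have "M ** matrix_inv M = mat 1 \<and> matrix_inv M ** M = mat 1"
    unfolding matrix_inv_def by (rule someI_ex)
  then show "M ** matrix_inv M = mat 1" "matrix_inv M ** M = mat 1" by auto
qed

text \<open>Cramer's rule for the columns of the identity. Quotients of determinants are visibly
  differentiable in the entries, which gives the regularity of the inverse metric.\<close>

lemma matrix_inv_cramer:
  fixes M :: "real^'k::finite^'k"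
  assumes "det M \<noteq> 0"
  shows "matrix_inv M $ i $ j = det (\<chi> k l. if l = i then axis j 1 $ k else M $ k $ l) / det M"
proof -
  have "M *v (matrix_inv M *v axis j 1) = axis j 1"
    using matrix_inv_mult[OF assms] by (simp add: matrix_vector_mul_assoc)
  then have "matrix_inv M *v axis j 1 = (\<chi> i. det (\<chi> k l. if l = i then axis j 1 $ k else M $ k $ l) / det M)"
    using cramer[OF assms] by blast
  then have "(matrix_inv M *v axis j 1) $ i = det (\<chi> k l. if l = i then axis j 1 $ k else M $ k $ l) / det M"
    by simp
  then show ?thesis by (simp add: matrix_vector_mult_basis column_def)
qed

lemma C1_on_matrix_inv:
  fixes M :: "real^'n::finite \<Rightarrow> real^'k::finite^'k"
  assumes M: "\<And>i j. C1_on V (\<lambda>x. M x $ i $ j)" and V: "open V" and nz: "\<And>x. x \<in> V \<Longrightarrow> det (M x) \<noteq> 0"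
  shows "C1_on V (\<lambda>x. matrix_inv (M x) $ i $ j)"
proof (rule C1_on_cong_open[OF _ V])
  have entry: "C1_on V (\<lambda>x. (\<chi> k l. if l = i then axis j 1 $ k else M x $ k $ l) $ a $ b)" for a b
    by (cases "b = i") (auto simp: M)
  show "C1_on V (\<lambda>x. det (\<chi> k l. if l = i then axis j 1 $ k else M x $ k $ l) / det (M x))"
    by (intro C1_on_divide C1_on_det entry M nz)
qed (simp only: matrix_inv_cramer[OF nz])

text \<open>Every matrix on the segment from the identity to \<open>M\<close> is positive definite,
  hence invertible, so the determinant cannot reach 0 on its way from the value 1.\<close>

lemma det_pos_definite:
  fixes M :: "real^'k::finite^'k"
  assumes pos: "\<And>v. v \<noteq> 0 \<Longrightarrow> v \<bullet> (M *v v) > 0"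
  shows "det M > 0"
proof (rule ccontr)
  assume neg: "\<not> det M > 0"
  let ?N = "\<lambda>t::real. (1 - t) *\<^sub>R mat 1 + t *\<^sub>R M"
  have "continuous_on {0..1} (\<lambda>t. det (?N t))"
    unfolding det_def by (intro continuous_intros)
  then obtain t where t: "0 \<le> t" "t \<le> 1" "det (?N t) = 0"
    using IVT2'[of "\<lambda>t. det (?N t)" 1 0 0] neg by auto
  then obtain v where v: "v \<noteq> 0" "?N t *v v = 0"
    using invertible_det_nz[of "?N t"] matrix_left_invertible_ker[of "?N t"] 
      invertible_left_inverse[of "?N t"] by auto
  have "0 = v \<bullet> (?N t *v v)" by (simp add: v(2))
  also have "\<dots> = (1 - t) * (v \<bullet> v) + t * (v \<bullet> (M *v v))"
    by (simp add: matrix_vector_mult_add_rdistrib scaleR_matrix_vector_assoc[symmetric] inner_add_right)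
  also have "\<dots> > 0"
  proof (cases "t = 0")
    case False
    then show ?thesis using t v(1) pos[OF v(1)] by (intro add_nonneg_pos) auto
  qed (use v(1) in simp)
  finally show False by simp
qed

lemma smooth_on_C1: "smooth_on V h \<Longrightarrow> C1_on V h"
  for h :: "real^'n::finite \<Rightarrow> real"
proof -
  assume "smooth_on V h"
  then have "higher_differentiable_on V h (Suc 0)" unfolding smooth_on_def by blast
  then show ?thesis by (simp add: C1_on_def partial_deriv_def[abs_def])
qed

lemma smooth_on_partial_C1: "smooth_on V h \<Longrightarrow> C1_on V (partial_deriv i h)"
  for h :: "real^'n::finite \<Rightarrow> real"
proof -
  assume "smooth_on V h"
  then have "higher_differentiable_on V h (Suc (Suc 0))" unfolding smooth_on_def by blast
  then show ?thesis
    by (simp add: C1_on_def partial_deriv_def[abs_def])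
qed

lemma smooth_on_component_C1:
  fixes h :: "real^'n::finite \<Rightarrow> 'b::real_normed_vector"
  assumes "smooth_on V h" "bounded_linear l"
  shows "C1_on V (\<lambda>x. l (h x))"
proof (rule C1_onI)
  have h: "higher_differentiable_on V h (Suc 0)" using assms(1) unfolding smooth_on_def by blast
  fix x assume "x \<in> V"
  then have "(h has_derivative frechet_derivative h (at x)) (at x)"
    using h frechet_derivative_works by auto
  then show "((\<lambda>x. l (h x)) has_derivative (\<lambda>v. l (frechet_derivative h (at x) v))) (at x)"
    by (rule bounded_linear.has_derivative[OF assms(2)])
next
  have h: "higher_differentiable_on V h (Suc 0)" using assms(1) unfolding smooth_on_def by blast
  show "continuous_on V (\<lambda>x. l (frechet_derivative h (at x) (axis i 1)))" for i
    using h by (intro continuous_on_compose2[OF linear_continuous_on[OF assms(2), of UNIV]]) auto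
qed

subsection \<open>The Riemannian volume\<close>

definition volume_density :: "('m, 'n::finite) metric_components \<Rightarrow> ('m, 'n) chart \<Rightarrow> real^'n \<Rightarrow> real"
  where "volume_density g c y = sqrt (det (g c (inv_coord c y)))"

definition overlap :: "('m, 'n::finite) chart \<Rightarrow> ('m, 'n) chart \<Rightarrow> (real^'n) set"
  where "overlap c c' = coord c ` (dom_chart c \<inter> dom_chart c')"

definition transition :: "('m, 'n) chart \<Rightarrow> ('m, 'n) chart \<Rightarrow> real^'n \<Rightarrow> real^'n"
  where "transition c c' = coord c' \<circ> inv_coord c"

text \<open>The matrix of \<open>transition_jacobian\<close>, written as a function of the
  coordinate vector instead of the point, because changes of variables take place in
  coordinates.\<close>

definition chart_jacobian :: "('m, 'n::finite) chart \<Rightarrow> ('m, 'n) chart \<Rightarrow> real^'n \<Rightarrow> real^'n^'n"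
  where "chart_jacobian c c' y = matrix (frechet_derivative (transition c c') (at y))"

text \<open>The push-forward of \<open>sqrt (det g) dy\<close> under the inverse chart: a measure on
  the whole manifold, concentrated on the chart domain. The value \<open>undefined\<close> is taken
  only where the density is 0.\<close>

definition chart_volume ::
  "('m::topological_space, 'n::finite) metric_components \<Rightarrow> ('m, 'n) chart \<Rightarrow> 'm measure"
  where "chart_volume g c = distr (density lborel (\<lambda>y. ennreal (volume_density g c y) * indicator (coord_image c) y))
    borel (\<lambda>y. if y \<in> coord_image c then inv_coord c y else undefined)"

locale riemannian =
  fixes A :: "('m::{t2_space, second_countable_topology}, 'n::finite) chart set"
    and g :: "('m, 'n) metric_components"
  assumes riemannian: "riemannian_manifold A g"
begin

section \<open>Gram matrices and transition maps in coordinates\<close>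

lemma chart:
  assumes "c \<in> A"
  shows "open (dom_chart c)" "open (coord_image c)" "continuous_on (dom_chart c) (coord c)"
    "continuous_on (coord_image c) (inv_coord c)"
    "\<And>p. p \<in> dom_chart c \<Longrightarrow> inv_coord c (coord c p) = p"
    "\<And>y. y \<in> coord_image c \<Longrightarrow> coord c (inv_coord c y) = y"
    "\<And>y. y \<in> coord_image c \<Longrightarrow> inv_coord c y \<in> dom_chart c"
proof -
  have "is_chart c" using assms riemannian by (simp add: riemannian_manifold_def smooth_atlas_def)
  then show "open (dom_chart c)" "open (coord_image c)" "continuous_on (dom_chart c) (coord c)"
    "continuous_on (coord_image c) (inv_coord c)"
    "\<And>p. p \<in> dom_chart c \<Longrightarrow> inv_coord c (coord c p) = p"
    "\<And>y. y \<in> coord_image c \<Longrightarrow> coord c (inv_coord c y) = y"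
    "\<And>y. y \<in> coord_image c \<Longrightarrow> inv_coord c y \<in> dom_chart c"
    by (auto simp: is_chart_def homeomorphism_def)
qed

lemma charts_cover: "\<exists>c\<in>A. p \<in> dom_chart c"
  using riemannian unfolding riemannian_manifold_def smooth_atlas_def by blast

lemma chart_at: "chart_at A p \<in> A" "p \<in> dom_chart (chart_at A p)"
proof -
  have "\<exists>c. c \<in> A \<and> p \<in> dom_chart c" using charts_cover[of p] by blast
  from someI_ex[OF this] show "chart_at A p \<in> A" "p \<in> dom_chart (chart_at A p)"
    unfolding chart_at_def by blast+
qed

lemma gram:
  assumes "c \<in> A"
  shows "smooth_on (coord_image c) (\<lambda>y. g c (inv_coord c y))"
    "\<And>y. y \<in> coord_image c \<Longrightarrow> transpose (g c (inv_coord c y)) = g c (inv_coord c y)"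
    "\<And>y v. y \<in> coord_image c \<Longrightarrow> v \<noteq> 0 \<Longrightarrow> v \<bullet> (g c (inv_coord c y) *v v) > 0"
proof -
  have m: "riemannian_metric A g" using riemannian by (simp add: riemannian_manifold_def)
  show "smooth_on (coord_image c) (\<lambda>y. g c (inv_coord c y))"
    using m assms unfolding riemannian_metric_def comp_def by blast
  show "\<And>y. y \<in> coord_image c \<Longrightarrow> transpose (g c (inv_coord c y)) = g c (inv_coord c y)"
    "\<And>y v. y \<in> coord_image c \<Longrightarrow> v \<noteq> 0 \<Longrightarrow> v \<bullet> (g c (inv_coord c y) *v v) > 0"
    using m assms chart(7)[OF assms] unfolding riemannian_metric_def by blast+
qed

lemma gram_C1: "c \<in> A \<Longrightarrow> C1_on (coord_image c) (\<lambda>y. g c (inv_coord c y) $ i $ j)"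
  using smooth_on_component_C1[OF gram(1), of c "\<lambda>M. M $ i $ j"]
    bounded_linear_compose[OF bounded_linear_vec_nth bounded_linear_vec_nth] by blast

lemma gram_continuous: "c \<in> A \<Longrightarrow> continuous_on (coord_image c) (\<lambda>y. g c (inv_coord c y))"
proof -
  assume "c \<in> A"
  then have "higher_differentiable_on (coord_image c) (\<lambda>y. g c (inv_coord c y)) 0"
    using gram(1) unfolding smooth_on_def by blast
  then show ?thesis by simp
qed

lemma det_gram_pos: "c \<in> A \<Longrightarrow> y \<in> coord_image c \<Longrightarrow> det (g c (inv_coord c y)) > 0"
  using gram(3) by (intro det_pos_definite) auto

lemma volume_density_pos: "c \<in> A \<Longrightarrow> y \<in> coord_image c \<Longrightarrow> volume_density g c y > 0"
  unfolding volume_density_def using det_gram_pos by simp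

lemma volume_density_C1: "c \<in> A \<Longrightarrow> C1_on (coord_image c) (volume_density g c)"
  unfolding volume_density_def[abs_def] by (intro C1_on_sqrt C1_on_det gram_C1 det_gram_pos)

lemma inv_gram_C1: "c \<in> A \<Longrightarrow> C1_on (coord_image c) (\<lambda>y. matrix_inv (g c (inv_coord c y)) $ i $ j)"
  by (intro C1_on_matrix_inv gram_C1 chart less_imp_neq[THEN not_sym] det_gram_pos)

lemma volume_density_measurable:
  assumes "c \<in> A"
  shows "(\<lambda>y. ennreal (volume_density g c y) * indicator (coord_image c) y) \<in> borel_measurable borel"
proof -
  have "(\<lambda>y. if y \<in> coord_image c then volume_density g c y else 0) \<in> borel_measurable borel"
    using chart(2)[OF assms] C1_on_continuous[OF volume_density_C1[OF assms]]
    by (intro borel_measurable_continuous_on_if) auto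
  then have "(\<lambda>y. ennreal (if y \<in> coord_image c then volume_density g c y else 0)) \<in> borel_measurable borel"
    by simp
  moreover have "(\<lambda>y. ennreal (if y \<in> coord_image c then volume_density g c y else 0))
      = (\<lambda>y. ennreal (volume_density g c y) * indicator (coord_image c) y)"
    by (auto simp: indicator_def)
  ultimately show ?thesis by simp
qed

lemma inv_coord_measurable:
  assumes "c \<in> A"
  shows "(\<lambda>y. if y \<in> coord_image c then inv_coord c y else undefined) \<in> borel_measurable borel"
  using chart(2,4)[OF assms] by (intro borel_measurable_continuous_on_if) auto

text \<open>Images under a chart become preimages under the Borel extension of its inverse; in this
  form they are seen to be Borel.\<close>

lemma coord_image_eq:
  assumes "c \<in> A" "B \<subseteq> dom_chart c"
  shows "coord c ` B = coord_image c \<inter> (\<lambda>y. if y \<in> coord_image c then inv_coord c y else undefined) -` B"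
proof (intro set_eqI iffI)
  note c = chart[OF assms(1)]
  fix y assume "y \<in> coord c ` B"
  then obtain p where p: "p \<in> B" "y = coord c p" by blast
  then have "p \<in> dom_chart c" using assms(2) by blast
  then have "y \<in> coord_image c" "inv_coord c y = p" using p c(5) by auto
  then show "y \<in> coord_image c \<inter> (\<lambda>y. if y \<in> coord_image c then inv_coord c y else undefined) -` B"
    using p by simp
next
  note c = chart[OF assms(1)]
  fix y assume "y \<in> coord_image c \<inter> (\<lambda>y. if y \<in> coord_image c then inv_coord c y else undefined) -` B"
  then have y: "y \<in> coord_image c" and *: "(if y \<in> coord_image c then inv_coord c y else undefined) \<in> B"
    unfolding Int_iff vimage_eq by blast+
  from * have "inv_coord c y \<in> B" unfolding if_P[OF y] .
  then show "y \<in> coord c ` B" using c(6)[OF y] by (metis imageI)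
qed

lemma coord_image_borel:
  assumes "c \<in> A" "B \<subseteq> dom_chart c" "B \<in> sets borel"
  shows "coord c ` B \<in> sets borel"
  unfolding coord_image_eq[OF assms(1,2)]
  using measurable_sets[OF inv_coord_measurable[OF assms(1)] assms(3)] chart(2)[OF assms(1)] by auto

lemma overlap:
  assumes "c \<in> A" "c' \<in> A"
  shows "open (overlap c c')" "overlap c c' \<subseteq> coord_image c"
    "smooth_on (overlap c c') (transition c c')"
    "homeomorphism (overlap c c') (overlap c' c) (transition c c') (transition c' c)"
    "\<And>y. y \<in> overlap c c' \<Longrightarrow> transition c c' y \<in> coord_image c'"
    "\<And>y. y \<in> overlap c c' \<Longrightarrow> inv_coord c' (transition c c' y) = inv_coord c y"
    "\<And>y. y \<in> overlap c c' \<longleftrightarrow> y \<in> coord_image c \<and> inv_coord c y \<in> dom_chart c'"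
proof -
  note c = chart[OF assms(1)] and c' = chart[OF assms(2)]
  show mem: "y \<in> overlap c c' \<longleftrightarrow> y \<in> coord_image c \<and> inv_coord c y \<in> dom_chart c'" for y
    using c(5,6,7) unfolding overlap_def by (auto simp: image_iff)
  then show sub: "overlap c c' \<subseteq> coord_image c" by blast
  have "overlap c c' = coord_image c \<inter> inv_coord c -` dom_chart c'" using mem by auto
  then show "open (overlap c c')" using continuous_open_preimage[OF c(4,2) c'(1)] by simp
  show "smooth_on (overlap c c') (transition c c')"
    using riemannian assms unfolding riemannian_manifold_def smooth_atlas_def overlap_def transition_def by blast
  have mem': "y \<in> overlap c' c \<longleftrightarrow> y \<in> coord_image c' \<and> inv_coord c' y \<in> dom_chart c" for y
    using c'(5,6,7) unfolding overlap_def by (auto simp: image_iff)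
  show t1: "transition c c' y \<in> coord_image c'" and t2: "inv_coord c' (transition c c' y) = inv_coord c y"
    if "y \<in> overlap c c'" for y
    using that c' mem by (auto simp: transition_def)
  have t1': "transition c' c y \<in> coord_image c" and t2': "inv_coord c (transition c' c y) = inv_coord c' y"
    if "y \<in> overlap c' c" for y
    using that c mem' by (auto simp: transition_def)
  have maps: "transition c c' y \<in> overlap c' c" "transition c' c (transition c c' y) = y" if "y \<in> overlap c c'" for y
    using that t1 t2 mem mem' c(6,7) by (auto simp: transition_def)
  have maps': "transition c' c y \<in> overlap c c'" "transition c c' (transition c' c y) = y" if "y \<in> overlap c' c" for y
    using that t1' t2' mem mem' c'(6,7) by (auto simp: transition_def)
  have cont: "continuous_on (overlap c c') (transition c c')"
    unfolding transition_def comp_def using mem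
    by (intro continuous_on_compose2[OF c'(3)] continuous_on_subset[OF c(4)]) auto
  have cont': "continuous_on (overlap c' c) (transition c' c)"
    unfolding transition_def comp_def using mem'
    by (intro continuous_on_compose2[OF c(3)] continuous_on_subset[OF c'(4)]) auto
  show "homeomorphism (overlap c c') (overlap c' c) (transition c c') (transition c' c)"
    using maps maps' cont cont' by (intro homeomorphismI) auto
qed

lemma transition_derivative:
  assumes "c \<in> A" "c' \<in> A" "y \<in> overlap c c'"
  shows "(transition c c' has_derivative (\<lambda>v. chart_jacobian c c' y *v v)) (at y)"
    "g c (inv_coord c y) = transpose (chart_jacobian c c' y) ** g c' (inv_coord c y) ** chart_jacobian c c' y"
proof -
  have "higher_differentiable_on (overlap c c') (transition c c') (Suc 0)"
    using overlap(3)[OF assms(1,2)] unfolding smooth_on_def by blast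
  then have D: "(transition c c' has_derivative frechet_derivative (transition c c') (at y)) (at y)"
    using assms(3) frechet_derivative_works by auto
  then show "(transition c c' has_derivative (\<lambda>v. chart_jacobian c c' y *v v)) (at y)"
    unfolding chart_jacobian_def using matrix_vector_mul(2)[OF has_derivative_linear[OF D]] by simp
  have y: "coord c (inv_coord c y) = y" "inv_coord c y \<in> dom_chart c \<inter> dom_chart c'"
    using overlap(7)[OF assms(1,2)] assms(3) chart(6,7)[OF assms(1)] by auto
  have "transition_jacobian c c' (inv_coord c y) = chart_jacobian c c' y"
    unfolding transition_jacobian_def chart_jacobian_def y(1) transition_def ..
  moreover have "riemannian_metric A g" using riemannian by (simp add: riemannian_manifold_def)
  then have "g c (inv_coord c y) = transpose (transition_jacobian c c' (inv_coord c y))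
      ** g c' (inv_coord c y) ** transition_jacobian c c' (inv_coord c y)"
    using assms(1,2) y(2) unfolding riemannian_metric_def by blast
  ultimately show "g c (inv_coord c y) = transpose (chart_jacobian c c' y) ** g c' (inv_coord c y) ** chart_jacobian c c' y"
    by simp
qed

lemma jacobian_entry:
  assumes "c \<in> A" "c' \<in> A" "y \<in> overlap c c'"
  shows "chart_jacobian c c' y $ i $ j = partial_deriv j (\<lambda>y. transition c c' y $ i) y"
proof -
  have "((\<lambda>y. transition c c' y $ i) has_derivative (\<lambda>v. (chart_jacobian c c' y *v v) $ i)) (at y)"
    by (rule bounded_linear.has_derivative[OF bounded_linear_vec_nth transition_derivative(1)[OF assms]])
  from partial_deriv_eqI[OF this, of j] show ?thesis
    by (simp add: matrix_vector_mult_basis column_def)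
qed

lemma transition_C1: "c \<in> A \<Longrightarrow> c' \<in> A \<Longrightarrow> C1_on (overlap c c') (\<lambda>y. transition c c' y $ i)"
  by (intro smooth_on_component_C1 overlap bounded_linear_vec_nth)

lemma jacobian_continuous:
  assumes "c \<in> A" "c' \<in> A"
  shows "continuous_on (overlap c c') (\<lambda>y. chart_jacobian c c' y $ i $ j)"
  using C1_on_continuous_partial[OF transition_C1[OF assms, of i], of j]
  by (rule continuous_on_eq) (simp add: jacobian_entry[OF assms])

text \<open>Determinants in the tensor law produce the square of the Jacobian determinant, and the
  root its absolute value, as in the change of variables formula.\<close>

lemma volume_density_transition:
  assumes "c \<in> A" "c' \<in> A" "y \<in> overlap c c'"
  shows "volume_density g c y = \<bar>det (chart_jacobian c c' y)\<bar> * volume_density g c' (transition c c' y)"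
proof -
  have "det (g c (inv_coord c y)) = (det (chart_jacobian c c' y))\<^sup>2 * det (g c' (inv_coord c y))"
    using arg_cong[OF transition_derivative(2)[OF assms], of det]
    by (simp add: det_mul power2_eq_square mult_ac)
  then show ?thesis
    unfolding volume_density_def overlap(6)[OF assms] by (simp only: real_sqrt_mult real_sqrt_abs)
qed

section \<open>Gluing the chart volumes\<close>

lemma emeasure_chart_volume_vimage:
  assumes c: "c \<in> A" and B: "B \<in> sets borel"
  shows "emeasure (chart_volume g c) B = (\<integral>\<^sup>+y. ennreal (volume_density g c y) * indicator (coord_image c) y *
      indicator ((\<lambda>y. if y \<in> coord_image c then inv_coord c y else undefined) -` B) y \<partial>lborel)"
proof -
  let ?i = "\<lambda>y. if y \<in> coord_image c then inv_coord c y else undefined"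
  let ?d = "\<lambda>y. ennreal (volume_density g c y) * indicator (coord_image c) y"
  have "emeasure (chart_volume g c) B = emeasure (density lborel ?d) (?i -` B)"
    unfolding chart_volume_def using inv_coord_measurable[OF c] B
    by (subst emeasure_distr) simp_all
  also have "\<dots> = (\<integral>\<^sup>+y. ?d y * indicator (?i -` B) y \<partial>lborel)"
    using volume_density_measurable[OF c] measurable_sets[OF inv_coord_measurable[OF c] B]
    by (subst emeasure_density) simp_all
  finally show ?thesis .
qed

lemma emeasure_chart_volume:
  assumes c: "c \<in> A" and B: "B \<in> sets borel" "B \<subseteq> dom_chart c"
  shows "emeasure (chart_volume g c) B = (\<integral>\<^sup>+y\<in>coord c ` B. ennreal (volume_density g c y) \<partial>lborel)"
  unfolding emeasure_chart_volume_vimage[OF c B(1)] coord_image_eq[OF c B(2)]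
  by (intro nn_integral_cong) (auto simp: indicator_def)

lemma emeasure_chart_volume_inside:
  assumes c: "c \<in> A" and B: "B \<in> sets borel"
  shows "emeasure (chart_volume g c) B = emeasure (chart_volume g c) (B \<inter> dom_chart c)"
proof -
  have B': "B \<inter> dom_chart c \<in> sets borel" using B chart(1)[OF c] by auto
  show ?thesis
    unfolding emeasure_chart_volume_vimage[OF c B] emeasure_chart_volume_vimage[OF c B']
    using chart(7)[OF c] by (intro nn_integral_cong) (auto simp: indicator_def)
qed

text \<open>The factor by which the densities of two charts differ is exactly the Jacobian factor of
  the change of variables formula.\<close>

lemma chart_volume_eq:
  assumes c: "c \<in> A" "c' \<in> A" and B: "B \<in> sets borel" "B \<subseteq> dom_chart c" "B \<subseteq> dom_chart c'"
  shows "emeasure (chart_volume g c) B = emeasure (chart_volume g c') B"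
proof -
  have img: "coord c' ` B = transition c c' ` (coord c ` B)"
    unfolding image_image transition_def comp_def using B(2) chart(5)[OF c(1)] by (intro image_cong) auto
  have sub: "coord c ` B \<subseteq> overlap c c'" using B by (auto simp: overlap_def)
  have Bc: "coord c ` B \<in> sets borel" using coord_image_borel c B by auto
  have "(\<integral>\<^sup>+y\<in>coord c' ` B. ennreal (volume_density g c' y) \<partial>lborel)
      = (\<integral>\<^sup>+y\<in>coord c' ` B. (ennreal (volume_density g c' y) * indicator (coord_image c') y) \<partial>lborel)"
    using B by (intro nn_integral_cong) (auto simp: indicator_def)
  also have "\<dots> = (\<integral>\<^sup>+x\<in>coord c ` B. ennreal \<bar>det (matrix (\<lambda>v. chart_jacobian c c' x *v v))\<bar> *
      (ennreal (volume_density g c' (transition c c' x)) * indicator (coord_image c') (transition c c' x)) \<partial>lborel)"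
    unfolding img
  proof (rule nn_integral_change_of_variables[OF overlap(1)[OF c] overlap(1)[OF c(2,1)] overlap(4)[OF c]
        transition_derivative(1)[OF c] _ Bc sub volume_density_measurable[OF c(2)]])
    show "continuous_on (overlap c c') (\<lambda>x. det (matrix (\<lambda>v. chart_jacobian c c' x *v v)))"
      unfolding matrix_of_matrix_vector_mul det_def by (intro continuous_intros jacobian_continuous c)
  qed
  also have "\<dots> = (\<integral>\<^sup>+y\<in>coord c ` B. ennreal (volume_density g c y) \<partial>lborel)"
  proof (intro nn_integral_cong)
    fix x
    show "ennreal \<bar>det (matrix (\<lambda>v. chart_jacobian c c' x *v v))\<bar> *
      (ennreal (volume_density g c' (transition c c' x)) * indicator (coord_image c') (transition c c' x)) * indicator (coord c ` B) x
      = ennreal (volume_density g c x) * indicator (coord c ` B) x"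
    proof (cases "x \<in> coord c ` B")
      case True
      then have x: "x \<in> overlap c c'" using sub by auto
      show ?thesis
        using overlap(5)[OF c x] volume_density_pos[OF c(2) overlap(5)[OF c x]] True
        by (simp add: volume_density_transition[OF c x] ennreal_mult matrix_of_matrix_vector_mul)
    qed simp
  qed
  finally show ?thesis using emeasure_chart_volume c B by simp
qed

lemma is_riemannian_volume_iff:
  "is_riemannian_volume A g \<nu> \<longleftrightarrow> sets \<nu> = sets borel \<and>
    (\<forall>c\<in>A. \<forall>B\<in>sets borel. B \<subseteq> dom_chart c \<longrightarrow> emeasure \<nu> B = emeasure (chart_volume g c) B)"
  unfolding is_riemannian_volume_def using emeasure_chart_volume
  unfolding volume_density_def by auto

text \<open>The atlas may be uncountable; the Lindelof property of a second countable space leaves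
  countably many chart domains, and \<open>disjointed\<close> turns them into a Borel
  partition.\<close>

lemma countable_chart_partition:
  "\<exists>(c :: nat \<Rightarrow> ('m, 'n) chart) (D :: nat \<Rightarrow> 'm set). (\<forall>n. c n \<in> A) \<and> (\<forall>n. D n \<in> sets borel) \<and>
    (\<forall>n. D n \<subseteq> dom_chart (c n)) \<and> disjoint_family D \<and> (\<Union>n. D n) = UNIV"
proof -
  have op: "\<And>S. S \<in> dom_chart ` A \<Longrightarrow> open S" using chart(1) by auto
  obtain F where F: "F \<subseteq> dom_chart ` A" "countable F" "\<Union>F = \<Union>(dom_chart ` A)"
    using Lindelof[OF op] by blast
  have U: "\<Union>(dom_chart ` A) = UNIV" using charts_cover by blast
  have ne: "F \<noteq> {}" using F U by auto
  define s where "s = from_nat_into F"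
  have s: "range s = F" unfolding s_def using range_from_nat_into[OF ne F(2)] .
  have "\<exists>c\<in>A. s n = dom_chart c" for n using s F(1) by blast
  then obtain c where c: "\<And>n. c n \<in> A" "\<And>n. s n = dom_chart (c n)" by metis
  show ?thesis
  proof (intro exI conjI allI)
    show "c n \<in> A" for n by (rule c)
    have "s n \<in> sets borel" for n unfolding c(2) by (intro borel_open chart(1) c(1))
    then have "range (disjointed s) \<subseteq> sets borel" by (intro sets.range_disjointed_sets) auto
    then show "disjointed s n \<in> sets borel" for n by auto
    show "disjointed s n \<subseteq> dom_chart (c n)" for n using disjointed_subset[of s n] c by simp
    show "disjoint_family (disjointed s)" by (rule disjoint_family_disjointed)
    show "(\<Union>n. disjointed s n) = UNIV" using UN_disjointed_eq[of s] s F U by simp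
  qed
qed

text \<open>\<open>riemannian_volume\<close> is a definite description, so nothing can be said about
  it before this. Existence glues the chart volumes along a countable partition, using that they
  agree on overlaps; uniqueness holds because the mass on each piece of the partition is
  prescribed.\<close>

lemma ex1_riemannian_volume: "\<exists>!\<nu>. is_riemannian_volume A g \<nu>"
proof -
  obtain c :: "nat \<Rightarrow> ('m, 'n) chart" and D :: "nat \<Rightarrow> 'm set" where cD: "(\<forall>n. c n \<in> A) \<and> (\<forall>n. D n \<in> sets borel) \<and>
    (\<forall>n. D n \<subseteq> dom_chart (c n)) \<and> disjoint_family D \<and> (\<Union>n. D n) = UNIV"
    using countable_chart_partition by (elim exE) (rule that)
  from cD have c: "\<And>n. c n \<in> A" and D: "\<And>n. D n \<in> sets borel" "\<And>n. D n \<subseteq> dom_chart (c n)"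
    "disjoint_family D" "(\<Union>n. D n) = UNIV" by simp_all
  have cv_sets: "sets (chart_volume g c) = sets borel" for c by (simp add: chart_volume_def)
  \<comment> \<open>The sum over the pieces is written as an integral over counting measure, so that
    countable additivity becomes an exchange of sum and integral.\<close>
  define F where "F = (\<lambda>B. \<integral>\<^sup>+n. emeasure (chart_volume g (c n)) (B \<inter> D n) \<partial>count_space UNIV)"
  define \<nu> where "\<nu> = measure_of UNIV (sets borel) F"
  have sb: "sigma_sets UNIV (sets (borel :: 'm measure)) = sets borel"
    using sets.sigma_sets_eq[of "borel :: 'm measure"] by simp
  have sets: "sets \<nu> = sets borel" unfolding \<nu>_def using sb by (subst sets_measure_of) auto
  have em: "emeasure \<nu> B = F B" if "B \<in> sets borel" for B
  proof (rule emeasure_measure_of[OF \<nu>_def])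
    show "sets borel \<subseteq> Pow (UNIV :: 'm set)" by simp
    show "positive (sets \<nu>) F" by (simp add: positive_def F_def)
    show "countably_additive (sets \<nu>) F"
    proof (rule countably_additiveI)
      fix B :: "nat \<Rightarrow> 'm set"
      assume B: "range B \<subseteq> sets \<nu>" "disjoint_family B"
      have "(\<Sum>i. F (B i)) = (\<integral>\<^sup>+n. (\<Sum>i. emeasure (chart_volume g (c n)) (B i \<inter> D n)) \<partial>count_space UNIV)"
        unfolding F_def by (subst nn_integral_suminf) auto
      also have "\<dots> = (\<integral>\<^sup>+n. emeasure (chart_volume g (c n)) (\<Union>(range B) \<inter> D n) \<partial>count_space UNIV)"
      proof (intro nn_integral_cong)
        fix n
        have "(\<Sum>i. emeasure (chart_volume g (c n)) (B i \<inter> D n)) = emeasure (chart_volume g (c n)) (\<Union>i. B i \<inter> D n)"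
          using B D(1) sets cv_sets
          by (intro suminf_emeasure) (auto simp: disjoint_family_on_def)
        then show "(\<Sum>i. emeasure (chart_volume g (c n)) (B i \<inter> D n))
            = emeasure (chart_volume g (c n)) (\<Union>(range B) \<inter> D n)" by simp
      qed
      finally show "(\<Sum>i. F (B i)) = F (\<Union> (range B))" by (simp add: F_def)
    qed
    show "B \<in> sets \<nu>" using that sets by simp
  qed
  have split: "emeasure M B = (\<Sum>n. emeasure M (B \<inter> D n))" if "sets M = sets borel" "B \<in> sets borel" for M B
  proof -
    have "(\<Sum>n. emeasure M (B \<inter> D n)) = emeasure M (\<Union>n. B \<inter> D n)"
      using that D(1,3) by (intro suminf_emeasure) (auto simp: disjoint_family_on_def disjoint_iff)
    moreover have "(\<Union>n. B \<inter> D n) = B" using D(4) by auto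
    ultimately show ?thesis by simp
  qed
  show ?thesis
  proof (rule ex1I[of _ \<nu>])
    show "is_riemannian_volume A g \<nu>"
      unfolding is_riemannian_volume_iff
    proof (intro conjI ballI impI sets)
      fix c' B assume c': "c' \<in> A" and B: "B \<in> sets borel" "B \<subseteq> dom_chart c'"
      have "emeasure \<nu> B = (\<Sum>n. emeasure (chart_volume g (c n)) (B \<inter> D n))"
        using em[OF B(1)] by (simp add: F_def nn_integral_count_space_nat)
      also have "\<dots> = (\<Sum>n. emeasure (chart_volume g c') (B \<inter> D n))"
      proof (intro suminf_cong chart_volume_eq c c')
        fix n show "B \<inter> D n \<in> sets borel" "B \<inter> D n \<subseteq> dom_chart (c n)" "B \<inter> D n \<subseteq> dom_chart c'"
          using B D by auto
      qed
      also have "\<dots> = emeasure (chart_volume g c') B" using split[OF cv_sets B(1)] by simp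
      finally show "emeasure \<nu> B = emeasure (chart_volume g c') B" .
    qed
    fix \<nu>' assume "is_riemannian_volume A g \<nu>'"
    then have \<nu>': "sets \<nu>' = sets borel"
      "\<And>c B. c \<in> A \<Longrightarrow> B \<in> sets borel \<Longrightarrow> B \<subseteq> dom_chart c \<Longrightarrow> emeasure \<nu>' B = emeasure (chart_volume g c) B"
      by (auto simp: is_riemannian_volume_iff)
    show "\<nu>' = \<nu>"
    proof (rule measure_eqI)
      fix B assume "B \<in> sets \<nu>'"
      then have B: "B \<in> sets borel" using \<nu>' by simp
      have "emeasure \<nu>' B = (\<Sum>n. emeasure (chart_volume g (c n)) (B \<inter> D n))"
        unfolding split[OF \<nu>'(1) B]
      proof (intro suminf_cong \<nu>'(2) c)
        fix n show "B \<inter> D n \<in> sets borel" "B \<inter> D n \<subseteq> dom_chart (c n)" using B D by auto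
      qed
      also have "\<dots> = emeasure \<nu> B" using em[OF B] by (simp add: F_def nn_integral_count_space_nat)
      finally show "emeasure \<nu>' B = emeasure \<nu> B" .
    qed (use \<nu>' sets in simp)
  qed
qed

abbreviation vol :: "'m measure" where "vol \<equiv> riemannian_volume A g"

lemma riemannian_volume: "is_riemannian_volume A g vol"
  unfolding riemannian_volume_def by (rule theI'[OF ex1_riemannian_volume])

lemma sets_vol [simp, measurable_cong]: "sets vol = sets borel"
  using riemannian_volume by (simp add: is_riemannian_volume_def)

lemma density_vol_chart:
  assumes c: "c \<in> A"
  shows "density vol (indicator (dom_chart c)) = chart_volume g c"
proof (rule measure_eqI)
  fix B assume "B \<in> sets (density vol (indicator (dom_chart c)))"
  then have B: "B \<in> sets borel" by simp
  have "emeasure (density vol (indicator (dom_chart c))) B = emeasure vol (B \<inter> dom_chart c)"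
    using B chart(1)[OF c] by (subst emeasure_density)
      (auto simp: indicator_inter_arith[symmetric] Int_commute intro!: borel_measurable_indicator)
  also have "\<dots> = emeasure (chart_volume g c) (B \<inter> dom_chart c)"
    using riemannian_volume B chart(1)[OF c] c unfolding is_riemannian_volume_iff by auto
  finally show "emeasure (density vol (indicator (dom_chart c))) B = emeasure (chart_volume g c) B"
    using emeasure_chart_volume_inside[OF c B] by simp
qed (simp add: chart_volume_def)

lemma nn_integral_vol_chart:
  assumes c: "c \<in> A" and f: "f \<in> borel_measurable borel"
  shows "(\<integral>\<^sup>+p\<in>dom_chart c. f p \<partial>vol) = (\<integral>\<^sup>+y\<in>coord_image c. ennreal (volume_density g c y) * f (inv_coord c y) \<partial>lborel)"
proof -
  let ?i = "\<lambda>y. if y \<in> coord_image c then inv_coord c y else undefined"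
  have fi: "(\<lambda>y. f (?i y)) \<in> borel_measurable borel"
    by (rule measurable_compose[OF inv_coord_measurable[OF c] f])
  have "(\<integral>\<^sup>+p\<in>dom_chart c. f p \<partial>vol) = (\<integral>\<^sup>+p. f p \<partial>density vol (indicator (dom_chart c)))"
    using f chart(1)[OF c]
    by (subst nn_integral_density) (auto simp: mult.commute intro!: borel_measurable_indicator)
  also have "\<dots> = (\<integral>\<^sup>+y. f (?i y) \<partial>density lborel (\<lambda>y. ennreal (volume_density g c y) * indicator (coord_image c) y))"
    unfolding density_vol_chart[OF c] chart_volume_def
    using f inv_coord_measurable[OF c] by (subst nn_integral_distr) auto
  also have "\<dots> = (\<integral>\<^sup>+y. ennreal (volume_density g c y) * indicator (coord_image c) y * f (?i y) \<partial>lborel)"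
    using fi volume_density_measurable[OF c] by (subst nn_integral_density) auto
  also have "\<dots> = (\<integral>\<^sup>+y\<in>coord_image c. ennreal (volume_density g c y) * f (inv_coord c y) \<partial>lborel)"
    by (intro nn_integral_cong) (auto simp: indicator_def)
  finally show ?thesis .
qed

lemma integral_vol_chart:
  fixes f :: "'m \<Rightarrow> real"
  assumes c: "c \<in> A" and f: "f \<in> borel_measurable borel" and supp: "\<And>p. p \<notin> dom_chart c \<Longrightarrow> f p = 0"
  shows "(\<integral>p. f p \<partial>vol) = (\<integral>y. indicator (coord_image c) y * (volume_density g c y * f (inv_coord c y)) \<partial>lborel)"
proof -
  let ?i = "\<lambda>y. if y \<in> coord_image c then inv_coord c y else undefined"
  let ?w = "\<lambda>y. volume_density g c y * indicator (coord_image c) y"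
  have fi: "(\<lambda>y. f (?i y)) \<in> borel_measurable borel"
    by (rule measurable_compose[OF inv_coord_measurable[OF c] f])
  have "(\<lambda>y. if y \<in> coord_image c then volume_density g c y else 0) \<in> borel_measurable borel"
    using chart(2)[OF c] C1_on_continuous[OF volume_density_C1[OF c]]
    by (intro borel_measurable_continuous_on_if) auto
  moreover have "(\<lambda>y. if y \<in> coord_image c then volume_density g c y else 0) = ?w" by (auto simp: indicator_def)
  ultimately have w: "?w \<in> borel_measurable borel" by simp
  have w0: "?w y \<ge> 0" for y using volume_density_pos[OF c] by (auto simp: indicator_def intro: less_imp_le)
  have dens: "(\<lambda>y. ennreal (volume_density g c y) * indicator (coord_image c) y) = (\<lambda>y. ennreal (?w y))"
    by (auto simp: indicator_def)
  have "(\<integral>p. f p \<partial>vol) = (\<integral>p. indicator (dom_chart c) p *\<^sub>R f p \<partial>vol)"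
    using supp by (intro Bochner_Integration.integral_cong) (auto simp: indicator_def)
  also have "\<dots> = (\<integral>p. f p \<partial>density vol (\<lambda>p. ennreal (indicator (dom_chart c) p)))"
    using f chart(1)[OF c] by (subst integral_density) (auto intro!: borel_measurable_indicator)
  also have "\<dots> = (\<integral>p. f p \<partial>chart_volume g c)"
    using density_vol_chart[OF c] by (simp add: ennreal_indicator)
  also have "\<dots> = (\<integral>y. f (?i y) \<partial>density lborel (\<lambda>y. ennreal (?w y)))"
    unfolding chart_volume_def dens using f inv_coord_measurable[OF c] by (subst integral_distr) auto
  also have "\<dots> = (\<integral>y. ?w y *\<^sub>R f (?i y) \<partial>lborel)"
    using fi w w0 by (subst integral_density) auto
  also have "\<dots> = (\<integral>y. indicator (coord_image c) y * (volume_density g c y * f (inv_coord c y)) \<partial>lborel)"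
    by (intro Bochner_Integration.integral_cong) (auto simp: indicator_def)
  finally show ?thesis .
qed

end

subsection \<open>Distance and Laplacian in a chart\<close>

text \<open>The straight coordinate segment is an admissible curve whose speed is at most
  \<open>N\<close> times its Euclidean speed. It also shows that the set of lengths is nonempty,
  which the real infimum requires in order to be meaningful.\<close>

lemma riemannian_dist_segment:
  fixes A :: "('m::{t2_space, second_countable_topology}, 'n::finite) chart set"
  assumes "riemannian_manifold A g" and c: "c \<in> A" and seg: "closed_segment x y \<subseteq> coord_image c"
    and N: "N \<ge> 0" "\<And>z v. z \<in> closed_segment x y \<Longrightarrow> v \<bullet> (g c (inv_coord c z) *v v) \<le> N\<^sup>2 * (norm v)\<^sup>2"
  shows "0 \<le> riemannian_dist A g (inv_coord c x) (inv_coord c y)"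
    and "riemannian_dist A g (inv_coord c x) (inv_coord c y) \<le> N * dist x y"
proof -
  interpret riemannian A g by unfold_locales fact
  define v where "v = y - x"
  define l where "l = (\<lambda>t::real. x + t *\<^sub>R v)"
  define \<gamma> where "\<gamma> = (\<lambda>t. inv_coord c (l t))"
  have l_seg: "l t \<in> closed_segment x y" if "t \<in> {0..1}" for t
    using that unfolding closed_segment_def l_def v_def by (auto intro!: exI[of _ t] simp: algebra_simps)
  then have l_V: "l t \<in> coord_image c" if "t \<in> {0..1}" for t using that seg by blast
  have l_cont: "continuous_on S l" for S unfolding l_def by (intro continuous_intros)
  have l_der: "(l has_vector_derivative v) (at t)" for t
    unfolding l_def by (auto intro!: derivative_eq_intros simp: has_vector_derivative_def)
  have \<gamma>_cont: "continuous_on {0..1} \<gamma>"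
    unfolding \<gamma>_def using l_V by (intro continuous_on_compose2[OF chart(4)[OF c] l_cont]) auto
  have ov: "l t \<in> overlap c c'" if "c' \<in> A" "t \<in> {0..1}" "\<gamma> t \<in> dom_chart c'" for c' t
    using overlap(7)[OF c that(1)] that l_V by (simp add: \<gamma>_def)
  have comp: "coord c' \<circ> \<gamma> = (\<lambda>t. transition c c' (l t))" for c'
    by (auto simp: transition_def \<gamma>_def)
  have der: "(coord c' \<circ> \<gamma> has_vector_derivative chart_jacobian c c' (l t) *v v) (at t)"
    if "c' \<in> A" "t \<in> {0..1}" "\<gamma> t \<in> dom_chart c'" for c' t
  proof -
    have "(l has_derivative (\<lambda>s. s *\<^sub>R v)) (at t)"
      using l_der by (simp add: has_vector_derivative_def)
    from has_derivative_compose[OF this transition_derivative(1)[OF c that(1) ov[OF that]]]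
    show ?thesis
      unfolding comp has_vector_derivative_def by (simp add: matrix_vector_mult_scaleR)
  qed
  have "C1_curve_on A 0 1 \<gamma>"
    unfolding C1_curve_on_def Let_def
  proof (intro conjI ballI \<gamma>_cont)
    fix c' t assume c': "c' \<in> A" and t: "t \<in> {t \<in> {0..1}. \<gamma> t \<in> dom_chart c'}"
    show "(coord c' \<circ> \<gamma>) differentiable at t within {0..1}"
      using der[OF c', of t] t
      by (auto simp: has_vector_derivative_def differentiable_def intro: has_derivative_at_withinI)
  next
    fix c' assume c': "c' \<in> A"
    let ?T = "{t \<in> {0..1}. \<gamma> t \<in> dom_chart c'}"
    have "continuous_on ?T (\<lambda>t. (chart_jacobian c c' (l t) *v v) $ i)" for i
      unfolding matrix_vector_mult_def vec_lambda_beta using ov[OF c']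
      by (intro continuous_intros continuous_on_compose2[OF jacobian_continuous[OF c c'] l_cont]) auto
    then have "continuous_on ?T (\<lambda>t. chart_jacobian c c' (l t) *v v)"
      using continuous_on_vec_lambda[of ?T "\<lambda>i t. (chart_jacobian c c' (l t) *v v) $ i"] by simp
    then show "continuous_on ?T (\<lambda>t. vector_derivative (coord c' \<circ> \<gamma>) (at t within {0..1}))"
    proof (rule continuous_on_eq)
      fix t assume "t \<in> ?T"
      then show "chart_jacobian c c' (l t) *v v = vector_derivative (coord c' \<circ> \<gamma>) (at t within {0..1})"
        using vector_derivative_within_cbox[of 0 1 t "coord c' \<circ> \<gamma>" "chart_jacobian c c' (l t) *v v"]
          has_vector_derivative_at_within[OF der[OF c', of t]] by simp
    qed
  qed
  then have pw: "piecewise_C1_curve A \<gamma>"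
    unfolding piecewise_C1_curve_def by (intro exI[of _ "{0, 1}"]) auto
  have ends: "\<gamma> 0 = inv_coord c x" "\<gamma> 1 = inv_coord c y" by (auto simp: \<gamma>_def l_def v_def)
  \<comment> \<open>The speed is evaluated in a chart that depends on \<open>t\<close>; the tensor
    law brings it back to the fixed chart \<open>c\<close>. The line \<open>l\<close> continues
    beyond both ends, so two-sided derivatives exist at 0 and 1 as well.\<close>
  have sp: "speed A g \<gamma> t \<le> N * norm v" if t: "t \<in> {0..1}" for t
  proof -
    let ?c = "chart_at A (\<gamma> t)" and ?J = "chart_jacobian c (chart_at A (\<gamma> t)) (l t)"
    note c' = chart_at[of "\<gamma> t"]
    have vd: "vector_derivative (coord ?c \<circ> \<gamma>) (at t) = ?J *v v"
      by (rule vector_derivative_at[OF der[OF c'(1) t c'(2)]])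
    have "(?J *v v) \<bullet> (g ?c (\<gamma> t) *v (?J *v v)) = v \<bullet> (g c (\<gamma> t) *v v)"
    proof -
      have "g c (\<gamma> t) = transpose ?J ** g ?c (\<gamma> t) ** ?J"
        using transition_derivative(2)[OF c c'(1) ov[OF c'(1) t c'(2)]] by (simp add: \<gamma>_def)
      then have "v \<bullet> (g c (\<gamma> t) *v v) = v \<bullet> (transpose ?J *v (g ?c (\<gamma> t) *v (?J *v v)))"
        by (simp add: matrix_vector_mul_assoc matrix_mul_assoc)
      also have "\<dots> = (?J *v v) \<bullet> (g ?c (\<gamma> t) *v (?J *v v))"
        by (metis dot_lmul_matrix transpose_matrix_vector transpose_transpose)
      finally show ?thesis by simp
    qed
    also have "\<dots> \<le> N\<^sup>2 * (norm v)\<^sup>2" unfolding \<gamma>_def by (rule N(2)[OF l_seg[OF t]])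
    finally have "sqrt ((?J *v v) \<bullet> (g ?c (\<gamma> t) *v (?J *v v))) \<le> sqrt ((N * norm v)\<^sup>2)"
      by (simp add: power_mult_distrib)
    then show ?thesis using N(1) by (simp add: speed_def Let_def vd)
  qed
  have len: "curve_length A g \<gamma> \<le> N * norm v"
  proof (cases "speed A g \<gamma> integrable_on {0..1}")
    case True
    then have "integral {0..1} (speed A g \<gamma>) \<le> integral {0..1} (\<lambda>_::real. N * norm v)"
      using sp by (intro integral_le) auto
    then show ?thesis by (simp add: curve_length_def)
  next
    \<comment> \<open>A non-integrable speed has integral 0 by convention, so the bound holds here
      too.\<close>
    case False
    then show ?thesis using N(1) by (simp add: curve_length_def not_integrable_integral)
  qed
  let ?S = "{curve_length A g \<gamma> |\<gamma>. piecewise_C1_curve A \<gamma> \<and> \<gamma> 0 = inv_coord c x \<and> \<gamma> 1 = inv_coord c y}"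
  have mem: "curve_length A g \<gamma> \<in> ?S" using pw ends by blast
  have nonneg: "0 \<le> d" if "d \<in> ?S" for d
  proof -
    have "0 \<le> v \<bullet> (g (chart_at A p) p *v v)" for v p
    proof -
      note c' = chart_at[of p]
      have "coord (chart_at A p) p \<in> coord_image (chart_at A p)" using c' by blast
      then show ?thesis
        using gram(3)[OF c'(1), of "coord (chart_at A p) p" v] chart(5)[OF c'] by (cases "v = 0") auto
    qed
    then have "0 \<le> speed A g \<gamma> t" for \<gamma> t by (simp add: speed_def Let_def)
    then have "0 \<le> curve_length A g \<gamma>" for \<gamma>
      unfolding curve_length_def
      by (cases "speed A g \<gamma> integrable_on {0..1}") (auto simp: integral_nonneg not_integrable_integral)
    then show ?thesis using that by auto
  qed
  show "0 \<le> riemannian_dist A g (inv_coord c x) (inv_coord c y)"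
    unfolding riemannian_dist_def using mem nonneg by (intro cInf_greatest) auto
  have "riemannian_dist A g (inv_coord c x) (inv_coord c y) \<le> curve_length A g \<gamma>"
    unfolding riemannian_dist_def using nonneg by (intro cInf_lower mem bdd_belowI[of _ 0]) auto
  also have "\<dots> \<le> N * dist x y" using len by (simp add: v_def dist_norm norm_minus_commute)
  finally show "riemannian_dist A g (inv_coord c x) (inv_coord c y) \<le> N * dist x y" .
qed

text \<open>The gradient of \<open>f\<close> in coordinates, multiplied by the volume density: its
  divergence is the density times the Laplacian.\<close>

definition flux :: "('m, 'n::finite) metric_components \<Rightarrow> ('m, 'n) chart \<Rightarrow> ('m \<Rightarrow> real) \<Rightarrow> 'n \<Rightarrow> real^'n \<Rightarrow> real"
  where "flux g c f i y = (\<Sum>j\<in>UNIV. volume_density g c y * matrix_inv (g c (inv_coord c y)) $ i $ j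
    * partial_deriv j (f \<circ> inv_coord c) y)"

lemma laplacian_in_chart_flux:
  "laplacian_in_chart g c f p = (\<Sum>i\<in>UNIV. partial_deriv i (flux g c f i) (coord c p)) / volume_density g c (coord c p)"
  unfolding laplacian_in_chart_def Let_def flux_def[abs_def] volume_density_def
  by (simp add: sum_distrib_left mult.assoc sum_divide_distrib)

text \<open>The contravariant transformation law of the inverse metric. Multiplying
  \<open>G'\<close> times the claimed inverse by \<open>transpose J\<close> from the left recovers
  \<open>transpose J\<close>, which can be cancelled.\<close>

lemma matrix_inv_congruence:
  fixes G J :: "real^'n::finite^'n"
  assumes G: "G = transpose J ** G' ** J" and "det G \<noteq> 0"
  shows "J ** matrix_inv G ** transpose J = matrix_inv G'"
proof -
  have d: "det J \<noteq> 0" "det G' \<noteq> 0" using assms by (auto simp: det_mul det_transpose)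
  have dT: "det (transpose J) \<noteq> 0" using d by (simp add: det_transpose)
  let ?M = "J ** matrix_inv G ** transpose J"
  have "transpose J ** (G' ** ?M) = (transpose J ** G' ** J) ** matrix_inv G ** transpose J"
    by (simp add: matrix_mul_assoc)
  also have "\<dots> = transpose J"
    unfolding G[symmetric] using matrix_inv_mult(1)[OF assms(2)] by simp
  finally have "matrix_inv (transpose J) ** (transpose J ** (G' ** ?M)) = matrix_inv (transpose J) ** transpose J"
    by simp
  then have "G' ** ?M = mat 1"
    unfolding matrix_mul_assoc[of "matrix_inv (transpose J)"] matrix_inv_mult(2)[OF dT] by simp
  then have "matrix_inv G' ** (G' ** ?M) = matrix_inv G'" by simp
  then show ?thesis
    unfolding matrix_mul_assoc[of "matrix_inv G'"] matrix_inv_mult(2)[OF d(2)] by simp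
qed

lemma integral_by_parts_compact:
  fixes X :: "'n::finite \<Rightarrow> real^'n \<Rightarrow> real"
  assumes V: "open V" "compact K" "K \<subseteq> V" and X: "\<And>i. C1_on V (X i)" and \<psi>: "C1_on V \<psi>"
    and supp: "\<And>y. y \<in> V \<Longrightarrow> y \<notin> K \<Longrightarrow> \<psi> y = 0"
  shows "(\<integral>y. indicator K y * ((\<Sum>i\<in>UNIV. partial_deriv i (X i) y) * \<psi> y) \<partial>lborel)
    = - (\<integral>y. indicator K y * (\<Sum>i\<in>UNIV. X i y * partial_deriv i \<psi> y) \<partial>lborel)"
proof -
  have int: "integrable lborel (\<lambda>y. indicator K y * f y)" if "continuous_on V f" for f :: "real^'n \<Rightarrow> real"
    using borel_integrable_compact[OF V(2) continuous_on_subset[OF that V(3)]] by simp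
  have P: "C1_on V (\<lambda>y. X i y * \<psi> y)" for i by (intro C1_on_mult X \<psi>)
  have "(\<integral>y. indicator K y * ((\<Sum>i\<in>UNIV. partial_deriv i (X i) y) * \<psi> y) \<partial>lborel)
      + (\<integral>y. indicator K y * (\<Sum>i\<in>UNIV. X i y * partial_deriv i \<psi> y) \<partial>lborel)
    = (\<integral>y. indicator K y * ((\<Sum>i\<in>UNIV. partial_deriv i (X i) y) * \<psi> y)
         + indicator K y * (\<Sum>i\<in>UNIV. X i y * partial_deriv i \<psi> y) \<partial>lborel)"
    by (intro Bochner_Integration.integral_add[symmetric] int continuous_intros
        C1_on_continuous_partial[OF X] C1_on_continuous[OF X] C1_on_continuous[OF \<psi>] C1_on_continuous_partial[OF \<psi>])
  also have "\<dots> = (\<integral>y. (\<Sum>i\<in>UNIV. indicator K y * partial_deriv i (\<lambda>y. X i y * \<psi> y) y) \<partial>lborel)"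
  proof (rule Bochner_Integration.integral_cong[OF refl])
    fix y
    show "indicator K y * ((\<Sum>i\<in>UNIV. partial_deriv i (X i) y) * \<psi> y) + indicator K y * (\<Sum>i\<in>UNIV. X i y * partial_deriv i \<psi> y)
      = (\<Sum>i\<in>UNIV. indicator K y * partial_deriv i (\<lambda>y. X i y * \<psi> y) y)"
    proof (cases "y \<in> K")
      case True
      then have "y \<in> V" using V(3) by auto
      then show ?thesis
        by (simp add: partial_deriv_mult C1_on_differentiable[OF X] C1_on_differentiable[OF \<psi>]
            sum.distrib sum_distrib_right sum_distrib_left)
    qed simp
  qed
  also have "\<dots> = (\<Sum>i\<in>UNIV. \<integral>y. indicator K y * partial_deriv i (\<lambda>y. X i y * \<psi> y) y \<partial>lborel)"
    by (intro Bochner_Integration.integral_sum int C1_on_continuous_partial P)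
  also have "\<dots> = 0"
    using supp by (intro sum.neutral ballI integral_partial_deriv_eq_0[OF V P]) simp
  finally show ?thesis by linarith
qed

context riemannian
begin

section \<open>Chart independence of the Laplacian\<close>

lemma smooth_function_chart:
  assumes "smooth_function A f" "c \<in> A"
  shows "C1_on (coord_image c) (f \<circ> inv_coord c)" "C1_on (coord_image c) (partial_deriv i (f \<circ> inv_coord c))"
  using assms smooth_on_C1 smooth_on_partial_C1 unfolding smooth_function_def by blast+

lemma flux_C1:
  assumes "smooth_function A f" "c \<in> A"
  shows "C1_on (coord_image c) (flux g c f i)"
  unfolding flux_def[abs_def]
  by (intro C1_on_sum C1_on_mult volume_density_C1 inv_gram_C1 smooth_function_chart assms)

lemma C1_compose_transition:
  assumes c: "c \<in> A" "c' \<in> A" and \<psi>: "C1_on W \<psi>" "\<And>y. y \<in> U \<Longrightarrow> transition c c' y \<in> W" and U: "U \<subseteq> overlap c c'"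
  shows "C1_on U (\<lambda>y. \<psi> (transition c c' y))"
    and "\<And>y. y \<in> U \<Longrightarrow> partial_deriv j (\<lambda>y. \<psi> (transition c c' y)) y
      = (\<Sum>k\<in>UNIV. chart_jacobian c c' y $ k $ j * partial_deriv k \<psi> (transition c c' y))"
proof -
  have der: "((\<lambda>y. \<psi> (transition c c' y)) has_derivative
      (\<lambda>v. \<Sum>k\<in>UNIV. (chart_jacobian c c' y *v v) $ k * partial_deriv k \<psi> (transition c c' y))) (at y)"
    if "y \<in> U" for y
    using has_derivative_compose[OF transition_derivative(1)[OF c]
        has_derivative_partial_deriv[OF C1_on_differentiable[OF \<psi>]]] that U by blast
  have mv: "(chart_jacobian c c' y *v axis j 1) $ k = chart_jacobian c c' y $ k $ j" for y k j
    by (simp add: matrix_vector_mult_basis column_def)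
  show "\<And>y. y \<in> U \<Longrightarrow> partial_deriv j (\<lambda>y. \<psi> (transition c c' y)) y
      = (\<Sum>k\<in>UNIV. chart_jacobian c c' y $ k $ j * partial_deriv k \<psi> (transition c c' y))"
    using partial_deriv_eqI[OF der] by (simp add: mv)
  have "continuous_on (overlap c c') (transition c c')"
    using overlap(4)[OF c] by (simp add: homeomorphism_def)
  then have tc: "continuous_on U (transition c c')" using U by (rule continuous_on_subset)
  show "C1_on U (\<lambda>y. \<psi> (transition c c' y))"
  proof (rule C1_onI[OF der])
    show "continuous_on U (\<lambda>y. \<Sum>k\<in>UNIV. (chart_jacobian c c' y *v axis i 1) $ k * partial_deriv k \<psi> (transition c c' y))" for i
      unfolding mv using \<psi>(2)
      by (intro continuous_intros continuous_on_subset[OF jacobian_continuous[OF c] U]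
          continuous_on_compose2[OF C1_on_continuous_partial[OF \<psi>(1)] tc]) auto
  qed
qed

text \<open>The inner product of two gradients does not depend on the chart.\<close>

lemma flux_transition:
  assumes c: "c \<in> A" "c' \<in> A" and f: "smooth_function A f" and y: "y \<in> overlap c c'"
    and \<psi>: "C1_on W \<psi>" "open W" "transition c c' y \<in> W" "W \<subseteq> overlap c' c"
  shows "(\<Sum>i\<in>UNIV. flux g c f i y * partial_deriv i (\<lambda>y. \<psi> (transition c c' y)) y) / volume_density g c y
    = (\<Sum>i\<in>UNIV. flux g c' f i (transition c c' y) * partial_deriv i \<psi> (transition c c' y))
        / volume_density g c' (transition c c' y)"
proof -
  let ?t = "transition c c'" and ?J = "chart_jacobian c c' y"
  let ?G = "g c (inv_coord c y)" and ?G' = "g c' (inv_coord c y)"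
  define a where "a = (\<chi> j. partial_deriv j (f \<circ> inv_coord c) y)"
  define b where "b = (\<chi> j. partial_deriv j (\<lambda>y. \<psi> (?t y)) y)"
  define a' where "a' = (\<chi> j. partial_deriv j (f \<circ> inv_coord c') (?t y))"
  define b' where "b' = (\<chi> j. partial_deriv j \<psi> (?t y))"
  have yV: "y \<in> coord_image c" using y overlap(2)[OF c] by blast
  have tV: "?t y \<in> coord_image c'" by (rule overlap(5)[OF c y])
  have flux_eq: "(\<Sum>i\<in>UNIV. flux g d f i z * q $ i) / volume_density g d z
      = q \<bullet> (matrix_inv (g d (inv_coord d z)) *v (\<chi> j. partial_deriv j (f \<circ> inv_coord d) z))"
    if "d \<in> A" "z \<in> coord_image d" for d z q
  proof -
    have "(\<Sum>i\<in>UNIV. flux g d f i z * q $ i) = volume_density g d z *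
        (q \<bullet> (matrix_inv (g d (inv_coord d z)) *v (\<chi> j. partial_deriv j (f \<circ> inv_coord d) z)))"
      by (simp add: flux_def inner_vec_def matrix_vector_mult_def sum_distrib_left sum_distrib_right mult_ac)
    then show ?thesis using volume_density_pos[OF that] by simp
  qed
  have "open (overlap c c' \<inter> ?t -` W)"
    using overlap(4)[OF c] overlap(1)[OF c] \<psi>(2)
    by (intro continuous_open_preimage) (auto simp: homeomorphism_def)
  then have U: "open (overlap c c' \<inter> ?t -` W)" "y \<in> overlap c c' \<inter> ?t -` W" using y \<psi>(3) by auto
  have b: "b = transpose ?J *v b'"
    using C1_compose_transition(2)[OF c \<psi>(1), of "overlap c c' \<inter> ?t -` W" y] U
    by (simp add: b_def b'_def vec_eq_iff matrix_vector_mult_def transpose_def)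
  have a: "a = transpose ?J *v a'"
  proof -
    have "a $ j = (transpose ?J *v a') $ j" for j
    proof -
      have "partial_deriv j (f \<circ> inv_coord c) y = partial_deriv j (\<lambda>z. (f \<circ> inv_coord c') (?t z)) y"
        using overlap(6)[OF c] by (intro partial_deriv_cong_open[OF overlap(1)[OF c] y]) simp
      also have "\<dots> = (\<Sum>k\<in>UNIV. ?J $ k $ j * partial_deriv k (f \<circ> inv_coord c') (?t y))"
        using overlap(5)[OF c] y
        by (intro C1_compose_transition(2)[OF c smooth_function_chart(1)[OF f c(2)] _ order_refl]) auto
      finally show ?thesis by (simp add: a_def a'_def matrix_vector_mult_def transpose_def)
    qed
    then show ?thesis by (simp add: vec_eq_iff)
  qed
  have inv: "?J ** matrix_inv ?G ** transpose ?J = matrix_inv ?G'"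
    using transition_derivative(2)[OF c y] det_gram_pos[OF c(1) yV] by (intro matrix_inv_congruence) auto
  have "(\<Sum>i\<in>UNIV. flux g c f i y * partial_deriv i (\<lambda>y. \<psi> (?t y)) y) / volume_density g c y
      = b \<bullet> (matrix_inv ?G *v a)"
    using flux_eq[OF c(1) yV, of b] by (simp add: b_def a_def)
  also have "\<dots> = b' \<bullet> (?J *v (matrix_inv ?G *v (transpose ?J *v a')))"
    unfolding a b by (metis dot_lmul_matrix transpose_matrix_vector)
  also have "\<dots> = b' \<bullet> (matrix_inv ?G' *v a')"
    unfolding inv[symmetric] by (simp only: matrix_vector_mul_assoc matrix_mul_assoc)
  also have "\<dots> = (\<Sum>i\<in>UNIV. flux g c' f i (?t y) * partial_deriv i \<psi> (?t y)) / volume_density g c' (?t y)"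
    using flux_eq[OF c(2) tV, of b'] overlap(6)[OF c y] by (simp add: b'_def a'_def)
  finally show ?thesis .
qed

text \<open>Both sides are the integral of \<open>\<Xi>\<close> over \<open>K\<close> against
  \<open>vol\<close>, read in two charts.\<close>

lemma integral_switch_chart:
  assumes c: "c \<in> A" "c' \<in> A" and K: "compact K" "K \<subseteq> dom_chart c" "K \<subseteq> dom_chart c'"
    and \<Xi>: "continuous_on K \<Xi>"
  shows "(\<integral>y. indicator (coord c ` K) y * (volume_density g c y * \<Xi> (inv_coord c y)) \<partial>lborel)
    = (\<integral>y. indicator (coord c' ` K) y * (volume_density g c' y * \<Xi> (inv_coord c' y)) \<partial>lborel)"
proof -
  have "closed K" using K(1) by (rule compact_imp_closed)
  then have "(\<lambda>p. if p \<in> K then \<Xi> p else 0) \<in> borel_measurable borel"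
    using \<Xi> by (intro borel_measurable_continuous_on_if) auto
  then have *: "(\<integral>p. (if p \<in> K then \<Xi> p else 0) \<partial>vol)
      = (\<integral>y. indicator (coord_image d) y * (volume_density g d y * (if inv_coord d y \<in> K then \<Xi> (inv_coord d y) else 0)) \<partial>lborel)"
    if "d \<in> A" "K \<subseteq> dom_chart d" for d
    using that by (intro integral_vol_chart) auto
  have "(\<integral>y. indicator (coord_image d) y * (volume_density g d y * (if inv_coord d y \<in> K then \<Xi> (inv_coord d y) else 0)) \<partial>lborel)
      = (\<integral>y. indicator (coord d ` K) y * (volume_density g d y * \<Xi> (inv_coord d y)) \<partial>lborel)"
    if "d \<in> A" "K \<subseteq> dom_chart d" for d
  proof (rule Bochner_Integration.integral_cong[OF refl])
    fix y
    have "y \<in> coord d ` K \<longleftrightarrow> y \<in> coord_image d \<and> inv_coord d y \<in> K"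
      using that chart(5,6)[OF that(1)] by (auto simp: image_iff)
    then show "indicator (coord_image d) y * (volume_density g d y * (if inv_coord d y \<in> K then \<Xi> (inv_coord d y) else 0))
      = indicator (coord d ` K) y * (volume_density g d y * \<Xi> (inv_coord d y))"
      by (auto simp: indicator_def)
  qed
  note ** = this
  show ?thesis
    unfolding **[OF c(1) K(2), symmetric] **[OF c(2) K(3), symmetric]
      *[OF c(1) K(2), symmetric] *[OF c(2) K(3), symmetric] ..
qed

text \<open>Both Laplacians represent the same weak form, so their difference integrates to zero
  against every test function.\<close>

lemma laplacian_chart_test:
  assumes c: "c \<in> A" "c' \<in> A" and f: "smooth_function A f"
    and K: "compact K" "K \<subseteq> dom_chart c" "K \<subseteq> dom_chart c'"
    and \<psi>: "C1_on UNIV \<psi>" "\<And>y. y \<notin> coord c ` K \<Longrightarrow> \<psi> y = 0"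
  shows "(\<integral>y. indicator (coord c ` K) y * (volume_density g c y * ((laplacian_in_chart g c f (inv_coord c y)
      - laplacian_in_chart g c' f (inv_coord c y)) * \<psi> y)) \<partial>lborel) = 0"
proof -
  let ?w = "volume_density g c" and ?w' = "volume_density g c'"
  let ?L = "laplacian_in_chart g c f" and ?L' = "laplacian_in_chart g c' f"
  let ?D = "\<lambda>y. \<Sum>i\<in>UNIV. partial_deriv i (flux g c f i) y"
  let ?D' = "\<lambda>y. \<Sum>i\<in>UNIV. partial_deriv i (flux g c' f i) y"
  let ?t = "transition c' c"
  \<comment> \<open>The same test function on the manifold, expressed in the second chart.\<close>
  define \<psi>' where "\<psi>' = (\<lambda>y. \<psi> (?t y))"
  define K1 where "K1 = coord c ` K"
  define K2 where "K2 = coord c' ` K"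
  define O1 where "O1 = overlap c c'"
  define O2 where "O2 = overlap c' c"
  have O: "open O1" "open O2" unfolding O1_def O2_def using overlap(1) c by auto
  have OV: "O1 \<subseteq> coord_image c" "O2 \<subseteq> coord_image c'" unfolding O1_def O2_def using overlap(2) c by auto
  have cK: "compact K1" "compact K2"
    unfolding K1_def K2_def using K chart(3)[OF c(1)] chart(3)[OF c(2)]
    by (auto intro!: compact_continuous_image intro: continuous_on_subset)
  have KO: "K1 \<subseteq> O1" "K2 \<subseteq> O2" unfolding K1_def K2_def O1_def O2_def overlap_def using K by auto
  have t_maps: "?t y \<in> O1" if "y \<in> O2" for y
    using that overlap(4)[OF c(2,1)] unfolding O1_def O2_def by (auto simp: homeomorphism_def)
  have \<psi>1: "C1_on O1 \<psi>" using \<psi>(1) by (rule C1_on_subset) simp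
  have \<psi>2: "C1_on O2 \<psi>'"
    unfolding \<psi>'_def using C1_compose_transition(1)[OF c(2,1) \<psi>(1)] by (simp add: O2_def)
  have \<psi>2_supp: "\<psi>' y = 0" if y: "y \<in> O2" "y \<notin> K2" for y
  proof -
    have "?t y \<notin> coord c ` K"
    proof
      assume "?t y \<in> coord c ` K"
      then obtain p where p: "p \<in> K" "?t y = coord c p" by blast
      then have "inv_coord c (?t y) = p" using chart(5)[OF c(1)] K(2) by auto
      then have "inv_coord c' y = p" using overlap(6)[OF c(2,1)] y(1) by (simp add: O2_def)
      then have "y = coord c' p" using chart(6)[OF c(2)] y(1) OV(2) by auto
      then show False using y(2) p(1) by (simp add: K2_def)
    qed
    then show ?thesis unfolding \<psi>'_def by (rule \<psi>(2))
  qed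
  have fl1: "C1_on O1 (flux g c f i)" for i using flux_C1[OF f c(1)] OV(1) by (rule C1_on_subset)
  have fl2: "C1_on O2 (flux g c' f i)" for i using flux_C1[OF f c(2)] OV(2) by (rule C1_on_subset)
  have w1: "?w y > 0" if "y \<in> O1" for y using volume_density_pos[OF c(1)] that OV(1) by blast
  have w2: "?w' y > 0" if "y \<in> O2" for y using volume_density_pos[OF c(2)] that OV(2) by blast
  have cw1: "continuous_on O1 ?w" using continuous_on_subset[OF C1_on_continuous[OF volume_density_C1[OF c(1)]] OV(1)] .
  have cw2: "continuous_on O2 ?w'" using continuous_on_subset[OF C1_on_continuous[OF volume_density_C1[OF c(2)]] OV(2)] .
  have L1: "?L (inv_coord c y) = ?D y / ?w y" if "y \<in> O1" for y
    unfolding laplacian_in_chart_flux chart(6)[OF c(1) subsetD[OF OV(1) that]] ..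
  have L2: "?L' (inv_coord c' y) = ?D' y / ?w' y" if "y \<in> O2" for y
    unfolding laplacian_in_chart_flux chart(6)[OF c(2) subsetD[OF OV(2) that]] ..
  have coordK: "continuous_on K (coord c)" "continuous_on K (coord c')"
    using K chart(3)[OF c(1)] chart(3)[OF c(2)] continuous_on_subset by blast+
  \<comment> \<open>\<open>\<Gamma>\<close> is the inner product of the gradients of
    \<open>f\<close> and of the test function, and \<open>\<Xi>\<close> is the Laplacian of the
    second chart times the test function. As functions of the point they can be integrated in either
    chart.\<close>
  define \<Gamma> where "\<Gamma> = (\<lambda>p. (\<Sum>i\<in>UNIV. flux g c f i (coord c p) * partial_deriv i \<psi> (coord c p)) / ?w (coord c p))"
  define \<Xi> where "\<Xi> = (\<lambda>p. ?D' (coord c' p) / ?w' (coord c' p) * \<psi> (coord c p))"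
  have KO': "coord c p \<in> O1" "coord c' p \<in> O2" if "p \<in> K" for p
    using that KO unfolding K1_def K2_def by auto
  have c\<Gamma>: "continuous_on K \<Gamma>"
    unfolding \<Gamma>_def using KO' w1
    by (intro continuous_intros continuous_on_compose2[OF C1_on_continuous[OF fl1] coordK(1)]
        continuous_on_compose2[OF C1_on_continuous_partial[OF \<psi>1] coordK(1)]
        continuous_on_compose2[OF cw1 coordK(1)]) force+
  have c\<Xi>: "continuous_on K \<Xi>"
    unfolding \<Xi>_def using KO' w2
    by (intro continuous_intros continuous_on_compose2[OF C1_on_continuous_partial[OF fl2] coordK(2)]
        continuous_on_compose2[OF C1_on_continuous[OF \<psi>1] coordK(1)]
        continuous_on_compose2[OF cw2 coordK(2)]) force+
  have inv1: "coord c (inv_coord c y) = y" if "y \<in> O1" for y using chart(6)[OF c(1)] that OV(1) by blast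
  have inv2: "coord c' (inv_coord c' y) = y" if "y \<in> O2" for y using chart(6)[OF c(2)] that OV(2) by blast
  have tc: "coord c (inv_coord c' y) = ?t y" for y by (simp add: transition_def)
  have 1: "(\<integral>y. indicator K1 y * (?D y * \<psi> y) \<partial>lborel) = - (\<integral>y. indicator K1 y * (?w y * \<Gamma> (inv_coord c y)) \<partial>lborel)"
  proof -
    have "(\<integral>y. indicator K1 y * (?D y * \<psi> y) \<partial>lborel)
        = - (\<integral>y. indicator K1 y * (\<Sum>i\<in>UNIV. flux g c f i y * partial_deriv i \<psi> y) \<partial>lborel)"
      using \<psi>(2) by (intro integral_by_parts_compact[OF O(1) cK(1) KO(1) fl1 \<psi>1]) (simp add: K1_def)
    also have "(\<integral>y. indicator K1 y * (\<Sum>i\<in>UNIV. flux g c f i y * partial_deriv i \<psi> y) \<partial>lborel)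
        = (\<integral>y. indicator K1 y * (?w y * \<Gamma> (inv_coord c y)) \<partial>lborel)"
      using KO(1) w1 inv1 by (intro Bochner_Integration.integral_cong) (force simp: \<Gamma>_def indicator_def)+
    finally show ?thesis .
  qed
  have 2: "(\<integral>y. indicator K2 y * (?D' y * \<psi>' y) \<partial>lborel) = - (\<integral>y. indicator K2 y * (?w' y * \<Gamma> (inv_coord c' y)) \<partial>lborel)"
  proof -
    have "(\<integral>y. indicator K2 y * (?D' y * \<psi>' y) \<partial>lborel)
        = - (\<integral>y. indicator K2 y * (\<Sum>i\<in>UNIV. flux g c' f i y * partial_deriv i \<psi>' y) \<partial>lborel)"
      by (rule integral_by_parts_compact[OF O(2) cK(2) KO(2) fl2 \<psi>2 \<psi>2_supp])
    also have "(\<integral>y. indicator K2 y * (\<Sum>i\<in>UNIV. flux g c' f i y * partial_deriv i \<psi>' y) \<partial>lborel)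
        = (\<integral>y. indicator K2 y * (?w' y * \<Gamma> (inv_coord c' y)) \<partial>lborel)"
    proof (rule Bochner_Integration.integral_cong[OF refl])
      fix y
      show "indicator K2 y * (\<Sum>i\<in>UNIV. flux g c' f i y * partial_deriv i \<psi>' y)
          = indicator K2 y * (?w' y * \<Gamma> (inv_coord c' y))"
      proof (cases "y \<in> K2")
        case True
        then have y: "y \<in> O2" using KO by blast
        have "\<Gamma> (inv_coord c' y) = (\<Sum>i\<in>UNIV. flux g c' f i y * partial_deriv i \<psi>' y) / ?w' y"
          unfolding \<Gamma>_def \<psi>'_def tc
          using flux_transition[OF c(2,1) f _ \<psi>1 O(1) t_maps[OF y]] y by (simp add: O1_def O2_def)
        then show ?thesis using w2[OF y] by simp
      qed simp
    qed
    finally show ?thesis .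
  qed
  have 3: "(\<integral>y. indicator K1 y * (?w y * \<Gamma> (inv_coord c y)) \<partial>lborel) = (\<integral>y. indicator K2 y * (?w' y * \<Gamma> (inv_coord c' y)) \<partial>lborel)"
    unfolding K1_def K2_def by (rule integral_switch_chart[OF c K c\<Gamma>])
  have 4: "(\<integral>y. indicator K1 y * (?w y * \<Xi> (inv_coord c y)) \<partial>lborel) = (\<integral>y. indicator K2 y * (?w' y * \<Xi> (inv_coord c' y)) \<partial>lborel)"
    unfolding K1_def K2_def by (rule integral_switch_chart[OF c K c\<Xi>])
  have 5: "(\<integral>y. indicator K2 y * (?w' y * \<Xi> (inv_coord c' y)) \<partial>lborel) = (\<integral>y. indicator K2 y * (?D' y * \<psi>' y) \<partial>lborel)"
    using KO(2) w2 inv2 by (intro Bochner_Integration.integral_cong) (force simp: \<Xi>_def \<psi>'_def tc indicator_def)+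
  \<comment> \<open>In each chart, integration by parts turns the Laplacian term into minus the
    integral of \<open>\<Gamma>\<close>.\<close>
  have eq: "(\<integral>y. indicator K1 y * (?D y * \<psi> y) \<partial>lborel) = (\<integral>y. indicator K1 y * (?w y * \<Xi> (inv_coord c y)) \<partial>lborel)"
    using 1 2 3 4 5 by simp
  have int: "integrable lborel (\<lambda>y. indicator K1 y * q y)" if "continuous_on K1 q" for q :: "real^'n \<Rightarrow> real"
    using borel_integrable_compact[OF cK(1) that] by simp
  have cont1: "continuous_on K1 (\<lambda>y. ?D y * \<psi> y)"
    by (intro continuous_on_mult continuous_on_sum continuous_on_subset[OF _ KO(1)] C1_on_continuous_partial[OF fl1]
        C1_on_continuous[OF \<psi>1])
  have invK: "inv_coord c y \<in> K" if "y \<in> K1" for y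
    using that chart(5)[OF c(1)] K(2) unfolding K1_def by auto
  have cont2: "continuous_on K1 (\<lambda>y. ?w y * \<Xi> (inv_coord c y))"
    using invK KO(1) OV(1)
    by (intro continuous_on_mult continuous_on_subset[OF cw1 KO(1)] continuous_on_compose2[OF c\<Xi>]
        continuous_on_subset[OF chart(4)[OF c(1)]]) auto
  have "(\<integral>y. indicator K1 y * (?w y * ((?L (inv_coord c y) - ?L' (inv_coord c y)) * \<psi> y)) \<partial>lborel)
      = (\<integral>y. indicator K1 y * (?D y * \<psi> y) - indicator K1 y * (?w y * \<Xi> (inv_coord c y)) \<partial>lborel)"
  proof (rule Bochner_Integration.integral_cong[OF refl])
    fix y
    show "indicator K1 y * (?w y * ((?L (inv_coord c y) - ?L' (inv_coord c y)) * \<psi> y))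
        = indicator K1 y * (?D y * \<psi> y) - indicator K1 y * (?w y * \<Xi> (inv_coord c y))"
    proof (cases "y \<in> K1")
      case True
      then have y: "y \<in> O1" using KO by blast
      have "?L' (inv_coord c y) = ?D' (coord c' (inv_coord c y)) / ?w' (coord c' (inv_coord c y))"
        by (rule laplacian_in_chart_flux)
      then have "?L' (inv_coord c y) * \<psi> y = \<Xi> (inv_coord c y)"
        unfolding \<Xi>_def inv1[OF y] by simp
      moreover have "?w y * (?L (inv_coord c y) * \<psi> y) = ?D y * \<psi> y" using w1[OF y] L1[OF y] by simp
      ultimately show ?thesis using True by (simp add: algebra_simps)
    qed simp
  qed
  also have "\<dots> = 0" using eq int[OF cont1] int[OF cont2] by (subst Bochner_Integration.integral_diff) auto
  finally show ?thesis unfolding K1_def .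
qed

text \<open>\<open>laplace_beltrami\<close> uses at each point the chart picked by
  \<open>chart_at\<close>, which may jump from point to point; this lemma permits one fixed chart on
  a whole ball. If the two expressions differed at a point, their difference would keep its sign on
  a small ball, and a bump supported there would contradict \<open>laplacian_chart_test\<close>. The
  weak formulation avoids computing with second derivatives of the transition map.\<close>

lemma laplacian_chart_invariant:
  assumes c: "c \<in> A" "c' \<in> A" and f: "smooth_function A f" and p: "p \<in> dom_chart c" "p \<in> dom_chart c'"
  shows "laplacian_in_chart g c f p = laplacian_in_chart g c' f p"
proof (rule ccontr)
  assume ne: "laplacian_in_chart g c f p \<noteq> laplacian_in_chart g c' f p"
  define E where "E = (\<lambda>y. laplacian_in_chart g c f (inv_coord c y) - laplacian_in_chart g c' f (inv_coord c y))"
  let ?O = "overlap c c'" and ?w = "volume_density g c"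
  let ?y0 = "coord c p"
  have y0: "?y0 \<in> ?O" using p by (auto simp: overlap_def)
  have E0: "E ?y0 \<noteq> 0" using ne chart(5)[OF c(1) p(1)] by (simp add: E_def)
  have cont: "continuous_on ?O E"
  proof -
    have q: "continuous_on (coord_image d) (\<lambda>y. (\<Sum>i\<in>UNIV. partial_deriv i (flux g d f i) y) / volume_density g d y)"
      if d: "d \<in> A" for d
      using volume_density_pos[OF d]
      by (intro continuous_intros C1_on_continuous_partial[OF flux_C1[OF f d]] C1_on_continuous[OF volume_density_C1[OF d]]) force
    have "continuous_on ?O (\<lambda>y. laplacian_in_chart g c f (inv_coord c y))"
      using continuous_on_subset[OF q[OF c(1)] overlap(2)[OF c]]
      by (rule continuous_on_eq) (use overlap(2)[OF c] chart(6)[OF c(1)] in \<open>auto simp: laplacian_in_chart_flux subset_iff\<close>)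
    moreover have "continuous_on ?O (\<lambda>y. laplacian_in_chart g c' f (inv_coord c y))"
    proof -
      have "continuous_on ?O (transition c c')" using overlap(4)[OF c] by (simp add: homeomorphism_def)
      then show ?thesis
        unfolding laplacian_in_chart_flux using overlap(5)[OF c]
        by (intro continuous_on_compose2[OF q[OF c(2)]]) (auto simp: transition_def comp_def)
    qed
    ultimately show ?thesis unfolding E_def by (intro continuous_intros)
  qed
  \<comment> \<open>Multiplying by \<open>E ?y0\<close> treats both signs of the difference at
    once.\<close>
  have "open (?O \<inter> (\<lambda>y. E y * E ?y0) -` {0<..})"
    by (intro continuous_open_preimage overlap(1) c continuous_intros cont open_greaterThan)
  moreover have "?y0 \<in> ?O \<inter> (\<lambda>y. E y * E ?y0) -` {0<..}"
    using y0 E0 by (auto simp: zero_less_mult_iff)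
  ultimately have "\<exists>r>0. cball ?y0 r \<subseteq> ?O \<inter> (\<lambda>y. E y * E ?y0) -` {0<..}"
    unfolding open_contains_cball by blast
  then obtain r where r: "r > 0" "cball ?y0 r \<subseteq> ?O \<inter> (\<lambda>y. E y * E ?y0) -` {0<..}"
    by blast
  \<comment> \<open>With this matrix the kernel is positive exactly on the open ball of radius
    \<open>r\<close> about 0.\<close>
  define B :: "real^'n^'n" where "B = mat (1 / r\<^sup>2)"
  have qB: "quad B z = (norm z)\<^sup>2 / r\<^sup>2" for z
    by (simp add: quad_def B_def matrix_vector_mult_def mat_def inner_vec_def if_distrib[of "\<lambda>t. t * _"]
        power2_norm_eq_inner sum_divide_distrib cong: if_cong)
  have B: "transpose B = B" by (simp add: B_def transpose_mat)
  define \<psi> where "\<psi> = (\<lambda>y. bump B (- ?y0 + 1 *\<^sub>R y))"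
  have \<psi>C: "C1_on UNIV \<psi>" unfolding \<psi>_def by (rule C1_on_affine[OF C1_on_bump[OF B, of UNIV]]) simp
  have \<psi>0: "\<psi> y \<ge> 0" for y by (simp add: \<psi>_def bump_def)
  have nd: "norm (- ?y0 + 1 *\<^sub>R y) = dist ?y0 y" for y by (simp add: dist_norm norm_minus_commute)
  have \<psi>pos: "\<psi> y > 0" if "y \<in> ball ?y0 r" for y
  proof -
    have "(dist ?y0 y)\<^sup>2 < r\<^sup>2" using that r(1) by (intro power_strict_mono) auto
    then have "(dist ?y0 y)\<^sup>2 / r\<^sup>2 < 1" using r(1) by simp
    then show ?thesis
      unfolding \<psi>_def bump_def qB nd by (intro zero_less_power) (simp add: less_max_iff_disj)
  qed
  have \<psi>zero: "\<psi> y = 0" if "y \<notin> cball ?y0 r" for y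
  proof -
    have "r\<^sup>2 \<le> (dist ?y0 y)\<^sup>2" using that r(1) by (intro power_mono) auto
    then have "(dist ?y0 y)\<^sup>2 / r\<^sup>2 \<ge> 1" using r(1) by simp
    then show ?thesis unfolding \<psi>_def bump_def qB nd by simp
  qed
  define K where "K = inv_coord c ` cball ?y0 r"
  have ballO: "cball ?y0 r \<subseteq> ?O" using r(2) by blast
  have ballV: "cball ?y0 r \<subseteq> coord_image c" using ballO overlap(2)[OF c] by blast
  have cK: "coord c ` K = cball ?y0 r"
  proof -
    have "coord c (inv_coord c y) = y" if "y \<in> cball ?y0 r" for y using chart(6)[OF c(1)] that ballV by blast
    then show ?thesis unfolding K_def image_image by simp
  qed
  have "compact K" unfolding K_def
    using continuous_on_subset[OF chart(4)[OF c(1)] ballV] by (rule compact_continuous_image) simp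
  moreover have "K \<subseteq> dom_chart c" unfolding K_def using chart(7)[OF c(1)] ballV by blast
  moreover have "K \<subseteq> dom_chart c'" unfolding K_def using overlap(7)[OF c] ballO by blast
  ultimately have zero: "(\<integral>y. indicator (cball ?y0 r) y * (?w y * (E y * \<psi> y)) \<partial>lborel) = 0"
    using laplacian_chart_test[OF c f _ _ _ \<psi>C, of K] \<psi>zero unfolding cK E_def by blast
  let ?h = "\<lambda>y. indicator (cball ?y0 r) y * (?w y * (E y * \<psi> y) * E ?y0)"
  have "continuous_on (cball ?y0 r) (\<lambda>y. ?w y * (E y * \<psi> y) * E ?y0)"
    by (intro continuous_intros continuous_on_subset[OF C1_on_continuous[OF volume_density_C1[OF c(1)]] ballV]
        continuous_on_subset[OF cont ballO] continuous_on_subset[OF C1_on_continuous[OF \<psi>C]]) simp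
  then have int: "integrable lborel ?h" using borel_integrable_compact[OF compact_cball] by fastforce
  have nn: "?h y \<ge> 0" for y
  proof (cases "y \<in> cball ?y0 r")
    case True
    then have "E y * E ?y0 > 0" "?w y > 0" using r(2) volume_density_pos[OF c(1)] ballV by auto
    then have "?w y * \<psi> y * (E y * E ?y0) \<ge> 0" using \<psi>0[of y] by simp
    moreover have "?h y = ?w y * \<psi> y * (E y * E ?y0)" using True by simp
    ultimately show ?thesis by linarith
  qed simp
  have "(\<integral>y. ?h y \<partial>lborel) = (\<integral>y. indicator (cball ?y0 r) y * (?w y * (E y * \<psi> y)) * E ?y0 \<partial>lborel)"
    by (simp add: mult_ac)
  also have "\<dots> = 0" using zero by simp
  finally have "AE y in lborel. ?h y = 0"
    using integral_nonneg_eq_0_iff_AE[OF int] nn by simp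
  then have "AE y in lborel. y \<notin> ball ?y0 r"
  proof (rule AE_mp, intro AE_I2 impI)
    fix y assume "?h y = 0"
    show "y \<notin> ball ?y0 r"
    proof
      assume y: "y \<in> ball ?y0 r"
      then have "y \<in> cball ?y0 r" by auto
      then have "E y * E ?y0 > 0" "?w y > 0" using r(2) volume_density_pos[OF c(1)] ballV by auto
      then have "?w y * \<psi> y * (E y * E ?y0) > 0" using \<psi>pos[OF y] by simp
      moreover have "?h y = ?w y * \<psi> y * (E y * E ?y0)" using \<open>y \<in> cball ?y0 r\<close> by simp
      ultimately show False using \<open>?h y = 0\<close> by linarith
    qed
  qed
  then have "ball ?y0 r \<in> null_sets lborel"
    by (subst (asm) AE_iff_null_sets[symmetric]) auto
  then have "emeasure lborel (ball ?y0 r) = 0" by auto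
  then show False
    using r(1) unit_ball_vol_pos[of "real CARD('n)"] by (simp add: emeasure_ball)
qed

text \<open>Turns the eigenvalue equation into an equation in divergence form in any one chart, as
  the mean value estimate requires.\<close>

lemma laplace_beltrami_chart:
  assumes "c \<in> A" "smooth_function A f" "y \<in> coord_image c"
  shows "(\<Sum>i\<in>UNIV. partial_deriv i (flux g c f i) y) = volume_density g c y * laplace_beltrami A g f (inv_coord c y)"
proof -
  have "laplace_beltrami A g f (inv_coord c y) = laplacian_in_chart g c f (inv_coord c y)"
    unfolding laplace_beltrami_def
    using chart_at chart(7)[OF assms(1,3)] by (intro laplacian_chart_invariant assms) auto
  also have "\<dots> = (\<Sum>i\<in>UNIV. partial_deriv i (flux g c f i) y) / volume_density g c y"
    unfolding laplacian_in_chart_flux using chart(6)[OF assms(1,3)] by simp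
  finally show ?thesis using volume_density_pos[OF assms(1,3)] by simp
qed

end

subsection \<open>From eigenfunctions to coordinate balls\<close>

text \<open>Fubini, together with the symmetry of the relation
  \<open>y \<in> cball x R\<close>.\<close>

lemma nn_integral_cball_swap:
  fixes \<sigma> :: "(real^'n::finite) measure" and h :: "real^'n \<Rightarrow> ennreal"
  assumes "finite_measure \<sigma>" and sets[measurable_cong]: "sets \<sigma> = sets borel" and [measurable]: "h \<in> borel_measurable borel"
  shows "(\<integral>\<^sup>+x. (\<integral>\<^sup>+y\<in>cball x R. h y \<partial>lborel) \<partial>\<sigma>) = (\<integral>\<^sup>+y. h y * emeasure \<sigma> (cball y R) \<partial>lborel)"
proof -
  interpret finite_measure \<sigma> by fact
  interpret pair_sigma_finite \<sigma> "lborel :: (real^'n) measure" ..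
  have [measurable]: "{p :: (real^'n) \<times> (real^'n). dist (fst p) (snd p) \<le> R} \<in> sets (borel \<Otimes>\<^sub>M borel)"
  proof -
    have "closed {p :: (real^'n) \<times> (real^'n). dist (fst p) (snd p) \<le> R}"
      by (intro closed_Collect_le continuous_intros)
    then have "{p :: (real^'n) \<times> (real^'n). dist (fst p) (snd p) \<le> R} \<in> sets borel" by (rule borel_closed)
    then show ?thesis by (simp only: borel_prod)
  qed
  have m: "(\<lambda>(x, y). h y * indicator {p. dist (fst p) (snd p) \<le> R} (x, y)) \<in> borel_measurable (\<sigma> \<Otimes>\<^sub>M lborel)"
    by measurable
  have "(\<integral>\<^sup>+x. (\<integral>\<^sup>+y\<in>cball x R. h y \<partial>lborel) \<partial>\<sigma>)
      = (\<integral>\<^sup>+x. (\<integral>\<^sup>+y. h y * indicator {p. dist (fst p) (snd p) \<le> R} (x, y) \<partial>lborel) \<partial>\<sigma>)"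
    by (intro nn_integral_cong) (auto simp: indicator_def)
  also have "\<dots> = (\<integral>\<^sup>+y. (\<integral>\<^sup>+x. h y * indicator {p. dist (fst p) (snd p) \<le> R} (x, y) \<partial>\<sigma>) \<partial>lborel)"
    using Fubini'[OF m] by simp
  also have "\<dots> = (\<integral>\<^sup>+y. (\<integral>\<^sup>+x. h y * indicator (cball y R) x \<partial>\<sigma>) \<partial>lborel)"
    by (intro nn_integral_cong) (auto simp: indicator_def dist_commute)
  also have "\<dots> = (\<integral>\<^sup>+y. h y * emeasure \<sigma> (cball y R) \<partial>lborel)"
    by (intro nn_integral_cong nn_integral_cmult_indicator) (simp add: sets)
  finally show ?thesis .
qed

lemma measurable_emeasure_cball:
  fixes \<sigma> :: "(real^'n::finite) measure"
  assumes "finite_measure \<sigma>" and sets: "sets \<sigma> = sets borel"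
  shows "(\<lambda>y. emeasure \<sigma> (cball y r)) \<in> borel_measurable borel"
proof -
  interpret finite_measure \<sigma> by fact
  have "closed {p :: (real^'n) \<times> (real^'n). dist (fst p) (snd p) \<le> r}"
    by (intro closed_Collect_le continuous_intros)
  then have "{p :: (real^'n) \<times> (real^'n). dist (fst p) (snd p) \<le> r} \<in> sets borel" by (rule borel_closed)
  then have "{p :: (real^'n) \<times> (real^'n). dist (fst p) (snd p) \<le> r} \<in> sets (borel \<Otimes>\<^sub>M borel)"
    by (simp only: borel_prod)
  then have "{p :: (real^'n) \<times> (real^'n). dist (fst p) (snd p) \<le> r} \<in> sets (borel \<Otimes>\<^sub>M \<sigma>)"
    by (simp only: sets_pair_measure_cong[OF refl sets])
  from measurable_emeasure_Pair[OF this]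
  have "(\<lambda>y. emeasure \<sigma> (Pair y -` {p. dist (fst p) (snd p) \<le> r})) \<in> borel_measurable borel" .
  moreover have "Pair y -` {p. dist (fst p) (snd p) \<le> r} = cball y r" for y :: "real^'n" by auto
  ultimately show ?thesis by simp
qed

text \<open>AM-GM in the form \<open>h N \<le> t h\<^sup>2 + N\<^sup>2 / t\<close> with \<open>N y\<close> the mass of the ball around \<open>y\<close>.\<close>

lemma nn_integral_cball_le:
  fixes \<sigma> :: "(real^'n::finite) measure" and h :: "real^'n \<Rightarrow> real"
  assumes fin: "finite_measure \<sigma>" and sets[measurable_cong]: "sets \<sigma> = sets borel"
    and h[measurable]: "h \<in> borel_measurable borel" and h0: "\<And>y. h y \<ge> 0" and t: "t > 0" and R: "R > 0"
  shows "(\<integral>\<^sup>+x. (\<integral>\<^sup>+y\<in>cball x R. ennreal (h y) \<partial>lborel) \<partial>\<sigma>)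
    \<le> ennreal t * (\<integral>\<^sup>+y. ennreal ((h y)\<^sup>2) \<partial>lborel)
      + ennreal (1 / t) * (ennreal (unit_ball_vol (real CARD('n)) * R ^ CARD('n)) * (\<integral>\<^sup>+x. emeasure \<sigma> (cball x (2 * R)) \<partial>\<sigma>))"
proof -
  interpret finite_measure \<sigma> by fact
  let ?N = "\<lambda>y. measure \<sigma> (cball y R)"
  have em: "emeasure \<sigma> (cball y R) = ennreal (?N y)" for y by (simp add: emeasure_eq_measure)
  note Nmeas' = measurable_emeasure_cball[OF fin sets]
  have N[measurable]: "?N \<in> borel_measurable borel"
    unfolding measure_def using Nmeas'[of R] by measurable
  have "(\<integral>\<^sup>+x. (\<integral>\<^sup>+y\<in>cball x R. ennreal (h y) \<partial>lborel) \<partial>\<sigma>) = (\<integral>\<^sup>+y. ennreal (h y) * ennreal (?N y) \<partial>lborel)"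
    using nn_integral_cball_swap[OF fin sets, of "\<lambda>y. ennreal (h y)" R] by (simp add: em)
  also have "\<dots> \<le> (\<integral>\<^sup>+y. ennreal t * ennreal ((h y)\<^sup>2) + ennreal (1 / t) * (ennreal (?N y) * ennreal (?N y)) \<partial>lborel)"
  proof (rule nn_integral_mono)
    fix y
    have "2 * (h y * ?N y) \<le> 2 * (t * (h y)\<^sup>2 + 1 / t * (?N y * ?N y))"
    proof -
      have "(t * h y - ?N y)\<^sup>2 / t = (t * (h y)\<^sup>2 + 1 / t * (?N y * ?N y)) - 2 * (h y * ?N y)"
        using t by (simp add: power2_eq_square field_simps)
      moreover have "0 \<le> (t * h y - ?N y)\<^sup>2 / t" using t by simp
      ultimately have "2 * (h y * ?N y) \<le> t * (h y)\<^sup>2 + 1 / t * (?N y * ?N y)"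
        by (simp only: diff_ge_0_iff_ge)
      also have "\<dots> \<le> 2 * (t * (h y)\<^sup>2 + 1 / t * (?N y * ?N y))"
        using t unfolding mult_2 by (intro le_add_same_cancel1[THEN iffD2]) simp
      finally show ?thesis .
    qed
    then have "h y * ?N y \<le> t * (h y)\<^sup>2 + 1 / t * (?N y * ?N y)" by simp
    then have "ennreal (h y * ?N y) \<le> ennreal (t * (h y)\<^sup>2 + 1 / t * (?N y * ?N y))" by (rule ennreal_leI)
    then show "ennreal (h y) * ennreal (?N y) \<le> ennreal t * ennreal ((h y)\<^sup>2) + ennreal (1 / t) * (ennreal (?N y) * ennreal (?N y))"
      using t h0 by (simp add: ennreal_mult[symmetric] ennreal_plus[symmetric] del: ennreal_plus)
  qed
  also have "\<dots> = ennreal t * (\<integral>\<^sup>+y. ennreal ((h y)\<^sup>2) \<partial>lborel) + ennreal (1 / t) * (\<integral>\<^sup>+y. ennreal (?N y) * ennreal (?N y) \<partial>lborel)"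
    by (subst nn_integral_add) (auto simp: nn_integral_cmult)
  \<comment> \<open>One factor \<open>?N y\<close> is expanded again as an integral over
    \<open>\<sigma>\<close>. For \<open>y\<close> within \<open>R\<close> of \<open>x\<close> the
    other factor is at most the mass of the doubled ball about \<open>x\<close>, so the square
    becomes the mass of the pairs at distance at most \<open>2 * R\<close>.\<close>
  also have "(\<integral>\<^sup>+y. ennreal (?N y) * ennreal (?N y) \<partial>lborel)
      = (\<integral>\<^sup>+x. (\<integral>\<^sup>+y\<in>cball x R. ennreal (?N y) \<partial>lborel) \<partial>\<sigma>)"
    using nn_integral_cball_swap[OF fin sets, of "\<lambda>y. ennreal (?N y)" R] by (simp add: em)
  also have "\<dots> \<le> (\<integral>\<^sup>+x. ennreal (unit_ball_vol (real CARD('n)) * R ^ CARD('n)) * emeasure \<sigma> (cball x (2 * R)) \<partial>\<sigma>)"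
  proof (rule nn_integral_mono)
    fix x
    have "(\<integral>\<^sup>+y\<in>cball x R. ennreal (?N y) \<partial>lborel) \<le> (\<integral>\<^sup>+y. emeasure \<sigma> (cball x (2 * R)) * indicator (cball x R) y \<partial>lborel)"
    proof (rule nn_integral_mono)
      fix y
      show "ennreal (?N y) * indicator (cball x R) y \<le> emeasure \<sigma> (cball x (2 * R)) * indicator (cball x R) y"
      proof (cases "y \<in> cball x R")
        case True
        have "cball y R \<subseteq> cball x (2 * R)"
        proof
          fix z assume "z \<in> cball y R"
          then show "z \<in> cball x (2 * R)" using True dist_triangle[of x z y] by simp
        qed
        then show ?thesis unfolding em[symmetric] by (intro mult_right_mono emeasure_mono) (auto simp: sets)
      qed simp
    qed
    also have "\<dots> = emeasure \<sigma> (cball x (2 * R)) * emeasure lborel (cball x R)"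
      by (subst nn_integral_cmult_indicator) auto
    also have "\<dots> = ennreal (unit_ball_vol (real CARD('n)) * R ^ CARD('n)) * emeasure \<sigma> (cball x (2 * R))"
      using R by (simp add: emeasure_cball mult.commute)
    finally show "(\<integral>\<^sup>+y\<in>cball x R. ennreal (?N y) \<partial>lborel)
        \<le> ennreal (unit_ball_vol (real CARD('n)) * R ^ CARD('n)) * emeasure \<sigma> (cball x (2 * R))" .
  qed
  also have "\<dots> = ennreal (unit_ball_vol (real CARD('n)) * R ^ CARD('n)) * (\<integral>\<^sup>+x. emeasure \<sigma> (cball x (2 * R)) \<partial>\<sigma>)"
    using Nmeas' by (intro nn_integral_cmult) (simp add: measurable_cong_sets[OF sets refl])
  finally show ?thesis by (meson add_left_mono mult_left_mono zero_le)
qed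

lemma transpose_matrix_inv:
  fixes G :: "real^'n::finite^'n"
  assumes "transpose G = G" "det G \<noteq> 0"
  shows "transpose (matrix_inv G) = matrix_inv G"
proof -
  have "G ** transpose (matrix_inv G) = transpose (matrix_inv G ** G)"
    by (simp add: matrix_transpose_mul assms(1))
  also have "\<dots> = mat 1" by (simp add: matrix_inv_mult(2)[OF assms(2)] transpose_mat)
  finally have "matrix_inv G ** (G ** transpose (matrix_inv G)) = matrix_inv G" by simp
  then show ?thesis unfolding matrix_mul_assoc matrix_inv_mult(2)[OF assms(2)] by simp
qed

text \<open>For eigenfunctions \<open>e j\<close>, the \<open>m\<close>-th power of minus the
  Laplacian divided by the square of \<open>\<Lambda>\<close>, applied to the sum with coefficients
  \<open>a\<close>.\<close>

definition eigen_sum :: "(nat \<Rightarrow> real) \<Rightarrow> (nat \<Rightarrow> 'm \<Rightarrow> real) \<Rightarrow> nat set \<Rightarrow> (nat \<Rightarrow> real) \<Rightarrow> real \<Rightarrow> nat \<Rightarrow> 'm \<Rightarrow> real"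
  where "eigen_sum lam e J a \<Lambda> m p = (\<Sum>j\<in>J. a j * (lam j / \<Lambda>) ^ (2 * m) * e j p)"

context riemannian
begin

text \<open>Here \<open>- \<Delta> (eigen_sum \<dots> m) = \<Lambda>\<^sup>2 eigen_sum \<dots> (m + 1)\<close>, which feeds the absorption argument.\<close>

lemma eigen_sum_pointwise:
  assumes c: "c \<in> A" and ball: "cball x0 (2 * r0) \<subseteq> coord_image c" and r0: "r0 > 0"
  obtains C \<kappa> where "C > 0" "\<kappa> > 0" "\<kappa> \<le> r0 / 2"
    "\<And>lam e J a \<Lambda> x Bd k. (\<And>j. smooth_function A (e j)) \<Longrightarrow> (\<And>j p. - laplace_beltrami A g (e j) p = (lam j)\<^sup>2 * e j p) \<Longrightarrow>
      finite J \<Longrightarrow> \<Lambda> \<ge> 1 \<Longrightarrow> (\<And>m p. \<bar>eigen_sum lam e J a \<Lambda> m p\<bar> \<le> Bd) \<Longrightarrow> x \<in> cball x0 (r0 / 2) \<Longrightarrow>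
      \<bar>eigen_sum lam e J a \<Lambda> 0 (inv_coord c x)\<bar> \<le> C *
        (\<Sum>m<k. (1/2) ^ m * integral\<^sup>L lborel (\<lambda>y. indicator (cball x (\<kappa> / \<Lambda>)) y * \<bar>eigen_sum lam e J a \<Lambda> m (inv_coord c y)\<bar>))
          / (\<kappa> / \<Lambda>) ^ CARD('n) + (1/2) ^ k * Bd"
proof -
  let ?V = "coord_image c" and ?w = "volume_density g c" and ?n = "CARD('n)"
  let ?G = "\<lambda>y. g c (inv_coord c y)"
  \<comment> \<open>With these coefficients the field in \<open>uniform_mean_estimate\<close> is the
    flux, and its divergence is \<open>?w\<close> times the Laplacian.\<close>
  define b where "b = (\<lambda>i j y. ?w y * matrix_inv (?G y) $ i $ j)"
  have bC: "C1_on ?V (b i j)" for i j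
    unfolding b_def by (intro C1_on_mult volume_density_C1 inv_gram_C1 c)
  have bsym: "b i j y = b j i y" if "y \<in> ?V" for i j y
  proof -
    have "det (?G y) \<noteq> 0" using det_gram_pos[OF c that] by simp
    from arg_cong[OF transpose_matrix_inv[OF gram(2)[OF c that] this], of "\<lambda>M. M $ i $ j"]
    have "matrix_inv (?G y) $ i $ j = matrix_inv (?G y) $ j $ i" by (simp add: transpose_def)
    then show ?thesis by (simp add: b_def)
  qed
  have bG: "(\<Sum>j\<in>UNIV. b i j y * (?G y *v z) $ j) = ?w y * z $ i" if "y \<in> ?V" for i y z
  proof -
    have "det (?G y) \<noteq> 0" using det_gram_pos[OF c that] by simp
    then have "matrix_inv (?G y) *v (?G y *v z) = z" by (simp add: matrix_vector_mul_assoc matrix_inv_mult)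
    then have "(\<Sum>j\<in>UNIV. matrix_inv (?G y) $ i $ j * (?G y *v z) $ j) = z $ i"
      by (metis (no_types, lifting) matrix_vector_mult_def sum.cong vec_lambda_beta)
    then show ?thesis by (simp add: b_def sum_distrib_left[symmetric] mult.assoc)
  qed
  obtain C where C: "C > 0" and est: "\<And>x r h S T. x \<in> cball x0 r0 \<Longrightarrow> 0 < r \<Longrightarrow> r \<le> r0 \<Longrightarrow> C1_on ?V h \<Longrightarrow>
      (\<And>j. C1_on ?V (\<lambda>y. \<Sum>i\<in>UNIV. b j i y * partial_deriv i h y)) \<Longrightarrow>
      (\<And>y. y \<in> cball x r \<Longrightarrow> \<bar>h y\<bar> \<le> S) \<Longrightarrow>
      (\<And>y. y \<in> cball x r \<Longrightarrow>
         \<bar>\<Sum>j\<in>UNIV. partial_deriv j (\<lambda>y. \<Sum>i\<in>UNIV. b j i y * partial_deriv i h y) y\<bar> \<le> ?w y * T) \<Longrightarrow>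
      \<bar>h x\<bar> \<le> C * (integral\<^sup>L lborel (\<lambda>y. indicator (cball x r) y * \<bar>h y\<bar>) / r ^ ?n + r * (S + r * T))"
    using uniform_mean_estimate[OF chart(2)[OF c] ball r0 gram_continuous[OF c] gram(2,3)[OF c] bC bsym
        C1_on_continuous[OF volume_density_C1[OF c]] volume_density_pos[OF c] bG] by blast
  \<comment> \<open>The bound 1 gives \<open>\<kappa> * \<kappa> \<le> \<kappa>\<close>, the bound
    \<open>r0 / 2\<close> keeps balls about points of \<open>cball x0 (r0 / 2)\<close> inside
    \<open>cball x0 r0\<close>, and the last bound provides both smallness conditions of
    \<open>weighted_absorption\<close>.\<close>
  define \<kappa> where "\<kappa> = min 1 (min (r0 / 2) (1 / (4 * (C * 2 ^ ?n))))"
  have \<kappa>: "\<kappa> > 0" "\<kappa> \<le> 1" "\<kappa> \<le> r0 / 2" "\<kappa> \<le> 1 / (4 * (C * 2 ^ ?n))"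
    using C r0 by (auto simp: \<kappa>_def)
  have \<kappa>C: "C * 2 ^ ?n * \<kappa> \<le> 1 / 4" using \<kappa>(4) C by (simp add: field_simps)
  show ?thesis
  proof (rule that[of "2 * C * 2 ^ ?n" \<kappa>])
    show "2 * C * 2 ^ ?n > 0" "\<kappa> > 0" "\<kappa> \<le> r0 / 2" using C \<kappa> by auto
    fix lam e J a \<Lambda> x Bd and k :: nat
    assume e: "\<And>j. smooth_function A (e j)" and eig: "\<And>j p. - laplace_beltrami A g (e j) p = (lam j)\<^sup>2 * e j p"
      and J: "finite J" and \<Lambda>: "\<Lambda> \<ge> (1::real)" and Bd: "\<And>m p. \<bar>eigen_sum lam e J a \<Lambda> m p\<bar> \<le> Bd"
      and x: "x \<in> cball x0 (r0 / 2)"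
    define F where "F = (\<lambda>m y. eigen_sum lam e J a \<Lambda> m (inv_coord c y))"
    define co where "co = (\<lambda>m j. a j * (lam j / \<Lambda>) ^ (2 * m))"
    have F: "F m = (\<lambda>y. \<Sum>j\<in>J. co m j * (e j \<circ> inv_coord c) y)" for m
      by (simp add: F_def eigen_sum_def co_def)
    have FC: "C1_on ?V (F m)" for m
      unfolding F by (intro C1_on_sum C1_on_mult C1_on_const smooth_function_chart(1)[OF e c])
    have ediff: "(\<lambda>y. co m j * (e j \<circ> inv_coord c) y) differentiable (at y)" if "y \<in> ?V" for m j y
      using C1_on_differentiable[OF C1_on_mult[OF C1_on_const smooth_function_chart(1)[OF e c]] that] .
    have pF: "partial_deriv i (F m) y = (\<Sum>j\<in>J. co m j * partial_deriv i (e j \<circ> inv_coord c) y)" if "y \<in> ?V" for m i y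
      unfolding F using ediff[OF that] C1_on_differentiable[OF smooth_function_chart(1)[OF e c] that] J
      by (subst partial_deriv_sum) (auto simp: partial_deriv_mult simp del: o_apply)
    have X: "(\<Sum>i\<in>UNIV. b k i y * partial_deriv i (F m) y) = (\<Sum>j\<in>J. co m j * flux g c (e j) k y)" if "y \<in> ?V" for m k y
      unfolding pF[OF that] flux_def b_def sum_distrib_left by (subst sum.swap) (simp add: mult_ac)
    have XC': "C1_on ?V (\<lambda>y. \<Sum>j\<in>J. co m j * flux g c (e j) k y)" for m k
      by (intro C1_on_sum C1_on_mult C1_on_const flux_C1 e c)
    have XC: "C1_on ?V (\<lambda>y. \<Sum>i\<in>UNIV. b k i y * partial_deriv i (F m) y)" for m k
      by (rule C1_on_cong_open[OF XC' chart(2)[OF c]]) (simp add: X)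
    have div: "(\<Sum>k\<in>UNIV. partial_deriv k (\<lambda>y. \<Sum>i\<in>UNIV. b k i y * partial_deriv i (F m) y) y)
        = - (?w y * (\<Lambda>\<^sup>2 * F (Suc m) y))" if y: "y \<in> ?V" for m y
    proof -
      have fd: "(\<lambda>y. co m j * flux g c (e j) k y) differentiable (at y)" for j k
        using C1_on_differentiable[OF C1_on_mult[OF C1_on_const flux_C1[OF e c]] y] .
      have "partial_deriv k (\<lambda>y. \<Sum>i\<in>UNIV. b k i y * partial_deriv i (F m) y) y
          = (\<Sum>j\<in>J. co m j * partial_deriv k (flux g c (e j) k) y)" for k
      proof -
        have "partial_deriv k (\<lambda>y. \<Sum>i\<in>UNIV. b k i y * partial_deriv i (F m) y) y
            = partial_deriv k (\<lambda>y. \<Sum>j\<in>J. co m j * flux g c (e j) k y) y"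
          by (rule partial_deriv_cong_open[OF chart(2)[OF c] y]) (rule X)
        also have "\<dots> = (\<Sum>j\<in>J. co m j * partial_deriv k (flux g c (e j) k) y)"
          using fd J C1_on_differentiable[OF flux_C1[OF e c] y]
          by (subst partial_deriv_sum) (auto simp: partial_deriv_mult)
        finally show ?thesis .
      qed
      then have "(\<Sum>k\<in>UNIV. partial_deriv k (\<lambda>y. \<Sum>i\<in>UNIV. b k i y * partial_deriv i (F m) y) y)
          = (\<Sum>k\<in>UNIV. \<Sum>j\<in>J. co m j * partial_deriv k (flux g c (e j) k) y)" by simp
      also have "\<dots> = (\<Sum>j\<in>J. co m j * (\<Sum>k\<in>UNIV. partial_deriv k (flux g c (e j) k) y))"
        by (subst sum.swap) (simp add: sum_distrib_left)
      also have "\<dots> = (\<Sum>j\<in>J. - (?w y * (\<Lambda>\<^sup>2 * (co (Suc m) j * (e j \<circ> inv_coord c) y))))"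
      proof (rule sum.cong[OF refl])
        fix j
        have "(\<Sum>k\<in>UNIV. partial_deriv k (flux g c (e j) k) y) = - (?w y * ((lam j)\<^sup>2 * e j (inv_coord c y)))"
          unfolding laplace_beltrami_chart[OF c e y] using eig[of j "inv_coord c y"]
          by (simp add: minus_equation_iff[of "laplace_beltrami _ _ _ _"] eq_commute)
        moreover have "co m j * (lam j)\<^sup>2 = \<Lambda>\<^sup>2 * co (Suc m) j"
          using \<Lambda> by (simp add: co_def power_divide power2_eq_square)
        ultimately show "co m j * (\<Sum>k\<in>UNIV. partial_deriv k (flux g c (e j) k) y)
            = - (?w y * (\<Lambda>\<^sup>2 * (co (Suc m) j * (e j \<circ> inv_coord c) y)))"
          by (simp add: algebra_simps)
      qed
      also have "\<dots> = - (?w y * (\<Lambda>\<^sup>2 * F (Suc m) y))"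
        by (simp add: F sum_negf sum_distrib_left)
      finally show ?thesis .
    qed
    let ?R = "\<kappa> / \<Lambda>"
    have R: "?R > 0" "?R \<le> \<kappa>" using \<kappa> \<Lambda> by (auto simp: divide_le_eq mult_le_cancel_left1)
    have near: "y \<in> cball x0 r0" if "y \<in> cball x ?R" for y
      using that x dist_triangle[of x0 y x] R \<kappa>(3) by auto
    have nearV: "cball x ?R \<subseteq> ?V" using near ball r0 by force
    have "\<bar>F 0 x\<bar> \<le> 2 * C * 2 ^ ?n *
      (\<Sum>m<k. (1/2) ^ m * integral\<^sup>L lborel (\<lambda>y. indicator (cball x ?R) y * \<bar>F m y\<bar>)) / ?R ^ ?n + (1/2) ^ k * Bd"
    proof (rule weighted_absorption[where L = "\<Lambda>\<^sup>2"])
      show "continuous_on (cball x ?R) (F m)" for m by (rule continuous_on_subset[OF C1_on_continuous[OF FC] nearV])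
      show "\<bar>F m y\<bar> \<le> Bd" for m y unfolding F_def by (rule Bd)
      have "C * 2 ^ ?n * ?R \<le> C * 2 ^ ?n * \<kappa>" using C R by (intro mult_left_mono) auto
      then show "C * 2 ^ ?n * ?R \<le> 1 / 4" using \<kappa>C by linarith
      have "?R * ?R * \<Lambda>\<^sup>2 = \<kappa> * \<kappa>" using \<Lambda> by (simp add: power2_eq_square)
      also have "\<dots> \<le> \<kappa> * 1" using \<kappa> by (intro mult_left_mono) auto
      finally have "C * 2 ^ ?n * (?R * ?R * \<Lambda>\<^sup>2) \<le> C * 2 ^ ?n * \<kappa>" using C by (intro mult_left_mono) auto
      then show "C * 2 ^ ?n * (?R * ?R * \<Lambda>\<^sup>2) \<le> 1 / 4" using \<kappa>C by linarith
      fix m z r S T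
      assume z: "z \<in> cball x ?R" and r: "0 < r" "r \<le> ?R" "cball z r \<subseteq> cball x ?R"
        and S: "\<And>y. y \<in> cball z r \<Longrightarrow> \<bar>F m y\<bar> \<le> S" and T: "\<And>y. y \<in> cball z r \<Longrightarrow> \<bar>F (Suc m) y\<bar> \<le> T"
      show "\<bar>F m z\<bar> \<le> C * (integral\<^sup>L lborel (\<lambda>y. indicator (cball z r) y * \<bar>F m y\<bar>) / r ^ ?n
                 + r * (S + r * (\<Lambda>\<^sup>2 * T)))"
      proof (rule est[OF near[OF z] r(1) _ FC XC S])
        show "r \<le> r0" using r R \<kappa>(3) r0 by linarith
        fix y assume y: "y \<in> cball z r"
        have yV: "y \<in> ?V" using y r(3) nearV by blast
        have "\<bar>F (Suc m) y\<bar> * (?w y * \<Lambda>\<^sup>2) \<le> T * (?w y * \<Lambda>\<^sup>2)"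
          using volume_density_pos[OF c yV] by (intro mult_right_mono T[OF y]) auto
        then show "\<bar>\<Sum>j\<in>UNIV. partial_deriv j (\<lambda>y. \<Sum>i\<in>UNIV. b j i y * partial_deriv i (F m) y) y\<bar> \<le> ?w y * (\<Lambda>\<^sup>2 * T)"
          unfolding div[OF yV] using volume_density_pos[OF c yV] by (simp add: abs_mult mult_ac)
      qed auto
    qed (use C R in auto)
    then show "\<bar>eigen_sum lam e J a \<Lambda> 0 (inv_coord c x)\<bar> \<le> 2 * C * 2 ^ ?n *
        (\<Sum>m<k. (1/2) ^ m * integral\<^sup>L lborel (\<lambda>y. indicator (cball x (\<kappa> / \<Lambda>)) y * \<bar>eigen_sum lam e J a \<Lambda> m (inv_coord c y)\<bar>))
          / (\<kappa> / \<Lambda>) ^ ?n + (1/2) ^ k * Bd"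
      by (simp only: F_def)
  qed
qed

end

section \<open>Norms, distances and energies in one chart\<close>

lemma measurable_nn_integral_cball:
  fixes h :: "real^'n::finite \<Rightarrow> ennreal"
  assumes [measurable]: "h \<in> borel_measurable borel"
  shows "(\<lambda>x. \<integral>\<^sup>+y\<in>cball x R. h y \<partial>lborel) \<in> borel_measurable borel"
proof -
  have "closed {p :: (real^'n) \<times> (real^'n). dist (fst p) (snd p) \<le> R}"
    by (intro closed_Collect_le continuous_intros)
  then have "{p :: (real^'n) \<times> (real^'n). dist (fst p) (snd p) \<le> R} \<in> sets borel" by (rule borel_closed)
  then have [measurable]: "{p :: (real^'n) \<times> (real^'n). dist (fst p) (snd p) \<le> R} \<in> sets (borel \<Otimes>\<^sub>M borel)"
    by (simp only: borel_prod)
  have "(\<lambda>x. \<integral>\<^sup>+y. h y * indicator {p. dist (fst p) (snd p) \<le> R} (x, y) \<partial>lborel) \<in> borel_measurable borel"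
    by measurable
  moreover have "(\<integral>\<^sup>+y. h y * indicator {p. dist (fst p) (snd p) \<le> R} (x, y) \<partial>lborel) = (\<integral>\<^sup>+y\<in>cball x R. h y \<partial>lborel)" for x
    by (intro nn_integral_cong) (auto simp: indicator_def)
  ultimately show ?thesis by simp
qed

text \<open>Products of two basis functions are integrable, being dominated by the sum of their
  squares; after expanding the square only the diagonal terms survive.\<close>

lemma orthonormal_sum_square:
  fixes e :: "nat \<Rightarrow> 'm \<Rightarrow> real"
  assumes sq: "\<And>j. square_integrable \<nu> (e j)"
    and orth: "\<And>i j. L2_inner \<nu> (e i) (e j) = (if i = j then 1 else 0)" and J: "finite J"
  shows "(\<integral>\<^sup>+p. ennreal ((\<Sum>j\<in>J. b j * e j p)\<^sup>2) \<partial>\<nu>) = ennreal (\<Sum>j\<in>J. (b j)\<^sup>2)"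
proof -
  have meas: "e j \<in> borel_measurable \<nu>" and int2: "integrable \<nu> (\<lambda>p. (e j p)\<^sup>2)" for j
    using sq[of j] by (auto simp: square_integrable_def)
  have int: "integrable \<nu> (\<lambda>p. e i p * e j p)" for i j
  proof (rule Bochner_Integration.integrable_bound)
    show "integrable \<nu> (\<lambda>p. (e i p)\<^sup>2 + (e j p)\<^sup>2)" by (intro Bochner_Integration.integrable_add int2)
    have "norm (e i p * e j p) \<le> norm ((e i p)\<^sup>2 + (e j p)\<^sup>2)" for p
    proof -
      have "2 * \<bar>e i p * e j p\<bar> \<le> (e i p)\<^sup>2 + (e j p)\<^sup>2"
        using zero_le_power2[of "\<bar>e i p\<bar> - \<bar>e j p\<bar>"] by (simp add: power2_diff abs_mult)
      moreover have "0 \<le> \<bar>e i p * e j p\<bar>" by simp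
      ultimately show ?thesis unfolding real_norm_def by linarith
    qed
    then show "AE p in \<nu>. norm (e i p * e j p) \<le> norm ((e i p)\<^sup>2 + (e j p)\<^sup>2)" by simp
  qed (intro borel_measurable_times meas)
  have sq_eq: "(\<Sum>j\<in>J. b j * e j p)\<^sup>2 = (\<Sum>i\<in>J. \<Sum>j\<in>J. b i * b j * (e i p * e j p))" for p
    by (simp add: power2_eq_square sum_product mult_ac)
  have int_sq: "integrable \<nu> (\<lambda>p. (\<Sum>j\<in>J. b j * e j p)\<^sup>2)"
    unfolding sq_eq by (intro Bochner_Integration.integrable_sum integrable_mult_right int)
  have "(\<integral>p. (\<Sum>j\<in>J. b j * e j p)\<^sup>2 \<partial>\<nu>) = (\<Sum>i\<in>J. \<Sum>j\<in>J. b i * b j * L2_inner \<nu> (e i) (e j))"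
    unfolding sq_eq L2_inner_def
    by (subst Bochner_Integration.integral_sum, intro Bochner_Integration.integrable_sum integrable_mult_right int)
       (intro sum.cong refl, subst Bochner_Integration.integral_sum, auto intro: int)
  also have "\<dots> = (\<Sum>j\<in>J. (b j)\<^sup>2)"
    using J by (simp add: orth power2_eq_square if_distrib[of "(*) _"] sum.delta cong: if_cong)
  finally show ?thesis using nn_integral_eq_integral[OF int_sq] by simp
qed

context riemannian
begin

lemma smooth_function_continuous:
  assumes f: "smooth_function A f"
  shows "continuous_on UNIV f"
proof -
  have "continuous_on (dom_chart c) f" if c: "c \<in> A" for c
  proof -
    have "continuous_on (dom_chart c) (\<lambda>p. (f \<circ> inv_coord c) (coord c p))"
      by (rule continuous_on_compose2[OF C1_on_continuous[OF smooth_function_chart(1)[OF f c]] chart(3)[OF c]]) simp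
    then show ?thesis by (rule continuous_on_eq) (use chart(5)[OF c] in simp)
  qed
  then have "continuous_on (\<Union>c\<in>A. dom_chart c) f"
    by (intro continuous_on_open_UN chart(1)) auto
  moreover have "(\<Union>c\<in>A. dom_chart c) = UNIV" using charts_cover by blast
  ultimately show ?thesis by simp
qed

text \<open>Balls are convex, so the segment between two points stays where the Gram matrix is
  bounded. The resulting upper bound on the distance makes the Riesz kernel large on pairs that are
  close in coordinates.\<close>

lemma chart_metric_bound:
  assumes c: "c \<in> A" and ball: "cball x0 r \<subseteq> coord_image c"
  obtains N where "N > 0" "\<And>x y. x \<in> cball x0 r \<Longrightarrow> y \<in> cball x0 r \<Longrightarrow>
    0 \<le> riemannian_dist A g (inv_coord c x) (inv_coord c y) \<and>
    riemannian_dist A g (inv_coord c x) (inv_coord c y) \<le> N * dist x y"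
proof -
  let ?G = "\<lambda>y. g c (inv_coord c y)" and ?n = "real CARD('n)"
  have cG: "continuous_on (cball x0 r) ?G" using continuous_on_subset[OF gram_continuous[OF c] ball] .
  have cG': "continuous_on (cball x0 r) (\<lambda>y. ?G y $ i $ j)" for i j by (intro continuous_intros cG)
  obtain N where N: "N \<ge> 1" "\<And>p y. p \<in> UNIV \<Longrightarrow> y \<in> cball x0 r \<Longrightarrow> \<bar>?G y $ fst p $ snd p\<bar> \<le> N"
    using compact_uniform_bound[of "UNIV :: ('n \<times> 'n) set" "cball x0 r" "\<lambda>p y. ?G y $ fst p $ snd p"] cG'
    by auto
  \<comment> \<open>As \<open>N \<ge> 1\<close>, the square of \<open>N'\<close> dominates the crude
    factor \<open>?n\<^sup>2 * N\<close> in the bound of the quadratic form.\<close>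
  define N' where "N' = ?n * N"
  have N': "N' > 0" using N(1) by (simp add: N'_def)
  have q: "v \<bullet> (?G z *v v) \<le> N'\<^sup>2 * (norm v)\<^sup>2" if "z \<in> cball x0 r" for z v
  proof -
    have G: "\<bar>?G z $ i $ j\<bar> \<le> N" for i j using N(2)[OF UNIV_I that, of "(i, j)"] by simp
    have "\<bar>(?G z *v v) $ i\<bar> \<le> ?n * (N * norm v)" for i
      unfolding matrix_vector_mult_def vec_lambda_beta using G component_le_norm_cart[of v] N(1)
      by (intro abs_sum_le_card) (auto simp: abs_mult intro!: mult_mono)
    then have "\<bar>v \<bullet> (?G z *v v)\<bar> \<le> ?n * (norm v * (?n * (N * norm v)))"
      unfolding inner_vec_def inner_real_def using component_le_norm_cart[of v]
      by (intro abs_sum_le_card) (auto simp: abs_mult intro!: mult_mono)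
    also have "\<dots> = ?n\<^sup>2 * N * (norm v)\<^sup>2" by (simp add: power2_eq_square mult_ac)
    also have "\<dots> \<le> ?n\<^sup>2 * N\<^sup>2 * (norm v)\<^sup>2"
      using N(1) by (intro mult_right_mono mult_left_mono) (auto simp: power2_eq_square)
    finally show ?thesis by (simp add: N'_def power_mult_distrib)
  qed
  show ?thesis
  proof (rule that[OF N'])
    fix x y assume "x \<in> cball x0 r" "y \<in> cball x0 r"
    then have seg: "closed_segment x y \<subseteq> cball x0 r" by (intro closed_segment_subset convex_cball)
    then have segV: "closed_segment x y \<subseteq> coord_image c" using ball by blast
    have "v \<bullet> (g c (inv_coord c z) *v v) \<le> N'\<^sup>2 * (norm v)\<^sup>2" if "z \<in> closed_segment x y" for z v
      by (rule q[OF subsetD[OF seg that]])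
    then show "0 \<le> riemannian_dist A g (inv_coord c x) (inv_coord c y) \<and>
      riemannian_dist A g (inv_coord c x) (inv_coord c y) \<le> N' * dist x y"
      using riemannian_dist_segment[OF riemannian c segV less_imp_le[OF N']] by blast
  qed
qed

lemma eigen_sum_continuous:
  assumes "\<And>j. smooth_function A (e j)"
  shows "continuous_on UNIV (eigen_sum lam e J a \<Lambda> m)"
  unfolding eigen_sum_def[abs_def] by (intro continuous_intros smooth_function_continuous assms)

text \<open>The reciprocal of the volume density is bounded on the compact ball, so there Lebesgue
  integrals of squares are dominated by Riemannian ones.\<close>

lemma chart_square_integral_le:
  assumes c: "c \<in> A" and ball: "cball x0 r \<subseteq> coord_image c"
  obtains W where "W > 0" "\<And>f. continuous_on UNIV f \<Longrightarrow>
    (\<integral>\<^sup>+y\<in>cball x0 r. ennreal ((f (inv_coord c y))\<^sup>2) \<partial>lborel) \<le> ennreal W * (\<integral>\<^sup>+p. ennreal ((f p)\<^sup>2) \<partial>vol)"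
proof -
  let ?w = "volume_density g c"
  have "continuous_on (cball x0 r) (\<lambda>y. 1 / ?w y)"
    using volume_density_pos[OF c] ball
    by (intro continuous_intros continuous_on_subset[OF C1_on_continuous[OF volume_density_C1[OF c]] ball]) force
  then obtain W where W: "W \<ge> 1" "\<And>y. y \<in> cball x0 r \<Longrightarrow> \<bar>1 / ?w y\<bar> \<le> W"
    using compact_uniform_bound[of "UNIV :: unit set" "cball x0 r" "\<lambda>_ y. 1 / ?w y"] by auto
  show ?thesis
  proof (rule that[of W])
    show "W > 0" using W by simp
    fix f :: "'m \<Rightarrow> real" assume f: "continuous_on UNIV f"
    have fm: "(\<lambda>p. ennreal ((f p)\<^sup>2)) \<in> borel_measurable borel"
      using borel_measurable_continuous_onI[OF f] by simp
    have "(\<integral>\<^sup>+y\<in>cball x0 r. ennreal ((f (inv_coord c y))\<^sup>2) \<partial>lborel)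
        \<le> (\<integral>\<^sup>+y. ennreal W * (ennreal (if y \<in> coord_image c then ?w y * (f (inv_coord c y))\<^sup>2 else 0)) \<partial>lborel)"
    proof (rule nn_integral_mono)
      fix y
      show "ennreal ((f (inv_coord c y))\<^sup>2) * indicator (cball x0 r) y
        \<le> ennreal W * (ennreal (if y \<in> coord_image c then ?w y * (f (inv_coord c y))\<^sup>2 else 0))"
      proof (cases "y \<in> cball x0 r")
        case True
        then have yV: "y \<in> coord_image c" using ball by blast
        have w: "?w y > 0" using volume_density_pos[OF c yV] .
        have "1 \<le> W * ?w y" using W(2)[OF True] w by (simp add: divide_le_eq)
        then have "1 * (f (inv_coord c y))\<^sup>2 \<le> W * ?w y * (f (inv_coord c y))\<^sup>2" by (intro mult_right_mono) auto
        then show ?thesis using True yV W(1) w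
          by (simp add: ennreal_mult[symmetric] mult.assoc ennreal_leI del: image_eqI)
      qed simp
    qed
    also have "\<dots> = ennreal W * (\<integral>\<^sup>+y. ennreal (if y \<in> coord_image c then ?w y * (f (inv_coord c y))\<^sup>2 else 0) \<partial>lborel)"
    proof (rule nn_integral_cmult)
      have "continuous_on (coord_image c) (\<lambda>y. ?w y * (f (inv_coord c y))\<^sup>2)"
        by (intro continuous_intros C1_on_continuous[OF volume_density_C1[OF c]]
            continuous_on_compose2[OF f chart(4)[OF c]]) simp
      then have "(\<lambda>y. if y \<in> coord_image c then ?w y * (f (inv_coord c y))\<^sup>2 else 0) \<in> borel_measurable borel"
        using chart(2)[OF c] by (intro borel_measurable_continuous_on_if) auto
      then show "(\<lambda>y. ennreal (if y \<in> coord_image c then ?w y * (f (inv_coord c y))\<^sup>2 else 0)) \<in> borel_measurable lborel"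
        by simp
    qed
    also have "(\<integral>\<^sup>+y. ennreal (if y \<in> coord_image c then ?w y * (f (inv_coord c y))\<^sup>2 else 0) \<partial>lborel)
        = (\<integral>\<^sup>+y\<in>coord_image c. ennreal (?w y) * ennreal ((f (inv_coord c y))\<^sup>2) \<partial>lborel)"
      using volume_density_pos[OF c]
      by (intro nn_integral_cong) (auto simp: indicator_def ennreal_mult less_imp_le)
    also have "\<dots> = (\<integral>\<^sup>+p\<in>dom_chart c. ennreal ((f p)\<^sup>2) \<partial>vol)"
      by (rule nn_integral_vol_chart[OF c fm, symmetric])
    also have "\<dots> \<le> (\<integral>\<^sup>+p. ennreal ((f p)\<^sup>2) \<partial>vol)"
      by (intro nn_integral_mono) (auto simp: indicator_def)
    finally show "(\<integral>\<^sup>+y\<in>cball x0 r. ennreal ((f (inv_coord c y))\<^sup>2) \<partial>lborel) \<le> ennreal W * (\<integral>\<^sup>+p. ennreal ((f p)\<^sup>2) \<partial>vol)"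
      by (meson mult_left_mono order_trans zero_le)
  qed
qed

text \<open>The part of \<open>\<mu>\<close> on one compact chart piece, carried to Euclidean space
  so that the estimates for coordinate balls apply. The value 0 off the chart domain makes the map
  Borel; the restricted measure has no mass there.\<close>

definition local_measure :: "('m, 'n) chart \<Rightarrow> (real^'n) set \<Rightarrow> 'm measure \<Rightarrow> (real^'n) measure"
  where "local_measure c K \<mu> = distr (density \<mu> (indicator (inv_coord c ` K))) borel
    (\<lambda>p. if p \<in> dom_chart c then coord c p else 0)"

lemma local_measure:
  assumes c: "c \<in> A" and K: "compact K" "K \<subseteq> coord_image c" and \<mu>: "finite_measure \<mu>" "sets \<mu> = sets borel"
  shows "finite_measure (local_measure c K \<mu>)" "sets (local_measure c K \<mu>) = sets borel"
    "\<And>f. f \<in> borel_measurable borel \<Longrightarrow>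
      (\<integral>\<^sup>+x. f x \<partial>local_measure c K \<mu>) = (\<integral>\<^sup>+p\<in>inv_coord c ` K. f (coord c p) \<partial>\<mu>)"
    "inv_coord c ` K \<in> sets borel"
proof -
  let ?D = "inv_coord c ` K" and ?\<phi> = "\<lambda>p. if p \<in> dom_chart c then coord c p else 0"
  have "compact ?D" using continuous_on_subset[OF chart(4)[OF c] K(2)] K(1) by (rule compact_continuous_image)
  then show D: "?D \<in> sets borel" by (simp add: compact_imp_closed borel_closed)
  have Dc: "?D \<subseteq> dom_chart c" using chart(7)[OF c] K(2) by blast
  have \<phi>: "?\<phi> \<in> borel_measurable borel"
    using chart(1,3)[OF c] by (intro borel_measurable_continuous_on_if) auto
  have \<phi>': "?\<phi> \<in> measurable (density \<mu> (indicator ?D)) borel"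
    using \<phi> by (simp add: measurable_cong_sets[OF \<mu>(2) refl])
  show "sets (local_measure c K \<mu>) = sets borel" by (simp add: local_measure_def)
  have ind: "indicator ?D \<in> borel_measurable \<mu>" using D \<mu>(2) by (intro borel_measurable_indicator) simp
  show nn: "(\<integral>\<^sup>+x. f x \<partial>local_measure c K \<mu>) = (\<integral>\<^sup>+p\<in>?D. f (coord c p) \<partial>\<mu>)"
    if f: "f \<in> borel_measurable borel" for f
  proof -
    have "(\<integral>\<^sup>+x. f x \<partial>local_measure c K \<mu>) = (\<integral>\<^sup>+p. f (?\<phi> p) \<partial>density \<mu> (indicator ?D))"
      unfolding local_measure_def using \<phi>' f by (subst nn_integral_distr) simp_all
    also have "\<dots> = (\<integral>\<^sup>+p. indicator ?D p * f (?\<phi> p) \<partial>\<mu>)"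
    proof (rule nn_integral_density[OF ind])
      have "(\<lambda>p. f (?\<phi> p)) \<in> borel_measurable borel" by (rule measurable_compose[OF \<phi> f])
      then show "(\<lambda>p. f (?\<phi> p)) \<in> borel_measurable \<mu>" by (simp add: measurable_cong_sets[OF \<mu>(2) refl])
    qed
    also have "\<dots> = (\<integral>\<^sup>+p\<in>?D. f (coord c p) \<partial>\<mu>)"
      using Dc by (intro nn_integral_cong) (auto simp: indicator_def)
    finally show ?thesis .
  qed
  show "finite_measure (local_measure c K \<mu>)"
  proof
    interpret finite_measure \<mu> by fact
    have "emeasure (local_measure c K \<mu>) (space (local_measure c K \<mu>)) = (\<integral>\<^sup>+x. 1 \<partial>local_measure c K \<mu>)"
      by simp
    also have "\<dots> = (\<integral>\<^sup>+p\<in>?D. 1 \<partial>\<mu>)" by (rule nn) simp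
    also have "\<dots> = emeasure \<mu> ?D" using D \<mu>(2) by simp
    finally show "emeasure (local_measure c K \<mu>) (space (local_measure c K \<mu>)) \<noteq> \<infinity>"
      using emeasure_finite by simp
  qed
qed

text \<open>A Chebyshev argument: on pairs whose coordinates are at distance at most
  \<open>r\<close>, the Riesz kernel is at least \<open>(N * r) powr (- u)\<close>. The kernel
  occurs only on the larger side of the comparison, where monotonicity of the nonnegative integral
  holds without measurability.\<close>

lemma local_measure_energy:
  assumes c: "c \<in> A" and K: "compact K" "K \<subseteq> coord_image c" and \<mu>: "finite_measure \<mu>" "sets \<mu> = sets borel"
    and N: "N > 0" "\<And>x y. x \<in> K \<Longrightarrow> y \<in> K \<Longrightarrow>
      0 \<le> riemannian_dist A g (inv_coord c x) (inv_coord c y) \<and>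
      riemannian_dist A g (inv_coord c x) (inv_coord c y) \<le> N * dist x y"
    and u: "u > 0" and r: "r > 0"
  shows "(\<integral>\<^sup>+x. emeasure (local_measure c K \<mu>) (cball x r) \<partial>local_measure c K \<mu>)
      \<le> ennreal ((N * r) powr u) * riesz_energy A g u \<mu>"
proof -
  let ?\<sigma> = "local_measure c K \<mu>" and ?D = "inv_coord c ` K" and ?E = "(N * r) powr u"
  note \<sigma> = local_measure[OF c K \<mu>]
  have E: "?E > 0" using N r by simp
  have cm: "(\<lambda>y. emeasure ?\<sigma> (cball y r)) \<in> borel_measurable borel"
    by (rule measurable_emeasure_cball[OF \<sigma>(1,2)])
  have cinv: "coord c p \<in> K" "inv_coord c (coord c p) = p" if "p \<in> ?D" for p
  proof -
    obtain y where y: "y \<in> K" "p = inv_coord c y" using \<open>p \<in> ?D\<close> by blast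
    then have "coord c p = y" using chart(6)[OF c] K(2) by auto
    with y show "coord c p \<in> K" "inv_coord c (coord c p) = p" by auto
  qed
  have key: "ennreal (1 / ?E) \<le> inverse (ennreal (riemannian_dist A g p q powr u))"
    if "p \<in> ?D" "q \<in> ?D" "dist (coord c p) (coord c q) \<le> r" for p q
  proof -
    have d: "0 \<le> riemannian_dist A g p q" "riemannian_dist A g p q \<le> N * dist (coord c p) (coord c q)"
      using N(2)[OF cinv(1)[OF that(1)] cinv(1)[OF that(2)]] cinv(2) that by auto
    have "N * dist (coord c p) (coord c q) \<le> N * r" using N(1) that(3) by simp
    then have "riemannian_dist A g p q powr u \<le> ?E" using d u by (intro powr_mono2) auto
    then show ?thesis
    \<comment> \<open>At distance 0 the kernel is infinite and the bound is trivial.\<close>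
    proof (cases "riemannian_dist A g p q powr u = 0")
      case False
      then have "riemannian_dist A g p q powr u > 0" by (simp add: order_less_le)
      then show ?thesis
        using \<open>_ \<le> ?E\<close> by (simp add: inverse_ennreal inverse_eq_divide ennreal_leI frac_le)
    qed simp
  qed
  have "ennreal (1 / ?E) * (\<integral>\<^sup>+x. emeasure ?\<sigma> (cball x r) \<partial>?\<sigma>)
      = (\<integral>\<^sup>+x. ennreal (1 / ?E) * emeasure ?\<sigma> (cball x r) \<partial>?\<sigma>)"
    using cm by (intro nn_integral_cmult[symmetric]) (simp add: measurable_cong_sets[OF \<sigma>(2) refl])
  also have "\<dots> = (\<integral>\<^sup>+p\<in>?D. ennreal (1 / ?E) * emeasure ?\<sigma> (cball (coord c p) r) \<partial>\<mu>)"
    using \<sigma>(3)[OF borel_measurable_times_ennreal[OF borel_measurable_const cm], of "ennreal (1 / ?E)"] .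
  also have "\<dots> \<le> (\<integral>\<^sup>+p. (\<integral>\<^sup>+q. inverse (ennreal (riemannian_dist A g p q powr u)) \<partial>\<mu>) \<partial>\<mu>)"
  proof (rule nn_integral_mono)
    fix p
    show "ennreal (1 / ?E) * emeasure ?\<sigma> (cball (coord c p) r) * indicator ?D p
        \<le> (\<integral>\<^sup>+q. inverse (ennreal (riemannian_dist A g p q powr u)) \<partial>\<mu>)"
    proof (cases "p \<in> ?D")
      case True
      have "ennreal (1 / ?E) * emeasure ?\<sigma> (cball (coord c p) r)
          = (\<integral>\<^sup>+x. ennreal (1 / ?E) * indicator (cball (coord c p) r) x \<partial>?\<sigma>)"
        by (subst nn_integral_cmult_indicator) (auto simp: \<sigma>(2))
      also have "\<dots> = (\<integral>\<^sup>+q\<in>?D. ennreal (1 / ?E) * indicator (cball (coord c p) r) (coord c q) \<partial>\<mu>)"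
      proof -
        have "(\<lambda>x. ennreal (1 / ?E) * indicator (cball (coord c p) r) x) \<in> borel_measurable borel"
          by (intro borel_measurable_times_ennreal borel_measurable_const borel_measurable_indicator
              borel_closed closed_cball)
        from \<sigma>(3)[OF this] show ?thesis .
      qed
      also have "\<dots> \<le> (\<integral>\<^sup>+q. inverse (ennreal (riemannian_dist A g p q powr u)) \<partial>\<mu>)"
        using key[OF True] by (intro nn_integral_mono) (auto simp: indicator_def)
      finally show ?thesis using True by simp
    qed simp
  qed
  also have "\<dots> = riesz_energy A g u \<mu>" by (simp add: riesz_energy_def)
  finally have "ennreal ?E * (ennreal (1 / ?E) * (\<integral>\<^sup>+x. emeasure ?\<sigma> (cball x r) \<partial>?\<sigma>)) \<le> ennreal ?E * riesz_energy A g u \<mu>"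
    by (rule mult_left_mono) simp
  moreover have "ennreal ?E * ennreal (1 / ?E) = 1" using E by (simp add: ennreal_mult[symmetric])
  ultimately show ?thesis by (simp add: mult.assoc[symmetric])
qed

end

lemma sum_half_powers_le: "(\<Sum>m<k. (1 / 2 :: real) ^ m) \<le> 2"
proof -
  have "(\<Sum>m<k. (1 / 2 :: real) ^ m) = 2 - 2 * (1 / 2) ^ k" by (induction k) auto
  then show ?thesis by simp
qed

lemma ennreal_mult_plus:
  "0 \<le> p \<Longrightarrow> 0 \<le> q \<Longrightarrow> 0 \<le> s \<Longrightarrow> ennreal (p * q + s) = ennreal p * ennreal q + ennreal s"
  by (simp add: ennreal_mult ennreal_plus)

context riemannian
begin

text \<open>The pointwise estimate is integrated over one chart piece, and
  \<open>nn_integral_cball_le\<close> treats each term. The constants are chosen before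
  \<open>lam\<close>, \<open>e\<close>, \<open>J\<close>, \<open>\<Lambda>\<close> and
  \<open>Bd\<close>, hence are uniform in them; \<open>\<tau>\<close> stays free until the pieces
  are added up.\<close>

lemma chart_energy_estimate:
  assumes c: "c \<in> A" and ball: "cball x0 (2 * r0) \<subseteq> coord_image c" and r0: "r0 > 0"
    and \<mu>: "finite_measure \<mu>" "sets \<mu> = sets borel" and u: "u > 0" and I: "riesz_energy A g u \<mu> < \<infinity>"
  obtains \<alpha> \<beta> where "\<alpha> \<ge> 0" "\<beta> \<ge> 0"
    "\<And>lam e J a \<Lambda> Bd k \<tau>. (\<And>j. smooth_function A (e j)) \<Longrightarrow>
      (\<And>j p. - laplace_beltrami A g (e j) p = (lam j)\<^sup>2 * e j p) \<Longrightarrow>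
      (\<And>j. square_integrable vol (e j)) \<Longrightarrow>
      (\<And>i j. L2_inner vol (e i) (e j) = (if i = j then 1 else 0)) \<Longrightarrow>
      finite J \<Longrightarrow> \<Lambda> \<ge> 1 \<Longrightarrow> (\<And>j. j \<in> J \<Longrightarrow> 0 \<le> lam j \<and> lam j \<le> \<Lambda>) \<Longrightarrow>
      (\<And>m p. \<bar>eigen_sum lam e J a \<Lambda> m p\<bar> \<le> Bd) \<Longrightarrow> \<tau> > 0 \<Longrightarrow>
      (\<integral>\<^sup>+p\<in>inv_coord c ` cball x0 (r0 / 2). ennreal \<bar>eigen_sum lam e J a \<Lambda> 0 p\<bar> \<partial>\<mu>)
        \<le> ennreal (\<alpha> * (\<tau> * (\<Sum>j\<in>J. (a j)\<^sup>2)) + \<beta> / \<tau> * \<Lambda> powr (real CARD('n) - u) + (1/2) ^ k * Bd * measure \<mu> UNIV)"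
proof -
  let ?n = "CARD('n)" and ?K = "cball x0 (r0 / 2)"
  let ?D = "inv_coord c ` ?K"
  have ball1: "cball x0 r0 \<subseteq> coord_image c" using ball subset_cball[of r0 "2 * r0" x0] r0 by auto
  have ball2: "?K \<subseteq> coord_image c" using ball1 subset_cball[of "r0 / 2" r0 x0] r0 by auto
  obtain C \<kappa> where C: "C > 0" and \<kappa>: "\<kappa> > 0" "\<kappa> \<le> r0 / 2" and
    est: "\<And>lam e J a \<Lambda> x Bd k. (\<And>j. smooth_function A (e j)) \<Longrightarrow> (\<And>j p. - laplace_beltrami A g (e j) p = (lam j)\<^sup>2 * e j p) \<Longrightarrow>
      finite J \<Longrightarrow> \<Lambda> \<ge> 1 \<Longrightarrow> (\<And>m p. \<bar>eigen_sum lam e J a \<Lambda> m p\<bar> \<le> Bd) \<Longrightarrow> x \<in> ?K \<Longrightarrow>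
      \<bar>eigen_sum lam e J a \<Lambda> 0 (inv_coord c x)\<bar> \<le> C *
        (\<Sum>m<k. (1/2) ^ m * integral\<^sup>L lborel (\<lambda>y. indicator (cball x (\<kappa> / \<Lambda>)) y * \<bar>eigen_sum lam e J a \<Lambda> m (inv_coord c y)\<bar>))
          / (\<kappa> / \<Lambda>) ^ ?n + (1/2) ^ k * Bd"
    by (rule eigen_sum_pointwise[OF c ball r0]) blast
  obtain W where W: "W > 0" "\<And>f. continuous_on UNIV f \<Longrightarrow>
    (\<integral>\<^sup>+y\<in>cball x0 r0. ennreal ((f (inv_coord c y))\<^sup>2) \<partial>lborel) \<le> ennreal W * (\<integral>\<^sup>+p. ennreal ((f p)\<^sup>2) \<partial>vol)"
    by (rule chart_square_integral_le[OF c ball1]) blast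
  obtain N where N: "N > 0" "\<And>x y. x \<in> ?K \<Longrightarrow> y \<in> ?K \<Longrightarrow>
      0 \<le> riemannian_dist A g (inv_coord c x) (inv_coord c y) \<and>
      riemannian_dist A g (inv_coord c x) (inv_coord c y) \<le> N * dist x y"
    by (rule chart_metric_bound[OF c ball2]) blast
  define I' where "I' = enn2real (riesz_energy A g u \<mu>)"
  have I': "riesz_energy A g u \<mu> = ennreal I'" "I' \<ge> 0" using I by (auto simp: I'_def)
  define \<omega> where "\<omega> = unit_ball_vol (real ?n)"
  have \<omega>: "\<omega> \<ge> 0" by (simp add: \<omega>_def)
  define \<sigma> where "\<sigma> = local_measure c ?K \<mu>"
  note \<sigma> = local_measure[OF c compact_cball ball2 \<mu>, folded \<sigma>_def]
  note energy = local_measure_energy[OF c compact_cball ball2 \<mu> N u, folded \<sigma>_def]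
  have spU: "space \<mu> = UNIV" using sets_eq_imp_space_eq[OF \<mu>(2)] by simp
  define \<alpha> where "\<alpha> = 2 * C * W"
  \<comment> \<open>Here the exponent of the theorem originates. With \<open>n\<close> the
    dimension, the prefactor R^-n, the weight 1/t of order R^-n, the ball volume R^n and the energy
    bound R^u combine to R^(u - n), and \<open>R = \<kappa> / \<Lambda>\<close>.\<close>
  define \<beta> where "\<beta> = 2 * C * \<omega> * I' * (2 * N) powr u * \<kappa> powr (u - real ?n)"
  show ?thesis
  proof (rule that[of \<alpha> \<beta>])
    show "\<alpha> \<ge> 0" "\<beta> \<ge> 0" using C W(1) \<omega> I' by (auto simp: \<alpha>_def \<beta>_def)
    fix lam e J a \<Lambda> Bd \<tau> and k :: nat
    assume e: "\<And>j. smooth_function A (e j)" and eig: "\<And>j p. - laplace_beltrami A g (e j) p = (lam j)\<^sup>2 * e j p"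
      and sq: "\<And>j. square_integrable vol (e j)" and orth: "\<And>i j. L2_inner vol (e i) (e j) = (if i = j then 1 else 0)"
      and J: "finite J" and \<Lambda>: "\<Lambda> \<ge> (1::real)" and lam: "\<And>j. j \<in> J \<Longrightarrow> 0 \<le> lam j \<and> lam j \<le> \<Lambda>"
      and Bd: "\<And>m p. \<bar>eigen_sum lam e J a \<Lambda> m p\<bar> \<le> Bd" and \<tau>: "\<tau> > (0::real)"
    define F where "F = eigen_sum lam e J a \<Lambda>"
    define S where "S = (\<Sum>j\<in>J. (a j)\<^sup>2)"
    define R where "R = \<kappa> / \<Lambda>"
    \<comment> \<open>This weight cancels the prefactor \<open>C / R ^ ?n\<close> in front of the
      L^2 term.\<close>
    define t where "t = \<tau> * R ^ ?n"
    \<comment> \<open>The cut-off outside the larger ball, which contains all integration balls,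
      makes \<open>h m\<close> Borel on the whole space.\<close>
    define h where "h = (\<lambda>m y. if y \<in> cball x0 r0 then \<bar>F m (inv_coord c y)\<bar> else 0)"
    define G where "G = (\<lambda>m x. \<integral>\<^sup>+y\<in>cball x R. ennreal (h m y) \<partial>lborel)"
    have R: "R > 0" "R \<le> \<kappa>" using \<kappa>(1) \<Lambda> by (auto simp: R_def divide_le_eq mult_le_cancel_left1)
    have t: "t > 0" using R(1) \<tau> by (simp add: t_def)
    have S0: "S \<ge> 0" by (simp add: S_def sum_nonneg)
    have Fc: "continuous_on UNIV (F m)" for m unfolding F_def by (rule eigen_sum_continuous[OF e])
    have Fic: "continuous_on (cball x0 r0) (\<lambda>y. \<bar>F m (inv_coord c y)\<bar>)" for m
      by (intro continuous_on_rabs continuous_on_compose2[OF Fc continuous_on_subset[OF chart(4)[OF c] ball1]]) simp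
    have hm: "h m \<in> borel_measurable borel" for m
      unfolding h_def using Fic by (intro borel_measurable_continuous_on_if) auto
    have h0: "h m y \<ge> 0" for m y by (simp add: h_def)
    have Gm: "G m \<in> borel_measurable borel" for m
      unfolding G_def using hm by (intro measurable_nn_integral_cball) simp
    have near: "cball x R \<subseteq> cball x0 r0" if "x \<in> ?K" for x
    proof
      fix y assume "y \<in> cball x R"
      then show "y \<in> cball x0 r0" using that R(2) \<kappa>(2) dist_triangle[of x0 y x] by auto
    qed
    have int: "ennreal (integral\<^sup>L lborel (\<lambda>y. indicator (cball x R) y * \<bar>F m (inv_coord c y)\<bar>)) = G m x"
      and int0: "integral\<^sup>L lborel (\<lambda>y. indicator (cball x R) y * \<bar>F m (inv_coord c y)\<bar>) \<ge> 0" if "x \<in> ?K" for m x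
    proof -
      let ?f = "\<lambda>y. indicator (cball x R) y * \<bar>F m (inv_coord c y)\<bar>"
      have "integrable lborel ?f"
        using borel_integrable_compact[OF compact_cball continuous_on_subset[OF Fic near[OF that]]] by simp
      then have "ennreal (integral\<^sup>L lborel ?f) = (\<integral>\<^sup>+y. ennreal (?f y) \<partial>lborel)"
        by (intro nn_integral_eq_integral[symmetric]) auto
      also have "\<dots> = G m x"
        unfolding G_def h_def using near[OF that]
        by (intro nn_integral_cong) (auto simp: indicator_def)
      finally show "ennreal (integral\<^sup>L lborel ?f) = G m x" .
      show "integral\<^sup>L lborel ?f \<ge> 0" by (rule integral_nonneg_AE) auto
    qed
    define X where "X = t * (W * S) + 1 / t * (\<omega> * R ^ ?n * ((N * (2 * R)) powr u * I'))"
    have X0: "X \<ge> 0" unfolding X_def using t W(1) S0 \<omega> R(1) I'(2) by simp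
    have GX: "(\<integral>\<^sup>+x. G m x \<partial>\<sigma>) \<le> ennreal X" for m
    proof -
      have "(\<integral>\<^sup>+x. G m x \<partial>\<sigma>) \<le> ennreal t * (\<integral>\<^sup>+y. ennreal ((h m y)\<^sup>2) \<partial>lborel)
          + ennreal (1 / t) * (ennreal (\<omega> * R ^ ?n) * (\<integral>\<^sup>+x. emeasure \<sigma> (cball x (2 * R)) \<partial>\<sigma>))"
        unfolding G_def \<omega>_def by (rule nn_integral_cball_le[OF \<sigma>(1,2) hm h0 t R(1)])
      also have "\<dots> \<le> ennreal t * (ennreal W * ennreal S)
          + ennreal (1 / t) * (ennreal (\<omega> * R ^ ?n) * (ennreal ((N * (2 * R)) powr u) * ennreal I'))"
      proof (intro add_mono mult_left_mono zero_le)
        have "(\<integral>\<^sup>+y. ennreal ((h m y)\<^sup>2) \<partial>lborel) = (\<integral>\<^sup>+y\<in>cball x0 r0. ennreal ((F m (inv_coord c y))\<^sup>2) \<partial>lborel)"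
          by (intro nn_integral_cong) (auto simp: h_def indicator_def)
        also have "\<dots> \<le> ennreal W * (\<integral>\<^sup>+p. ennreal ((F m p)\<^sup>2) \<partial>vol)" by (rule W(2)[OF Fc])
        also have "(\<integral>\<^sup>+p. ennreal ((F m p)\<^sup>2) \<partial>vol) = ennreal (\<Sum>j\<in>J. (a j * (lam j / \<Lambda>) ^ (2 * m))\<^sup>2)"
          unfolding F_def eigen_sum_def by (rule orthonormal_sum_square[OF sq orth J])
        also have "\<dots> \<le> ennreal S"
          unfolding S_def
        proof (intro ennreal_leI sum_mono)
          fix j assume "j \<in> J"
          then have "0 \<le> lam j / \<Lambda>" "lam j / \<Lambda> \<le> 1" using lam \<Lambda> by auto
          then have "(lam j / \<Lambda>) ^ (2 * m) \<le> 1" "0 \<le> (lam j / \<Lambda>) ^ (2 * m)"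
            by (simp_all only: power_le_one zero_le_power)
          then have "((lam j / \<Lambda>) ^ (2 * m))\<^sup>2 \<le> 1" by (simp only: power_le_one)
          then show "(a j * (lam j / \<Lambda>) ^ (2 * m))\<^sup>2 \<le> (a j)\<^sup>2"
            unfolding power_mult_distrib by (intro mult_left_le) auto
        qed
        finally show "(\<integral>\<^sup>+y. ennreal ((h m y)\<^sup>2) \<partial>lborel) \<le> ennreal W * ennreal S"
          by (simp add: mult_left_mono)
        show "(\<integral>\<^sup>+x. emeasure \<sigma> (cball x (2 * R)) \<partial>\<sigma>) \<le> ennreal ((N * (2 * R)) powr u) * ennreal I'"
          using energy[of "2 * R"] R(1) I'(1) by simp
      qed
      also have "\<dots> = ennreal X"
        unfolding X_def using t W(1) S0 \<omega> R(1) I'(2)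
        by (simp add: ennreal_mult[symmetric] ennreal_plus[symmetric] del: ennreal_plus)
      finally show ?thesis .
    qed
    define f where "f = (\<lambda>x. ennreal (C / R ^ ?n) * (\<Sum>m<k. ennreal ((1/2) ^ m) * G m x) + ennreal ((1/2) ^ k * Bd))"
    have fm: "f \<in> borel_measurable borel"
      unfolding f_def using Gm
      by (intro borel_measurable_add borel_measurable_times_ennreal borel_measurable_const borel_measurable_sum)
    have Bd0: "Bd \<ge> 0" using Bd[of 0 undefined] by (meson abs_ge_zero order_trans)
    have pointwise: "ennreal \<bar>F 0 p\<bar> \<le> f (coord c p)" if p: "p \<in> ?D" for p
    proof -
      obtain x where x: "x \<in> ?K" "p = inv_coord c x" using p by blast
      then have cp: "coord c p = x" using chart(6)[OF c] ball2 by auto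
      let ?i = "\<lambda>m. integral\<^sup>L lborel (\<lambda>y. indicator (cball x R) y * \<bar>F m (inv_coord c y)\<bar>)"
      have "\<bar>F 0 p\<bar> \<le> C * (\<Sum>m<k. (1/2) ^ m * ?i m) / R ^ ?n + (1/2) ^ k * Bd"
        using est[OF e eig J \<Lambda> Bd x(1), of k] unfolding x(2) F_def R_def .
      also have "C * (\<Sum>m<k. (1/2) ^ m * ?i m) / R ^ ?n = C / R ^ ?n * (\<Sum>m<k. (1/2) ^ m * ?i m)" by simp
      finally have "ennreal \<bar>F 0 p\<bar> \<le> ennreal (C / R ^ ?n * (\<Sum>m<k. (1/2) ^ m * ?i m) + (1/2) ^ k * Bd)"
        by (rule ennreal_leI)
      also have "\<dots> = ennreal (C / R ^ ?n) * ennreal (\<Sum>m<k. (1/2) ^ m * ?i m) + ennreal ((1/2) ^ k * Bd)"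
      proof (rule ennreal_mult_plus)
        show "0 \<le> (\<Sum>m<k. (1/2) ^ m * ?i m)"
          by (intro sum_nonneg mult_nonneg_nonneg int0[OF x(1)]) simp
      qed (use C R(1) Bd0 in simp_all)
      also have "ennreal (\<Sum>m<k. (1/2) ^ m * ?i m) = (\<Sum>m<k. ennreal ((1/2) ^ m) * ennreal (?i m))"
        using int0[OF x(1)] by (simp add: sum_ennreal[symmetric] ennreal_mult)
      finally show ?thesis unfolding f_def cp int[OF x(1)] .
    qed
    have "(\<integral>\<^sup>+p\<in>?D. ennreal \<bar>F 0 p\<bar> \<partial>\<mu>) \<le> (\<integral>\<^sup>+p\<in>?D. f (coord c p) \<partial>\<mu>)"
      using pointwise by (intro nn_integral_mono) (auto simp: indicator_def)
    also have "\<dots> = (\<integral>\<^sup>+x. f x \<partial>\<sigma>)" by (rule \<sigma>(3)[OF fm, symmetric])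
    also have "\<dots> = ennreal (C / R ^ ?n) * (\<Sum>m<k. ennreal ((1/2) ^ m) * (\<integral>\<^sup>+x. G m x \<partial>\<sigma>))
        + ennreal ((1/2) ^ k * Bd) * emeasure \<sigma> (space \<sigma>)"
    proof -
      have G\<sigma>: "G m \<in> borel_measurable \<sigma>" for m using Gm by (simp add: measurable_cong_sets[OF \<sigma>(2) refl])
      have s\<sigma>: "(\<lambda>x. \<Sum>m<k. ennreal ((1/2) ^ m) * G m x) \<in> borel_measurable \<sigma>"
        using G\<sigma> by (intro borel_measurable_sum borel_measurable_times_ennreal borel_measurable_const)
      have "(\<integral>\<^sup>+x. f x \<partial>\<sigma>) = (\<integral>\<^sup>+x. ennreal (C / R ^ ?n) * (\<Sum>m<k. ennreal ((1/2) ^ m) * G m x) \<partial>\<sigma>)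
          + (\<integral>\<^sup>+x. ennreal ((1/2) ^ k * Bd) \<partial>\<sigma>)"
        unfolding f_def
        by (rule nn_integral_add[OF borel_measurable_times_ennreal[OF borel_measurable_const s\<sigma>] borel_measurable_const])
      also have "(\<integral>\<^sup>+x. ennreal (C / R ^ ?n) * (\<Sum>m<k. ennreal ((1/2) ^ m) * G m x) \<partial>\<sigma>)
          = ennreal (C / R ^ ?n) * (\<Sum>m<k. ennreal ((1/2) ^ m) * (\<integral>\<^sup>+x. G m x \<partial>\<sigma>))"
        unfolding nn_integral_cmult[OF s\<sigma>]
        by (subst nn_integral_sum)
           (use G\<sigma> in \<open>auto simp: nn_integral_cmult intro!: borel_measurable_times_ennreal\<close>)
      also have "(\<integral>\<^sup>+x. ennreal ((1/2) ^ k * Bd) \<partial>\<sigma>) = ennreal ((1/2) ^ k * Bd) * emeasure \<sigma> (space \<sigma>)"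
        by (rule nn_integral_const)
      finally show ?thesis .
    qed
    also have "\<dots> \<le> ennreal (C / R ^ ?n) * ennreal (2 * X) + ennreal ((1/2) ^ k * Bd) * ennreal (measure \<mu> UNIV)"
    proof (intro add_mono mult_left_mono zero_le)
      have "(\<Sum>m<k. ennreal ((1/2) ^ m) * (\<integral>\<^sup>+x. G m x \<partial>\<sigma>)) \<le> (\<Sum>m<k. ennreal ((1/2) ^ m) * ennreal X)"
        by (intro sum_mono mult_left_mono GX zero_le)
      also have "\<dots> = ennreal ((\<Sum>m<k. (1/2) ^ m) * X)"
        using X0 by (simp add: ennreal_mult[symmetric] sum_distrib_right sum_ennreal)
      also have "\<dots> \<le> ennreal (2 * X)"
        using X0 sum_half_powers_le[of k] by (intro ennreal_leI mult_right_mono)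
      finally show "(\<Sum>m<k. ennreal ((1/2) ^ m) * (\<integral>\<^sup>+x. G m x \<partial>\<sigma>)) \<le> ennreal (2 * X)" .
      interpret finite_measure \<mu> by fact
      have "emeasure \<sigma> (space \<sigma>) = (\<integral>\<^sup>+x. 1 \<partial>\<sigma>)" by simp
      also have "\<dots> = (\<integral>\<^sup>+p\<in>?D. 1 \<partial>\<mu>)" by (rule \<sigma>(3)) simp
      also have "\<dots> \<le> (\<integral>\<^sup>+p. 1 \<partial>\<mu>)" by (intro nn_integral_mono) (auto simp: indicator_def)
      also have "\<dots> = ennreal (measure \<mu> UNIV)" using spU emeasure_eq_measure[of UNIV] by simp
      finally show "emeasure \<sigma> (space \<sigma>) \<le> ennreal (measure \<mu> UNIV)" .
    qed
    also have "\<dots> = ennreal (C / R ^ ?n * (2 * X) + (1/2) ^ k * Bd * measure \<mu> UNIV)"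
    proof -
      have "ennreal ((1/2) ^ k * Bd) * ennreal (measure \<mu> UNIV) = ennreal ((1/2) ^ k * Bd * measure \<mu> UNIV)"
        using Bd0 by (intro ennreal_mult[symmetric]) auto
      moreover have "ennreal (C / R ^ ?n * (2 * X) + (1/2) ^ k * Bd * measure \<mu> UNIV)
          = ennreal (C / R ^ ?n) * ennreal (2 * X) + ennreal ((1/2) ^ k * Bd * measure \<mu> UNIV)"
        using C R(1) X0 Bd0 by (intro ennreal_mult_plus) auto
      ultimately show ?thesis by (simp only:)
    qed
    also have "C / R ^ ?n * (2 * X) = \<alpha> * (\<tau> * S) + \<beta> / \<tau> * \<Lambda> powr (real ?n - u)"
    proof -
      have "(N * (2 * R)) powr u / R ^ ?n = (2 * N) powr u * \<kappa> powr (u - real ?n) * \<Lambda> powr (real ?n - u)"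
      proof -
        have "(N * (2 * R)) powr u = (2 * N) powr u * R powr u"
          using N(1) R(1) by (subst powr_mult[symmetric]) (auto simp: mult_ac)
        moreover have "R powr u / R ^ ?n = R powr (u - real ?n)"
          using R(1) by (simp add: powr_diff powr_realpow)
        moreover have "R powr (u - real ?n) = \<kappa> powr (u - real ?n) * \<Lambda> powr (real ?n - u)"
        proof -
          have "R powr (u - real ?n) = \<kappa> powr (u - real ?n) / \<Lambda> powr (u - real ?n)"
            unfolding R_def using \<kappa>(1) \<Lambda> by (simp add: powr_divide)
          also have "\<dots> = \<kappa> powr (u - real ?n) * \<Lambda> powr (- (u - real ?n))"
            by (simp only: powr_minus divide_inverse)
          finally show ?thesis by simp
        qed
        ultimately show ?thesis by (metis mult.assoc times_divide_eq_right)
      qed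
      then have pw: "(N * (2 * R)) powr u = (2 * N) powr u * \<kappa> powr (u - real ?n) * \<Lambda> powr (real ?n - u) * R ^ ?n"
        using R(1) by (simp add: field_simps)
      show ?thesis
        unfolding X_def \<alpha>_def \<beta>_def pw t_def using R(1) \<tau> by (simp add: field_simps)
    qed
    finally show "(\<integral>\<^sup>+p\<in>?D. ennreal \<bar>eigen_sum lam e J a \<Lambda> 0 p\<bar> \<partial>\<mu>)
        \<le> ennreal (\<alpha> * (\<tau> * (\<Sum>j\<in>J. (a j)\<^sup>2)) + \<beta> / \<tau> * \<Lambda> powr (real ?n - u) + (1/2) ^ k * Bd * measure \<mu> UNIV)"
      by (simp only: F_def S_def)
  qed
qed

end

subsection \<open>Energy and correlation dimension\<close>

context riemannian
begin

text \<open>The radii \<open>r / 2\<close>, \<open>r\<close> and \<open>2 * r\<close> serve the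
  points of the covering, the integration balls about them, and the bounds on the
  coefficients.\<close>

lemma small_chart_ball:
  "\<exists>c x r. c \<in> A \<and> r > 0 \<and> cball x (2 * r) \<subseteq> coord_image c \<and>
    p \<in> dom_chart c \<inter> coord c -` ball x (r / 2)"
proof -
  obtain c where c: "c \<in> A" "p \<in> dom_chart c" using charts_cover by blast
  have "coord c p \<in> coord_image c" using c(2) by blast
  then obtain r where r: "r > 0" "cball (coord c p) r \<subseteq> coord_image c"
    using chart(2)[OF c(1)] unfolding open_contains_cball by blast
  have "c \<in> A \<and> r / 2 > 0 \<and> cball (coord c p) (2 * (r / 2)) \<subseteq> coord_image c \<and>
    p \<in> dom_chart c \<inter> coord c -` ball (coord c p) (r / 2 / 2)" using c r by simp
  then show ?thesis by blast
qed

text \<open>Compactness yields finitely many chart pieces; they may overlap, so the integral over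
  the manifold is bounded by the sum over the pieces. The constant is fixed before an eigenbasis is
  chosen.\<close>

lemma riesz_spectral_bound:
  assumes compact: "compact (UNIV :: 'm set)" and \<mu>: "finite_measure \<mu>" "sets \<mu> = sets borel"
    and u: "u > 0" and I: "riesz_energy A g u \<mu> < \<infinity>"
  shows "\<exists>C::real. \<forall>lam e. laplace_eigenbasis A g lam e \<longrightarrow>
    (\<forall>\<Lambda>\<ge>1. spectral_sum lam e \<mu> \<Lambda> \<le> ennreal (C * \<Lambda> powr (real CARD('n) - u)))"
proof -
  interpret finite_measure \<mu> by fact
  obtain c x r where cxr: "\<And>p. c p \<in> A" "\<And>p. r p > 0" "\<And>p. cball (x p) (2 * r p) \<subseteq> coord_image (c p)"
    "\<And>p. p \<in> dom_chart (c p) \<inter> coord (c p) -` ball (x p) (r p / 2)"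
    using small_chart_ball by metis
  define O' where "O' = (\<lambda>p. dom_chart (c p) \<inter> coord (c p) -` ball (x p) (r p / 2))"
  define D where "D = (\<lambda>p. inv_coord (c p) ` cball (x p) (r p / 2))"
  have op: "open (O' p)" for p
    unfolding O'_def using chart(1,3)[OF cxr(1)] by (intro continuous_open_preimage) auto
  have cov: "UNIV \<subseteq> (\<Union>p\<in>UNIV. O' p)" using cxr(4) unfolding O'_def by blast
  obtain P where P: "finite P" "UNIV \<subseteq> (\<Union>p\<in>P. O' p)"
    by (rule compactE_image[OF compact _ cov]) (simp_all add: op)
  have OD: "O' p \<subseteq> D p" for p
  proof
    fix q assume "q \<in> O' p"
    then have "coord (c p) q \<in> cball (x p) (r p / 2)" "inv_coord (c p) (coord (c p) q) = q"
      using chart(5)[OF cxr(1)] by (auto simp: O'_def)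
    then show "q \<in> D p" unfolding D_def by (metis imageI)
  qed
  have Dm: "D p \<in> sets borel" for p
  proof -
    have "cball (x p) (r p / 2) \<subseteq> cball (x p) (2 * r p)" using cxr(2)[of p] by (intro subset_cball) simp
    then show ?thesis unfolding D_def using local_measure(4)[OF cxr(1) compact_cball _ \<mu>] cxr(3) by blast
  qed
  \<comment> \<open>The conclusion of \<open>chart_energy_estimate\<close> as a predicate, so that
    \<open>\<alpha>\<close> and \<open>\<beta>\<close> can be chosen as functions of the
    point.\<close>
  define Q where "Q = (\<lambda>p \<alpha> \<beta>. \<forall>lam e J a \<Lambda> Bd k \<tau>. (\<forall>j. smooth_function A (e j)) \<longrightarrow>
      (\<forall>j p. - laplace_beltrami A g (e j) p = (lam j)\<^sup>2 * e j p) \<longrightarrow>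
      (\<forall>j. square_integrable vol (e j)) \<longrightarrow>
      (\<forall>i j. L2_inner vol (e i) (e j) = (if i = j then 1 else 0)) \<longrightarrow>
      finite J \<longrightarrow> \<Lambda> \<ge> 1 \<longrightarrow> (\<forall>j. j \<in> J \<longrightarrow> 0 \<le> lam j \<and> lam j \<le> \<Lambda>) \<longrightarrow>
      (\<forall>m p. \<bar>eigen_sum lam e J a \<Lambda> m p\<bar> \<le> Bd) \<longrightarrow> \<tau> > 0 \<longrightarrow>
      (\<integral>\<^sup>+q\<in>D p. ennreal \<bar>eigen_sum lam e J a \<Lambda> 0 q\<bar> \<partial>\<mu>)
        \<le> ennreal (\<alpha> * (\<tau> * (\<Sum>j\<in>J. (a j)\<^sup>2)) + \<beta> / \<tau> * \<Lambda> powr (real CARD('n) - u) + (1/2) ^ k * Bd * measure \<mu> UNIV))"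
  have "\<exists>\<alpha> \<beta>. \<alpha> \<ge> 0 \<and> \<beta> \<ge> 0 \<and> Q p \<alpha> \<beta>" for p
    by (rule chart_energy_estimate[OF cxr(1) cxr(3) cxr(2) \<mu> u I, of p], unfold Q_def D_def) blast
  then obtain \<alpha> \<beta> where \<alpha>\<beta>: "\<And>p. \<alpha> p \<ge> 0" "\<And>p. \<beta> p \<ge> 0" "\<And>p. Q p (\<alpha> p) (\<beta> p)"
    by metis
  \<comment> \<open>The summand 1 keeps the later division by \<open>\<A>\<close> safe when all
    \<open>\<alpha>\<close> vanish.\<close>
  define \<A> where "\<A> = (\<Sum>p\<in>P. \<alpha> p) + 1"
  define \<B> where "\<B> = (\<Sum>p\<in>P. \<beta> p)"
  have \<A>: "\<A> \<ge> 1" unfolding \<A>_def using \<alpha>\<beta>(1) by (simp add: sum_nonneg)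
  have \<B>: "\<B> \<ge> 0" unfolding \<B>_def using \<alpha>\<beta>(2) by (simp add: sum_nonneg)
  show ?thesis
  proof (intro exI[of _ "4 * \<A> * \<B>"] allI impI)
    fix lam e \<Lambda> assume basis: "laplace_eigenbasis A g lam e" and \<Lambda>: "(1::real) \<le> \<Lambda>"
    have e: "smooth_function A (e j)" and eig: "- laplace_beltrami A g (e j) p = (lam j)\<^sup>2 * e j p"
      and sq: "square_integrable vol (e j)" and orth: "L2_inner vol (e i) (e j) = (if i = j then 1 else 0)" for i j p
      using basis unfolding laplace_eigenbasis_def complete_orthonormal_basis_def by blast+
    have lam: "lam j \<ge> 0" for j
    proof (cases j)
      case 0
      then show ?thesis using basis by (simp add: laplace_eigenbasis_def)
    next
      case (Suc i)
      have "lam (Suc i) > 0"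
        by (induction i) (use basis in \<open>auto simp: laplace_eigenbasis_def intro: less_le_trans\<close>)
      then show ?thesis using Suc by simp
    qed
    define a where "a = (\<lambda>j. \<integral>x. e j x \<partial>\<mu>)"
    have econt: "continuous_on UNIV (e j)" for j by (rule smooth_function_continuous[OF e])
    have "\<exists>B. \<forall>p. \<bar>e j p\<bar> \<le> B" for j
    proof -
      have "bounded (range (e j))"
        by (rule compact_imp_bounded[OF compact_continuous_image[OF econt compact]])
      then show ?thesis by (auto simp: bounded_real)
    qed
    then obtain B where B: "\<And>j p. \<bar>e j p\<bar> \<le> B j" by metis
    have eint: "integrable \<mu> (e j)" for j
    proof (rule integrable_const_bound[of _ "B j"])
      show "e j \<in> borel_measurable \<mu>"
        using borel_measurable_continuous_onI[OF econt] by (simp add: measurable_cong_sets[OF \<mu>(2) refl])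
    qed (use B in auto)
    have bound: "(\<Sum>j\<in>J. (a j)\<^sup>2) \<le> 4 * \<A> * \<B> * \<Lambda> powr (real CARD('n) - u)"
      if J: "finite J" "J \<subseteq> {j. lam j \<le> \<Lambda>}" for J
    proof -
      define S where "S = (\<Sum>j\<in>J. (a j)\<^sup>2)"
      let ?F = "eigen_sum lam e J a \<Lambda>" and ?L = "\<Lambda> powr (real CARD('n) - u)"
      define Bd where "Bd = (\<Sum>j\<in>J. \<bar>a j\<bar> * B j)"
      have lamJ: "\<forall>j. j \<in> J \<longrightarrow> 0 \<le> lam j \<and> lam j \<le> \<Lambda>" using J lam by auto
      have Bd: "\<bar>?F m p\<bar> \<le> Bd" for m p
      proof -
        have "\<bar>?F m p\<bar> \<le> (\<Sum>j\<in>J. \<bar>a j * (lam j / \<Lambda>) ^ (2 * m) * e j p\<bar>)"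
          unfolding eigen_sum_def by (rule sum_abs)
        also have "\<dots> \<le> Bd"
          unfolding Bd_def
        proof (rule sum_mono)
          fix j assume "j \<in> J"
          then have q: "0 \<le> lam j / \<Lambda>" "lam j / \<Lambda> \<le> 1" using lamJ \<Lambda> by auto
          have "\<bar>a j * (lam j / \<Lambda>) ^ (2 * m) * e j p\<bar> = \<bar>a j\<bar> * (lam j / \<Lambda>) ^ (2 * m) * \<bar>e j p\<bar>"
            using q(1) by (simp add: abs_mult)
          also have "\<dots> \<le> \<bar>a j\<bar> * 1 * B j"
            using q B[of j p] by (intro mult_mono power_le_one) auto
          finally show "\<bar>a j * (lam j / \<Lambda>) ^ (2 * m) * e j p\<bar> \<le> \<bar>a j\<bar> * B j" by simp
        qed
        finally show ?thesis .
      qed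
      have Fcont: "continuous_on UNIV (?F 0)" by (rule eigen_sum_continuous[OF e])
      have F0: "?F 0 = (\<lambda>p. \<Sum>j\<in>J. a j * e j p)" by (simp add: eigen_sum_def[abs_def])
      have Fint: "integrable \<mu> (?F 0)"
        unfolding F0 by (intro Bochner_Integration.integrable_sum integrable_mult_right eint)
      have "(\<integral>p. ?F 0 p \<partial>\<mu>) = (\<Sum>j\<in>J. a j * (\<integral>p. e j p \<partial>\<mu>))"
        unfolding F0 by (subst Bochner_Integration.integral_sum) (simp_all add: eint)
      then have "(\<integral>p. ?F 0 p \<partial>\<mu>) = S"
        by (simp add: S_def power2_eq_square a_def)
      then have "S \<le> (\<integral>p. \<bar>?F 0 p\<bar> \<partial>\<mu>)"
        using integral_abs_bound[of \<mu> "?F 0"] by linarith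
      then have "ennreal S \<le> (\<integral>\<^sup>+p. ennreal \<bar>?F 0 p\<bar> \<partial>\<mu>)"
        using nn_integral_eq_integral[OF integrable_abs[OF Fint]] by (simp add: ennreal_leI)
      also have "\<dots> \<le> (\<integral>\<^sup>+p. (\<Sum>i\<in>P. ennreal \<bar>?F 0 p\<bar> * indicator (D i) p) \<partial>\<mu>)"
      proof (rule nn_integral_mono)
        fix p
        obtain i where i: "i \<in> P" "p \<in> D i" using P(2) OD by blast
        have "ennreal \<bar>?F 0 p\<bar> = ennreal \<bar>?F 0 p\<bar> * indicator (D i) p" using i by simp
        also have "\<dots> \<le> (\<Sum>i\<in>P. ennreal \<bar>?F 0 p\<bar> * indicator (D i) p)"
          using i(1) P(1) by (intro member_le_sum) auto
        finally show "ennreal \<bar>?F 0 p\<bar> \<le> (\<Sum>i\<in>P. ennreal \<bar>?F 0 p\<bar> * indicator (D i) p)" .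
      qed
      also have "\<dots> = (\<Sum>i\<in>P. \<integral>\<^sup>+p\<in>D i. ennreal \<bar>?F 0 p\<bar> \<partial>\<mu>)"
      proof (rule nn_integral_sum)
        fix i
        have "(\<lambda>p. ennreal \<bar>?F 0 p\<bar>) \<in> borel_measurable borel"
          using borel_measurable_continuous_onI[OF Fcont] by simp
        then have "(\<lambda>p. ennreal \<bar>?F 0 p\<bar> * indicator (D i) p) \<in> borel_measurable borel"
          using Dm[of i] by (intro borel_measurable_times_ennreal borel_measurable_indicator)
        then show "(\<lambda>p. ennreal \<bar>?F 0 p\<bar> * indicator (D i) p) \<in> borel_measurable \<mu>"
          by (simp add: measurable_cong_sets[OF \<mu>(2) refl])
      qed
      finally have total: "ennreal S \<le> (\<Sum>i\<in>P. \<integral>\<^sup>+p\<in>D i. ennreal \<bar>?F 0 p\<bar> \<partial>\<mu>)" .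
      have S0: "S \<ge> 0" by (simp add: S_def sum_nonneg)
      have Bd0: "Bd \<ge> 0" using Bd[of 0 undefined] by (meson abs_ge_zero order_trans)
      have "S \<le> 4 * \<A> * \<B> * ?L + (1/2) ^ k * (2 * (real (card P) * Bd * measure \<mu> UNIV))" for k
      proof -
        \<comment> \<open>Chosen so that the quadratic terms of all pieces add up to at most
          \<open>S / 2\<close>.\<close>
        define \<tau> where "\<tau> = 1 / (2 * \<A>)"
        have \<tau>: "\<tau> > 0" using \<A> by (simp add: \<tau>_def)
        let ?r = "\<lambda>i. \<alpha> i * (\<tau> * S) + \<beta> i / \<tau> * ?L + (1/2) ^ k * Bd * measure \<mu> UNIV"
        have "(\<integral>\<^sup>+p\<in>D i. ennreal \<bar>?F 0 p\<bar> \<partial>\<mu>) \<le> ennreal (?r i)" for i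
          using \<alpha>\<beta>(3)[of i] e eig sq orth J(1) \<Lambda> lamJ Bd \<tau> unfolding Q_def S_def by blast
        then have "ennreal S \<le> (\<Sum>i\<in>P. ennreal (?r i))"
          using total by (meson order_trans sum_mono)
        also have "\<dots> = ennreal (\<Sum>i\<in>P. ?r i)"
          using \<alpha>\<beta>(1,2) \<tau> S0 Bd0 by (intro sum_ennreal) simp
        finally have "S \<le> (\<Sum>i\<in>P. ?r i)"
          using \<alpha>\<beta>(1,2) \<tau> S0 Bd0 by (subst (asm) ennreal_le_iff) (auto intro!: sum_nonneg)
        also have "\<dots> = (\<A> - 1) * (\<tau> * S) + \<B> / \<tau> * ?L + real (card P) * ((1/2) ^ k * Bd * measure \<mu> UNIV)"
          unfolding \<A>_def \<B>_def by (simp add: sum.distrib sum_distrib_right sum_divide_distrib)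
        also have "\<dots> \<le> S / 2 + 2 * \<A> * \<B> * ?L + (1/2) ^ k * (real (card P) * Bd * measure \<mu> UNIV)"
        proof -
          have "(\<A> - 1) * (\<tau> * S) \<le> \<A> * (\<tau> * S)" using \<tau> S0 by (intro mult_right_mono) auto
          also have "\<dots> = S / 2" using \<A> by (simp add: \<tau>_def)
          finally have "(\<A> - 1) * (\<tau> * S) \<le> S / 2" .
          moreover have "\<B> / \<tau> * ?L = 2 * \<A> * \<B> * ?L" by (simp add: \<tau>_def)
          ultimately show ?thesis by (simp add: mult_ac)
        qed
        finally show ?thesis by (simp add: algebra_simps)
      qed
      moreover have "(\<lambda>k. 4 * \<A> * \<B> * ?L + (1/2) ^ k * (2 * (real (card P) * Bd * measure \<mu> UNIV)))
          \<longlonglongrightarrow> 4 * \<A> * \<B> * ?L + 0 * (2 * (real (card P) * Bd * measure \<mu> UNIV))"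
        by (intro tendsto_intros LIMSEQ_power_zero) simp
      ultimately have "S \<le> 4 * \<A> * \<B> * ?L + 0 * (2 * (real (card P) * Bd * measure \<mu> UNIV))"
        by (intro LIMSEQ_le_const) auto
      then show ?thesis by (simp add: S_def)
    qed
    show "spectral_sum lam e \<mu> \<Lambda> \<le> ennreal (4 * \<A> * \<B> * \<Lambda> powr (real CARD('n) - u))"
      unfolding spectral_sum_def
    proof (rule infsum_le_finite_sums)
      show "(\<lambda>j. ennreal (\<bar>\<integral>x. e j x \<partial>\<mu>\<bar>\<^sup>2)) summable_on {j. lam j \<le> \<Lambda>}"
        by (intro nonneg_summable_on_complete) simp
      fix J assume "finite J" "J \<subseteq> {j. lam j \<le> \<Lambda>}"
      from ennreal_leI[OF bound[OF this]]
      show "(\<Sum>j\<in>J. ennreal (\<bar>\<integral>x. e j x \<partial>\<mu>\<bar>\<^sup>2)) \<le> ennreal (4 * \<A> * \<B> * \<Lambda> powr (real CARD('n) - u))"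
        by (simp add: a_def sum_ennreal)
    qed
  qed
qed

end

text \<open>The distribution function vanishes by convention at radii where the sublevel set of the
  distance is not measurable; a positive correlation dimension excludes this at small radii.\<close>

lemma correlation_dimension_sublevel:
  assumes dim: "has_correlation_dimension A g \<mu> s" and s': "0 < s'" "s' < s"
  obtains b where "0 < b" "b < 1" "\<And>r. 0 < r \<Longrightarrow> r \<le> b \<Longrightarrow>
    {(x, y). riemannian_dist A g x y \<le> r} \<in> sets (\<mu> \<Otimes>\<^sub>M \<mu>) \<and>
    emeasure (\<mu> \<Otimes>\<^sub>M \<mu>) {(x, y). riemannian_dist A g x y \<le> r} \<le> ennreal (r powr s')"
proof -
  let ?F = "distance_distribution A g \<mu>"
  have "eventually (\<lambda>r. s' < ln (?F r) / ln r) (at_right 0)"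
    using dim s'(2) unfolding has_correlation_dimension_def by (rule order_tendstoD)
  then obtain b0 where b0: "b0 > 0" "\<And>r. 0 < r \<Longrightarrow> r < b0 \<Longrightarrow> s' < ln (?F r) / ln r"
    by (auto simp: eventually_at_right_field)
  \<comment> \<open>Radii below 1 make \<open>ln r\<close> negative, which reverses the inequality
    in \<open>lF\<close>; halving \<open>b0\<close> allows \<open>r = b\<close>.\<close>
  define b where "b = min (b0 / 2) (1 / 2)"
  show ?thesis
  proof (rule that[of b])
    show "0 < b" "b < 1" using b0 by (auto simp: b_def)
    fix r :: real assume r: "0 < r" "r \<le> b"
    let ?E = "{(x, y). riemannian_dist A g x y \<le> r}"
    have lr: "ln r < 0" using r by (auto simp: b_def)
    have s'r: "s' < ln (?F r) / ln r" using b0 r by (auto simp: b_def)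
    then have lF: "ln (?F r) < s' * ln r" using lr by (simp add: neg_less_divide_eq)
    \<comment> \<open>By the convention \<open>ln 0 = 0\<close> a vanishing value would make the
      quotient 0, which is not above \<open>s' > 0\<close>.\<close>
    have F0: "?F r \<noteq> 0"
    proof
      assume "?F r = 0"
      then show False using s'r s'(1) by simp
    qed
    then have F: "?F r > 0" unfolding distance_distribution_def by (simp add: order_less_le)
    have "?F r = exp (ln (?F r))" using F by simp
    also have "\<dots> \<le> exp (s' * ln r)" using lF by simp
    also have "\<dots> = r powr s'" using r(1) by (simp add: powr_def)
    finally have "?F r \<le> r powr s'" .
    moreover have "?E \<in> sets (\<mu> \<Otimes>\<^sub>M \<mu>)"
      using F0 measure_notin_sets unfolding distance_distribution_def by blast
    moreover have "emeasure (\<mu> \<Otimes>\<^sub>M \<mu>) ?E = ennreal (?F r)"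
      using F0 unfolding distance_distribution_def measure_def
      by (cases "emeasure (\<mu> \<Otimes>\<^sub>M \<mu>) ?E") auto
    ultimately show "?E \<in> sets (\<mu> \<Otimes>\<^sub>M \<mu>) \<and> emeasure (\<mu> \<Otimes>\<^sub>M \<mu>) ?E \<le> ennreal (r powr s')"
      by (simp add: ennreal_leI)
  qed
qed

text \<open>The least exponent at which \<open>b * (1/2) ^ k\<close> falls below \<open>d\<close> is
  positive because \<open>d \<le> b\<close>; its predecessor is the required
  \<open>k\<close>.\<close>

lemma dyadic_scale:
  fixes d b :: real
  assumes "0 < d" "d \<le> b"
  obtains k where "b * (1/2) ^ Suc k < d" "d \<le> b * (1/2) ^ k"
proof -
  have "\<exists>k. b * (1/2) ^ k < d"
  proof -
    have "b > 0" using assms by linarith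
    obtain k where "(1/2) ^ k < d / b" using real_arch_pow_inv[of "d / b" "1/2"] assms \<open>b > 0\<close> by auto
    then show ?thesis using \<open>b > 0\<close> by (auto simp: field_simps)
  qed
  then obtain k where k: "b * (1/2) ^ k < d" "\<And>j. j < k \<Longrightarrow> \<not> b * (1/2) ^ j < d"
    using exists_least_iff[of "\<lambda>k. b * (1/2) ^ k < d"] by auto
  then obtain j where "k = Suc j" using assms by (cases k) auto
  then show ?thesis using k(1) k(2)[of j] by (intro that[of j]) auto
qed

text \<open>For \<open>u < s' < s\<close> the kernel is dominated by a constant plus a weighted sum
  over dyadic sublevel sets, whose masses decay fast enough to beat the weights geometrically. The
  majorant is measurable for the product measure, so its iterated integral equals an integral over
  the product.\<close>

lemma riesz_energy_finite:
  assumes \<mu>: "finite_measure \<mu>" "sets \<mu> = sets (borel :: 'm::topological_space measure)"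
    and dim: "has_correlation_dimension A g \<mu> s" and u: "0 < u" "u < s"
  shows "riesz_energy A g u \<mu> < \<infinity>"
proof -
  interpret finite_measure \<mu> by fact
  define s' where "s' = (u + s) / 2"
  have s': "u < s'" "0 < s'" "s' < s" using u by (auto simp: s'_def)
  obtain b where b: "0 < b" "b < 1" and E: "\<And>r. 0 < r \<Longrightarrow> r \<le> b \<Longrightarrow>
    {(x, y). riemannian_dist A g x y \<le> r} \<in> sets (\<mu> \<Otimes>\<^sub>M \<mu>) \<and>
    emeasure (\<mu> \<Otimes>\<^sub>M \<mu>) {(x, y). riemannian_dist A g x y \<le> r} \<le> ennreal (r powr s')"
    by (rule correlation_dimension_sublevel[OF dim s'(2,3)]) blast
  define r where "r = (\<lambda>k::nat. b * (1/2) ^ k)"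
  define X where "X = (\<lambda>k. {(x, y). riemannian_dist A g x y \<le> r k})"
  \<comment> \<open>On the shell between \<open>r (Suc k)\<close> and \<open>r k\<close> the kernel
    is at most its value at the inner radius, hence the shifted index.\<close>
  define w where "w = (\<lambda>k. r (Suc k) powr (- u))"
  have r: "0 < r k" "r k \<le> b" for k using b by (auto simp: r_def mult_left_le power_le_one)
  have X: "X k \<in> sets (\<mu> \<Otimes>\<^sub>M \<mu>)" "emeasure (\<mu> \<Otimes>\<^sub>M \<mu>) (X k) \<le> ennreal (r k powr s')" for k
    using E[OF r] by (auto simp: X_def)
  have w0: "w k > 0" for k using r(1)[of "Suc k"] by (simp add: w_def)
  let ?h = "\<lambda>p. ennreal (b powr (- u)) + (\<Sum>k. ennreal (w k) * indicator (X k) p)"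
  have pointwise: "inverse (ennreal (riemannian_dist A g x y powr u)) \<le> ?h (x, y)" for x y
  proof -
    let ?d = "riemannian_dist A g x y"
    have inv: "inverse (ennreal (?d powr u)) = ennreal (?d powr (- u))" if "?d > 0"
      using that by (simp add: inverse_ennreal powr_minus)
    consider "?d \<le> 0" | "?d > b" | "0 < ?d" "?d \<le> b" by linarith
    then show ?thesis
    proof cases
      \<comment> \<open>Every sublevel set contains the pair and every weight is at least 1, so the
        majorant is infinite, as the kernel is at distance 0.\<close>
      case 1
      then have "(x, y) \<in> X k" for k using r(1)[of k] by (auto simp: X_def)
      then have sum: "(\<Sum>k. ennreal (w k) * indicator (X k) (x, y)) = (\<Sum>k. ennreal (w k))" by simp
      have w1: "w k \<ge> 1" for k
      proof -
        have "r (Suc k) \<le> 1" using r(2)[of "Suc k"] b by linarith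
        then have "r (Suc k) powr u \<le> 1" using r(1)[of "Suc k"] u(1) by (intro powr_le1) auto
        then show ?thesis using r(1)[of "Suc k"] by (simp add: w_def powr_minus one_le_inverse_iff)
      qed
      have "(\<Sum>k::nat. (1::ennreal)) \<le> (\<Sum>k. ennreal (w k))"
        using w1 by (intro suminf_le) (auto simp: ennreal_1[symmetric] simp del: ennreal_1 intro: ennreal_leI)
      moreover have "(\<Sum>k::nat. (1::ennreal)) = \<infinity>"
        using nn_integral_count_space_nat[of "\<lambda>_. 1"] by simp
      ultimately show ?thesis unfolding sum by (simp add: top_unique)
    next
      case 2
      then have "?d powr (- u) \<le> b powr (- u)" using b u by (intro powr_mono2') auto
      then show ?thesis using 2 b inv by (auto intro!: add_increasing2 ennreal_leI)
    next
      case 3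
      then obtain k where k: "r (Suc k) < ?d" "?d \<le> r k" unfolding r_def by (rule dyadic_scale)
      have "?d powr (- u) \<le> w k" unfolding w_def using k(1) r(1)[of "Suc k"] u by (intro powr_mono2') auto
      then have "ennreal (?d powr (- u)) \<le> ennreal (w k) * indicator (X k) (x, y)"
        using k(2) by (simp add: X_def ennreal_leI)
      also have "\<dots> = (\<Sum>j\<in>{k}. ennreal (w j) * indicator (X j) (x, y))"
        by (simp only: sum.insert finite.emptyI empty_iff not_False_eq_True sum.empty add_0_right)
      also have "\<dots> \<le> (\<Sum>j. ennreal (w j) * indicator (X j) (x, y))"
        by (rule sum_le_suminf) auto
      also have "\<dots> \<le> ?h (x, y)" by simp
      finally show ?thesis using inv 3 by simp
    qed
  qed
  have meas: "(\<lambda>p. \<Sum>k. ennreal (w k) * indicator (X k) p) \<in> borel_measurable (\<mu> \<Otimes>\<^sub>M \<mu>)"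
    using X(1) by (intro borel_measurable_suminf_order borel_measurable_times_ennreal borel_measurable_const borel_measurable_indicator)
  have "riesz_energy A g u \<mu> \<le> (\<integral>\<^sup>+x. (\<integral>\<^sup>+y. ?h (x, y) \<partial>\<mu>) \<partial>\<mu>)"
    unfolding riesz_energy_def by (intro nn_integral_mono pointwise)
  also have "\<dots> = (\<integral>\<^sup>+p. ?h p \<partial>(\<mu> \<Otimes>\<^sub>M \<mu>))"
    using meas by (intro nn_integral_fst borel_measurable_add borel_measurable_const)
  also have "\<dots> = ennreal (b powr (- u)) * emeasure (\<mu> \<Otimes>\<^sub>M \<mu>) (space (\<mu> \<Otimes>\<^sub>M \<mu>))
      + (\<Sum>k. ennreal (w k) * emeasure (\<mu> \<Otimes>\<^sub>M \<mu>) (X k))"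
    using X(1) meas
    by (subst nn_integral_add) (auto simp: nn_integral_suminf nn_integral_cmult_indicator)
  also have "\<dots> < \<infinity>"
  proof -
    have "emeasure (\<mu> \<Otimes>\<^sub>M \<mu>) (space (\<mu> \<Otimes>\<^sub>M \<mu>)) = emeasure \<mu> (space \<mu>) * emeasure \<mu> (space \<mu>)"
      unfolding space_pair_measure by (rule emeasure_pair_measure_Times) auto
    then have 1: "ennreal (b powr (- u)) * emeasure (\<mu> \<Otimes>\<^sub>M \<mu>) (space (\<mu> \<Otimes>\<^sub>M \<mu>)) < \<infinity>"
      by (simp add: emeasure_eq_measure ennreal_mult[symmetric] ennreal_mult_less_top)
    \<comment> \<open>The ratio of the dominating geometric series, below 1 because
      \<open>u < s'\<close>.\<close>
    define q where "q = (1/2 :: real) powr (s' - u)"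
    have q: "0 < q" "q < 1"
      unfolding q_def using s'(1) by (simp_all add: powr_def ln_div mult_less_0_iff)
    have weight: "w k * r k powr s' = 2 powr u * b powr (s' - u) * q ^ k" for k
    proof -
      have "r (Suc k) = r k / 2" by (simp add: r_def)
      then have "w k = r k powr (- u) / 2 powr (- u)" by (simp only: w_def powr_divide)
      also have "\<dots> = r k powr (- u) * 2 powr u"
        by (simp only: powr_minus[of 2 u] divide_inverse inverse_inverse_eq)
      finally have "w k * r k powr s' = 2 powr u * (r k powr (- u) * r k powr s')" by (simp only: mult_ac)
      also have "r k powr (- u) * r k powr s' = r k powr (s' - u)"
        by (simp only: powr_add[symmetric] add.commute[of "- u"] diff_conv_add_uminus)
      also have "r k powr (s' - u) = b powr (s' - u) * ((1/2) ^ k) powr (s' - u)"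
        unfolding r_def by (rule powr_mult)
      also have "((1/2::real) ^ k) powr (s' - u) = q ^ k"
        unfolding q_def by (simp add: powr_power powr_realpow[symmetric] powr_powr mult.commute)
      finally show ?thesis by simp
    qed
    have sm: "summable (\<lambda>k. w k * r k powr s')"
      unfolding weight using q by (intro summable_mult summable_geometric) auto
    have "(\<Sum>k. ennreal (w k) * emeasure (\<mu> \<Otimes>\<^sub>M \<mu>) (X k)) \<le> (\<Sum>k. ennreal (w k * r k powr s'))"
      using X(2) w0 by (intro suminf_le) (auto simp: ennreal_mult less_imp_le intro!: mult_left_mono)
    also have "\<dots> < \<infinity>"
      using sm w0 r(1) by (subst suminf_ennreal2) (auto simp: less_imp_le)
    finally have 2: "(\<Sum>k. ennreal (w k) * emeasure (\<mu> \<Otimes>\<^sub>M \<mu>) (X k)) < \<infinity>" .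
    from 1 2 show ?thesis by simp
  qed
  finally show ?thesis .
qed

theorem theorem1p6:
  fixes A :: "('m::{t2_space, second_countable_topology}, 'n::finite) chart set"
    and g :: "('m, 'n) metric_components"
    and \<mu> :: "'m measure"
  assumes "riemannian_manifold A g"
    and "compact (UNIV :: 'm set)"
    and "connected (UNIV :: 'm set)"
    and "CARD('n) \<ge> 2"
    and "finite_measure \<mu>"
    and "sets \<mu> = sets borel"
  shows "(\<forall>u. 0 < u \<and> u < real CARD('n) \<and> riesz_energy A g u \<mu> < \<infinity> \<longrightarrow>
           (\<exists>C1::real. \<forall>lam e. laplace_eigenbasis A g lam e \<longrightarrow>
              (\<forall>\<Lambda>\<ge>1. spectral_sum lam e \<mu> \<Lambda> \<le> ennreal (C1 * \<Lambda> powr (real CARD('n) - u))))) \<and>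
         (\<forall>s. 0 < s \<and> s < real CARD('n) \<and> has_correlation_dimension A g \<mu> s \<longrightarrow>
           (\<forall>u. 0 < u \<and> u < s \<longrightarrow> riesz_energy A g u \<mu> < \<infinity>) \<and>
           (\<forall>\<epsilon>>0. \<exists>C2::real. \<forall>lam e. laplace_eigenbasis A g lam e \<longrightarrow>
              (\<forall>\<Lambda>\<ge>1. spectral_sum lam e \<mu> \<Lambda> \<le> ennreal (C2 * \<Lambda> powr (real CARD('n) - s + \<epsilon>)))))"
proof -
  interpret riemannian A g by unfold_locales fact
  note bound = riesz_spectral_bound[OF assms(2,5,6)]
  have energy: "riesz_energy A g u \<mu> < \<infinity>" if "has_correlation_dimension A g \<mu> s" "0 < u" "u < s" for s u
    by (rule riesz_energy_finite[OF assms(5,6) that])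
  have second: "\<exists>C2::real. \<forall>lam e. laplace_eigenbasis A g lam e \<longrightarrow>
      (\<forall>\<Lambda>\<ge>1. spectral_sum lam e \<mu> \<Lambda> \<le> ennreal (C2 * \<Lambda> powr (real CARD('n) - s + \<epsilon>)))"
    if s: "0 < s" and dim: "has_correlation_dimension A g \<mu> s" and \<epsilon>: "\<epsilon> > 0" for s \<epsilon>
  proof -
    \<comment> \<open>The value \<open>s - \<epsilon>\<close> produces the exponent;
      \<open>s / 2\<close> keeps \<open>u\<close> positive when \<open>\<epsilon>\<close> is at
      least \<open>s\<close>.\<close>
    define u where "u = max (s - \<epsilon>) (s / 2)"
    have u: "0 < u" "u < s" "s - \<epsilon> \<le> u" using s \<epsilon> by (auto simp: u_def)
    obtain C where C: "\<And>lam e \<Lambda>. laplace_eigenbasis A g lam e \<Longrightarrow> \<Lambda> \<ge> 1 \<Longrightarrow>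
        spectral_sum lam e \<mu> \<Lambda> \<le> ennreal (C * \<Lambda> powr (real CARD('n) - u))"
      using bound[OF u(1) energy[OF dim u(1,2)]] by blast
    show ?thesis
    \<comment> \<open>The constant of the first part comes without a sign, and enlarging the power
      of \<open>\<Lambda>\<close> requires a nonnegative factor.\<close>
    proof (intro exI[of _ "\<bar>C\<bar>"] allI impI)
      fix lam e \<Lambda> assume basis: "laplace_eigenbasis A g lam e" and \<Lambda>: "(1::real) \<le> \<Lambda>"
      have "C * \<Lambda> powr (real CARD('n) - u) \<le> \<bar>C\<bar> * \<Lambda> powr (real CARD('n) - s + \<epsilon>)"
        using \<Lambda> u(3) by (intro mult_mono powr_mono) auto
      then show "spectral_sum lam e \<mu> \<Lambda> \<le> ennreal (\<bar>C\<bar> * \<Lambda> powr (real CARD('n) - s + \<epsilon>))"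
        using C[OF basis \<Lambda>] by (meson ennreal_leI order_trans)
    qed
  qed
  show ?thesis using bound energy second by blast
qed

end
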